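(* Let $\Sigma=\{(z,w)\in\mathbb{C}^n\times\mathbb{C}=\mathbb{C}^{n+1}:\operatorname{Im}w>|z|^2\}$ be the Siegel upper half space. Then $\Sigma$ admits a uniformly $C^\infty$ defining function and is strictly pseudoconvex, but $\Sigma$ is not uniformly strictly pseudoconvex. Moreover, for every $1\le q\le n-1$ and every $t\ge0$, the Folland-Kohn basic estimate on $(0,q)$-forms fails on $\Sigma$: there is no constant $C_t>0$ such that $$\int_{b\Sigma}|f|^2e^{-t|\zeta|^2}\,d\sigma\le C_t\big(\|\bar\partial f\|_t^2+\|\bar\partial^*_tf\|_t^2\big)$$ for all $(0,q)$-forms $f\in\mathrm{Dom}(\bar\partial)\cap\mathrm{Dom}(\bar\partial^*_t)$ on $\Sigma$, where $\zeta=(z,w)$.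
   Context: Let $\Omega\subset\mathbb{C}^N$ be a domain with boundary $b\Omega$ (here $\Omega=\Sigma$, $N=n+1$). A defining function for $\Omega$ is a real-valued function $\rho$ with $\Omega=\{\rho<0\}$ (on the domain of $\rho$) and $d\rho\ne0$ on $b\Omega$. A $C^m$ defining function $\rho$ defined on a neighborhood $U$ of $b\Omega$ is uniformly $C^m$ if $\mathrm{dist}(\partial\Omega,\partial U)>0$, $\|\rho\|_{C^m(U)}<\infty$ and $\inf_U|\nabla\rho|>0$; it is uniformly $C^\infty$ if, on $U$, it is uniformly $C^m$ for all $m\in\mathbb{N}$. At $p\in b\Omega$, $T^{1,0}_p(b\Omega)=\{L\in T^{1,0}_p(\mathbb{C}^N):\partial\rho(L)=0\}$. The normalized Levi form at $p$ is the restriction to $T^{1,0}_p(b\Omega)$ of the complex Hessian $\big(\partial^2\rho/\partial\zeta_j\partial\bar\zeta_k\big)$ of a defining function $\rho$ normalized so that $|d\rho|=1$ on $b\Omega$; its $N-1$ eigenvalues are taken with respect to the standard hermitian inner product of coefficient vectors ($L=\sum\xi_j\partial/\partial\zeta_j$, $\sum|\xi_j|^2$). $\Omega$ is strictly pseudoconvex if at every boundary point all eigenvalues of the normalized Levi form are positive, and uniformly strictly pseudoconvex if there is $\lambda>0$ such that at every boundary point all these eigenvalues are greater than $\lambda$. For $t\in\mathbb{R}$, $(f,g)_t=\int_\Omega\langle f,g\rangle e^{-t|\zeta|^2}\,dV$ is the inner product on $L^2_{0,q}(\Omega,e^{-t|\zeta|^2})$, the space of weighted square-integrable $(0,q)$-forms,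 where $\langle\cdot,\cdot\rangle$ is the standard pointwise inner product and $dV$ is Lebesgue measure; $\|f\|_t^2=(f,f)_t$. $\bar\partial:L^2_{0,q}(\Omega,e^{-t|\zeta|^2})\to L^2_{0,q+1}(\Omega,e^{-t|\zeta|^2})$ is the maximal closed extension of the Cauchy-Riemann operator, $\bar\partial^*_t:L^2_{0,q+1}(\Omega,e^{-t|\zeta|^2})\to L^2_{0,q}(\Omega,e^{-t|\zeta|^2})$ is its adjoint with respect to $(\cdot,\cdot)_t$ (for each degree $q$), and $d\sigma$ is the induced surface measure on $b\Omega$. In the boundary integral, $f$ on $b\Omega$ means the boundary values of $f$. *)

theory Defs
  imports "HOL-Analysis.Analysis" "HOL-Library.Option_ord"
begin

section \<open>Defining functions\<close>

fun Ck_on :: "nat \<Rightarrow> ('a::euclidean_space \<Rightarrow> 'b::real_normed_vector) \<Rightarrow> 'a set \<Rightarrow> bool" where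
  "Ck_on 0 f U \<longleftrightarrow> continuous_on U f"
| "Ck_on (Suc k) f U \<longleftrightarrow>
     (\<forall>x\<in>U. f differentiable (at x)) \<and> (\<forall>v. Ck_on k (\<lambda>x. frechet_derivative f (at x) v) U)"

definition grad :: "('a::euclidean_space \<Rightarrow> real) \<Rightarrow> 'a \<Rightarrow> 'a" where
  "grad f x = (\<Sum>b\<in>Basis. frechet_derivative f (at x) b *\<^sub>R b)"

fun iter_partial :: "('a::euclidean_space \<Rightarrow> real) \<Rightarrow> 'a list \<Rightarrow> 'a \<Rightarrow> real" where
  "iter_partial f [] = f"
| "iter_partial f (b # bs) = iter_partial (\<lambda>x. frechet_derivative f (at x) b) bs"

definition finite_Ck_norm :: "nat \<Rightarrow> ('a::euclidean_space \<Rightarrow> real) \<Rightarrow> 'a set \<Rightarrow> bool" where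
  "finite_Ck_norm m f U \<longleftrightarrow>
     (\<exists>B. \<forall>bs. set bs \<subseteq> Basis \<and> length bs \<le> m \<longrightarrow> (\<forall>x\<in>U. \<bar>iter_partial f bs x\<bar> \<le> B))"

definition Ck_defining_function ::
  "nat \<Rightarrow> ('a::euclidean_space \<Rightarrow> real) \<Rightarrow> 'a set \<Rightarrow> 'a set \<Rightarrow> bool" where
  "Ck_defining_function m \<rho> U \<Omega> \<longleftrightarrow>
     open U \<and> frontier \<Omega> \<subseteq> U \<and> Ck_on m \<rho> U \<and>
     \<Omega> \<inter> U = {x \<in> U. \<rho> x < 0} \<and> (\<forall>p\<in>frontier \<Omega>. grad \<rho> p \<noteq> 0)"

text \<open>The condition \<open>dist(b\<Omega>, bU) > 0\<close> is spelled out because \<^const>\<open>setdist\<close> is \<open>0\<close>, rather than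
  infinite, when \<open>bU\<close> is empty.\<close>

definition uniformly_Ck_defining_function ::
  "nat \<Rightarrow> ('a::euclidean_space \<Rightarrow> real) \<Rightarrow> 'a set \<Rightarrow> 'a set \<Rightarrow> bool" where
  "uniformly_Ck_defining_function m \<rho> U \<Omega> \<longleftrightarrow>
     Ck_defining_function m \<rho> U \<Omega> \<and>
     (\<exists>\<delta>>0. \<forall>x\<in>frontier \<Omega>. \<forall>y\<in>frontier U. \<delta> \<le> dist x y) \<and>
     finite_Ck_norm m \<rho> U \<and>
     (\<exists>c>0. \<forall>x\<in>U. c \<le> norm (grad \<rho> x))"

definition admits_uniformly_smooth_defining_function :: "'a::euclidean_space set \<Rightarrow> bool" where
  "admits_uniformly_smooth_defining_function \<Omega> \<longleftrightarrow>
     (\<exists>\<rho> U. \<forall>m. uniformly_Ck_defining_function m \<rho> U \<Omega>)"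


section \<open>The normalized Levi form\<close>

definition d_zeta :: "'m \<Rightarrow> (complex ^ 'm::finite \<Rightarrow> complex) \<Rightarrow> complex ^ 'm \<Rightarrow> complex" where
  "d_zeta j f \<zeta> =
     (frechet_derivative f (at \<zeta>) (axis j 1) - \<i> * frechet_derivative f (at \<zeta>) (axis j \<i>)) / 2"

definition d_zetabar :: "'m \<Rightarrow> (complex ^ 'm::finite \<Rightarrow> complex) \<Rightarrow> complex ^ 'm \<Rightarrow> complex" where
  "d_zetabar j f \<zeta> =
     (frechet_derivative f (at \<zeta>) (axis j 1) + \<i> * frechet_derivative f (at \<zeta>) (axis j \<i>)) / 2"

text \<open>A vector \<open>\<Sum>\<^sub>j \<xi>\<^sub>j \<partial>/\<partial>\<zeta>\<^sub>j\<close> of type \<open>(1,0)\<close> is identified with its coefficient vector \<open>\<xi>\<close>.\<close>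

definition T10 :: "(complex ^ 'm::finite \<Rightarrow> real) \<Rightarrow> complex ^ 'm \<Rightarrow> (complex ^ 'm) set" where
  "T10 \<rho> p = {\<xi>. (\<Sum>j\<in>UNIV. d_zeta j (\<lambda>\<zeta>. of_real (\<rho> \<zeta>)) p * \<xi> $ j) = 0}"

definition complex_hessian ::
  "(complex ^ 'm::finite \<Rightarrow> real) \<Rightarrow> complex ^ 'm \<Rightarrow> complex ^ 'm \<Rightarrow> complex ^ 'm \<Rightarrow> complex" where
  "complex_hessian \<rho> p \<xi> \<eta> =
     (\<Sum>j\<in>UNIV. \<Sum>k\<in>UNIV.
        d_zeta j (d_zetabar k (\<lambda>\<zeta>. of_real (\<rho> \<zeta>))) p * \<xi> $ j * cnj (\<eta> $ k))"

text \<open>Eigenvalues of the hermitian form obtained by restricting the complex Hessian to \<open>T\<^sup>1\<^sup>,\<^sup>0\<close>, with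
  respect to the standard hermitian inner product.\<close>

definition levi_eigenvalue ::
  "(complex ^ 'm::finite \<Rightarrow> real) \<Rightarrow> complex ^ 'm \<Rightarrow> real \<Rightarrow> bool" where
  "levi_eigenvalue \<rho> p \<mu> \<longleftrightarrow>
     (\<exists>\<xi>\<in>T10 \<rho> p. \<xi> \<noteq> 0 \<and>
        (\<forall>\<eta>\<in>T10 \<rho> p. complex_hessian \<rho> p \<xi> \<eta> = of_real \<mu> * (\<Sum>j\<in>UNIV. \<xi> $ j * cnj (\<eta> $ j))))"

definition normalized_defining_function ::
  "(complex ^ 'm::finite \<Rightarrow> real) \<Rightarrow> (complex ^ 'm) set \<Rightarrow> (complex ^ 'm) set \<Rightarrow> bool" where
  "normalized_defining_function \<rho> U \<Omega> \<longleftrightarrow>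
     Ck_defining_function 2 \<rho> U \<Omega> \<and> (\<forall>p\<in>frontier \<Omega>. norm (grad \<rho> p) = 1)"

text \<open>The normalized Levi form does not depend on the normalized defining function, so in the next
  two definitions it is computed from any one of them.\<close>

definition strictly_pseudoconvex :: "(complex ^ 'm::finite) set \<Rightarrow> bool" where
  "strictly_pseudoconvex \<Omega> \<longleftrightarrow>
     (\<exists>\<rho> U. normalized_defining_function \<rho> U \<Omega> \<and>
        (\<forall>p\<in>frontier \<Omega>. \<forall>\<mu>. levi_eigenvalue \<rho> p \<mu> \<longrightarrow> \<mu> > 0))"

definition uniformly_strictly_pseudoconvex :: "(complex ^ 'm::finite) set \<Rightarrow> bool" where
  "uniformly_strictly_pseudoconvex \<Omega> \<longleftrightarrow>
     (\<exists>\<rho> U. normalized_defining_function \<rho> U \<Omega> \<and>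
        (\<exists>c>0. \<forall>p\<in>frontier \<Omega>. \<forall>\<mu>. levi_eigenvalue \<rho> p \<mu> \<longrightarrow> \<mu> > c))"


section \<open>Weighted square-integrable forms and the Cauchy-Riemann operator\<close>

text \<open>A \<open>(0,q)\<close>-form is given by its coefficients \<open>f J\<close>, where the set \<open>J\<close> with \<open>card J = q\<close> stands for
  the strictly increasing multi-index of its elements; values \<open>f J\<close> with \<open>card J \<noteq> q\<close> are ignored.
  Square-integrable forms are represented by functions, not by classes modulo null sets.\<close>

type_synonym 'm form = "'m set \<Rightarrow> complex ^ 'm \<Rightarrow> complex"

definition weight :: "real \<Rightarrow> complex ^ 'm::finite \<Rightarrow> real" where
  "weight t \<zeta> = exp (- t * (norm \<zeta>)\<^sup>2)"

definition L2_form :: "(complex ^ 'm::finite) set \<Rightarrow> real \<Rightarrow> nat \<Rightarrow> 'm form \<Rightarrow> bool" where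
  "L2_form \<Omega> t q f \<longleftrightarrow>
     (\<forall>J. card J = q \<longrightarrow>
        set_borel_measurable lebesgue \<Omega> (f J) \<and>
        set_integrable lebesgue \<Omega> (\<lambda>\<zeta>. (cmod (f J \<zeta>))\<^sup>2 * weight t \<zeta>))"

definition L2_inner ::
  "(complex ^ 'm::finite) set \<Rightarrow> real \<Rightarrow> nat \<Rightarrow> 'm form \<Rightarrow> 'm form \<Rightarrow> complex" where
  "L2_inner \<Omega> t q f g =
     (LINT \<zeta>:\<Omega>|lebesgue. (\<Sum>J | card J = q. f J \<zeta> * cnj (g J \<zeta>)) * of_real (weight t \<zeta>))"

definition L2_norm_sq :: "(complex ^ 'm::finite) set \<Rightarrow> real \<Rightarrow> nat \<Rightarrow> 'm form \<Rightarrow> real" where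
  "L2_norm_sq \<Omega> t q f = Re (L2_inner \<Omega> t q f f)"

definition test_function :: "('a::euclidean_space) set \<Rightarrow> ('a \<Rightarrow> complex) \<Rightarrow> bool" where
  "test_function U \<phi> \<longleftrightarrow>
     (\<forall>k. Ck_on k \<phi> UNIV) \<and> (\<exists>K. compact K \<and> K \<subseteq> U \<and> (\<forall>x. x \<notin> K \<longrightarrow> \<phi> x = 0))"

text \<open>The sign in \<open>d\<zeta>bar\<^sub>k \<and> d\<zeta>bar\<^bsub>K - {k}\<^esub> = wedge_sign k K d\<zeta>bar\<^sub>K\<close> for \<open>k \<in> K\<close>.\<close>

definition wedge_sign :: "'m::linorder \<Rightarrow> 'm set \<Rightarrow> complex" where
  "wedge_sign k K = (-1) ^ card {j \<in> K. j < k}"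

text \<open>The maximal closed extension: \<open>g\<close> is the distributional \<open>\<partial>bar f\<close> on \<open>\<Omega>\<close>, and both are in the
  weighted spaces.\<close>

definition has_dbar ::
  "(complex ^ 'm::{finite,linorder}) set \<Rightarrow> real \<Rightarrow> nat \<Rightarrow> 'm form \<Rightarrow> 'm form \<Rightarrow> bool" where
  "has_dbar \<Omega> t q f g \<longleftrightarrow>
     L2_form \<Omega> t q f \<and> L2_form \<Omega> t (Suc q) g \<and>
     (\<forall>K \<phi>. card K = Suc q \<and> test_function \<Omega> \<phi> \<longrightarrow>
        (LINT \<zeta>:\<Omega>|lebesgue. g K \<zeta> * \<phi> \<zeta>) =
        - (LINT \<zeta>:\<Omega>|lebesgue. \<Sum>k\<in>K. wedge_sign k K * f (K - {k}) \<zeta> * d_zetabar k \<phi> \<zeta>))"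

text \<open>\<open>u\<close> is the value at the \<open>(0,q+1)\<close>-form \<open>f\<close> of the Hilbert space adjoint of \<open>\<partial>bar\<close> acting on
  \<open>(0,q)\<close>-forms.\<close>

definition has_dbar_adjoint ::
  "(complex ^ 'm::{finite,linorder}) set \<Rightarrow> real \<Rightarrow> nat \<Rightarrow> 'm form \<Rightarrow> 'm form \<Rightarrow> bool" where
  "has_dbar_adjoint \<Omega> t q f u \<longleftrightarrow>
     L2_form \<Omega> t (Suc q) f \<and> L2_form \<Omega> t q u \<and>
     (\<forall>v g. has_dbar \<Omega> t q v g \<longrightarrow> L2_inner \<Omega> t (Suc q) g f = L2_inner \<Omega> t q v u)"


section \<open>Boundary values and the basic estimate\<close>

text \<open>\<open>\<sigma>\<close> is the surface measure of \<open>b\<Omega>\<close>. A form in the intersection of the domains of \<open>\<partial>bar\<close> and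
  its adjoint need not be continuous up to the boundary, so boundary values are taken in the sense
  of distributions: the averages of \<open>f\<close> over the thin layers \<open>{-\<epsilon> < \<rho> < 0}\<close>, weighted by
  \<open>|grad \<rho>|\<close> as in the coarea formula, converge weakly to \<open>b\<close>. For \<open>f\<close> continuous up to the boundary
  \<open>b\<close> is the restriction of the extension to \<open>b\<Omega>\<close>, and for \<open>f\<close> in a Sobolev space \<open>W\<^sup>1\<close> it is the
  usual trace. The limit does not depend on the choice of \<open>\<rho>\<close>.\<close>

definition has_boundary_values ::
  "(complex ^ 'm::finite) set \<Rightarrow> (complex ^ 'm) measure \<Rightarrow> nat \<Rightarrow> 'm form \<Rightarrow> 'm form \<Rightarrow> bool" where
  "has_boundary_values \<Omega> \<sigma> q f b \<longleftrightarrow>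
     (\<exists>\<rho> U. (\<forall>m. Ck_defining_function m \<rho> U \<Omega>) \<and>
        (\<forall>J. card J = q \<longrightarrow>
           set_borel_measurable \<sigma> (frontier \<Omega>) (b J) \<and>
           (\<forall>\<psi>. test_function U \<psi> \<longrightarrow>
              set_integrable \<sigma> (frontier \<Omega>) (\<lambda>p. b J p * \<psi> p) \<and>
              ((\<lambda>\<epsilon>. (LINT \<zeta>:{\<zeta> \<in> \<Omega> \<inter> U. - \<epsilon> < \<rho> \<zeta>}|lebesgue.
                        f J \<zeta> * \<psi> \<zeta> * of_real (norm (grad \<rho> \<zeta>))) / of_real \<epsilon>)
                \<longlongrightarrow> (LINT p:frontier \<Omega>|\<sigma>. b J p * \<psi> p)) (at_right 0))))"

text \<open>Only meaningful for \<open>q \<ge> 1\<close>. The boundary integral is a nonnegative integral, so it may be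
  infinite, in which case the inequality does not hold.\<close>

definition basic_estimate ::
  "(complex ^ 'm::{finite,linorder}) set \<Rightarrow> (complex ^ 'm::_) measure \<Rightarrow> nat \<Rightarrow> real \<Rightarrow> real \<Rightarrow> bool" where
  "basic_estimate \<Omega> \<sigma> q t C \<longleftrightarrow>
     (\<forall>f g u b.
        has_dbar \<Omega> t q f g \<and> has_dbar_adjoint \<Omega> t (q - 1) f u \<and> has_boundary_values \<Omega> \<sigma> q f b \<longrightarrow>
        (\<integral>\<^sup>+p\<in>frontier \<Omega>. ennreal ((\<Sum>J | card J = q. (cmod (b J p))\<^sup>2) * weight t p) \<partial>\<sigma>)
          \<le> ennreal (C * (L2_norm_sq \<Omega> t (q + 1) g + L2_norm_sq \<Omega> t (q - 1) u)))"


section \<open>The Siegel upper half space\<close>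

text \<open>A point \<open>(z,w)\<close> of \<open>\<complex>\<^sup>n \<times> \<complex>\<close> is the vector with coordinates \<open>z\<^sub>j\<close> at \<^term>\<open>Some j\<close> and \<open>w\<close> at
  \<^const>\<open>None\<close>. In the order on the indices \<^const>\<open>None\<close> comes first; this only affects the signs of
  the basis forms.\<close>

definition siegel :: "(complex ^ ('n::finite option)) set" where
  "siegel = {\<zeta>. Im (\<zeta> $ None) > (norm (\<chi> j. \<zeta> $ Some j))\<^sup>2}"

text \<open>The surface measure of the graph \<open>Im w = h(z, Re w)\<close>.\<close>

definition graph_point ::
  "((complex ^ 'n::finite) \<times> real \<Rightarrow> real) \<Rightarrow> (complex ^ 'n) \<times> real \<Rightarrow> complex ^ ('n option)" where
  "graph_point h = (\<lambda>(z, x). \<chi> i. case i of None \<Rightarrow> Complex x (h (z, x)) | Some j \<Rightarrow> z $ j)"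

definition graph_surface_measure ::
  "((complex ^ 'n::finite) \<times> real \<Rightarrow> real) \<Rightarrow> (complex ^ ('n option)) measure" where
  "graph_surface_measure h =
     distr (density lborel (\<lambda>y. ennreal (sqrt (1 + (norm (grad h y))\<^sup>2)))) borel (graph_point h)"

definition siegel_surface_measure :: "(complex ^ ('n::finite option)) measure" where
  "siegel_surface_measure = graph_surface_measure (\<lambda>(z, x). (norm z)\<^sup>2)"

end

theory Submission
  imports Defs
begin

text \<open>Put \<open>r = |z|\<^sup>2 - Im w\<close> and \<open>s = |grad r| = sqrt (1 + 4|z|\<^sup>2)\<close>. The quotient \<open>r/s\<close> is a normalized
  defining function whose derivatives of all orders are bounded near the boundary. For every
  normalized defining function the Levi form on the complex tangent space is \<open>|\<xi>\<^sub>z|\<^sup>2 / s\<close>: the boundary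
  contains the curves \<open>p + a X + a\<^sup>2 |X\<^sub>z|\<^sup>2 i e\<^sub>w\<close> with \<open>X\<close> tangent at \<open>p\<close>. It is positive, but tends to \<open>0\<close>
  as \<open>|z| \<rightarrow> \<infinity>\<close>.

  For the basic estimate fix \<open>P\<close> with \<open>q + 1\<close> elements, possible since \<open>q \<le> n - 1\<close>, and contract
  \<open>dzbar\<^sub>P\<close> with \<open>\<Sum> zbar\<^sub>l \<partial>/\<partial>zbar\<^sub>l\<close>. The resulting \<open>(0,q)\<close>-form has no \<open>dwbar\<close>-component, antiholomorphic
  coefficients, and is tangential to every level set of \<open>r\<close>, so its smooth multiples are in the domain
  of the adjoint. Multiply it by a cut-off and by the holomorphic function \<open>exp (i N w')\<close>, where \<open>w'\<close> is
  the last coordinate in the Heisenberg frame centred at the boundary point \<open>(R e\<^sub>j, i R\<^sup>2)\<close>,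
  \<open>j \<in> P\<close>, and \<open>N = R\<^sup>8\<close>. Since \<open>|exp (i N w')| \<le> exp (N r)\<close>, integration across the boundary gains \<open>1/N\<close>,
  while the squares of \<open>\<partial>bar f\<close> and of its adjoint are \<open>O(N |f|\<^sup>2)\<close>: the right-hand side of the estimate is
  comparable to the integral of \<open>|f|\<^sup>2\<close> in the coordinates \<open>(z, Re w)\<close>. The left-hand side carries the
  additional density \<open>s \<ge> R\<close> of the surface measure, and \<open>R\<close> is arbitrary.\<close>

section \<open>Smooth functions\<close>

text \<open>The weight dictates the scales. Near the centre \<open>|w|\<close> is about
  \<open>R\<^sup>2\<close>, so a displacement \<open>d\<close> in \<open>z\<close> and
  \<open>h\<close> in the Heisenberg coordinate changes \<open>|\<zeta>|\<^sup>2\<close> by terms of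
  order \<open>R ^ 3 * d\<close> and \<open>R\<^sup>2 * h\<close>. The support must shrink as
  \<open>R\<close> grows if the weight is to be compared on both sides with a factor independent of
  \<open>R\<close>. Shrinking makes the cut-off steep, but a gradient up to the square root of
  \<open>N\<close> costs nothing: its square is absorbed by the gain \<open>1 / N\<close>. For
  \<open>N = R ^ 8\<close> this root is \<open>R ^ 4\<close>, above the \<open>R ^ 3\<close> that
  the weight demands. Volume and weight are then common factors of both sides. A form with constant
  coefficients would not be tangential. The contraction is, and since contracting it once more gives
  0 identically, three terms vanish together: the normal component, the derivative of order
  \<open>N\<close> of the peak, and the derivative of the weight.\<close>

definition smooth :: "('a::euclidean_space \<Rightarrow> 'b::real_normed_vector) \<Rightarrow> bool" where
  "smooth f \<longleftrightarrow> (\<forall>k. Ck_on k f UNIV)"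

lemma Ck_on_SucD: "Ck_on (Suc k) f U \<Longrightarrow> Ck_on k f U"
proof (induction k arbitrary: f)
  case 0
  then show ?case
    by (auto intro!: continuous_at_imp_continuous_on differentiable_imp_continuous_within)
next
  case (Suc k)
  from Suc.prems have "\<forall>x\<in>U. f differentiable (at x)"
    "\<And>v. Ck_on (Suc k) (\<lambda>x. frechet_derivative f (at x) v) U"
    unfolding Ck_on.simps(2)[of "Suc k"] by blast+
  with Suc.IH show ?case unfolding Ck_on.simps(2) by blast
qed

lemma smooth_Ck: "smooth f \<Longrightarrow> Ck_on k f UNIV"
  by (simp add: smooth_def)

lemma smooth_differentiable: "smooth f \<Longrightarrow> f differentiable (at x)"
  using smooth_Ck[of f "Suc 0"] by simp

lemma smooth_has_derivative: "smooth f \<Longrightarrow> (f has_derivative frechet_derivative f (at x)) (at x)"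
  by (simp add: frechet_derivative_works[symmetric] smooth_differentiable)

lemma smooth_frechet_derivative: "smooth f \<Longrightarrow> smooth (\<lambda>x. frechet_derivative f (at x) v)"
  unfolding smooth_def
proof
  fix k assume "\<forall>k. Ck_on k f UNIV"
  then have "Ck_on (Suc k) f UNIV" ..
  then show "Ck_on k (\<lambda>x. frechet_derivative f (at x) v) UNIV"
    unfolding Ck_on.simps(2) by blast
qed

lemma smooth_continuous_on: "smooth f \<Longrightarrow> continuous_on S f"
  using smooth_Ck[of f 0] continuous_on_subset by auto

lemma Ck_on_add:
  "Ck_on k f UNIV \<Longrightarrow> Ck_on k g UNIV \<Longrightarrow> Ck_on k (\<lambda>x. f x + g x) UNIV"
proof (induction k arbitrary: f g)
  case (Suc k)
  have *: "((\<lambda>x. f x + g x) has_derivative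
      (\<lambda>h. frechet_derivative f (at x) h + frechet_derivative g (at x) h)) (at x)" for x
    using Suc.prems by (intro has_derivative_add) (auto simp: frechet_derivative_works[symmetric])
  have "frechet_derivative (\<lambda>x. f x + g x) (at x) v
      = frechet_derivative f (at x) v + frechet_derivative g (at x) v" for x v
    using frechet_derivative_at[OF *] by metis
  with Suc show ?case by auto
qed (auto intro: continuous_intros)

lemma Ck_on_linear:
  assumes "bounded_linear L"
  shows "Ck_on k f UNIV \<Longrightarrow> Ck_on k (\<lambda>x. L (f x)) UNIV"
proof (induction k arbitrary: f)
  case 0
  then show ?case using bounded_linear.continuous_on[OF assms] by simp
next
  case (Suc k)
  have *: "((\<lambda>x. L (f x)) has_derivative (\<lambda>h. L (frechet_derivative f (at x) h))) (at x)" for x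
    using Suc.prems by (intro bounded_linear.has_derivative[OF assms])
      (auto simp: frechet_derivative_works[symmetric])
  have "frechet_derivative (\<lambda>x. L (f x)) (at x) v = L (frechet_derivative f (at x) v)" for x v
    using frechet_derivative_at[OF *] by metis
  with Suc * show ?case by (auto simp: differentiable_def)
qed

text \<open>One Leibniz induction serves \<open>mult\<close>, \<open>scaleR\<close> and
  \<open>inner\<close>. Both \<open>f\<close> and \<open>g\<close> are generalised because each term
  of the derivative has one of them replaced by its own derivative.\<close>

lemma Ck_on_bilinear:
  assumes "bounded_bilinear mul"
  shows "Ck_on k f UNIV \<Longrightarrow> Ck_on k g UNIV \<Longrightarrow> Ck_on k (\<lambda>x. mul (f x) (g x)) UNIV"
proof (induction k arbitrary: f g)
  case 0
  then show ?case using bounded_bilinear.continuous_on[OF assms] by auto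
next
  case (Suc k)
  have *: "((\<lambda>x. mul (f x) (g x)) has_derivative
      (\<lambda>h. mul (f x) (frechet_derivative g (at x) h) + mul (frechet_derivative f (at x) h) (g x))) (at x)" for x
    using Suc.prems by (intro bounded_bilinear.FDERIV[OF assms])
      (auto simp: frechet_derivative_works[symmetric])
  have "frechet_derivative (\<lambda>x. mul (f x) (g x)) (at x) v =
     mul (f x) (frechet_derivative g (at x) v) + mul (frechet_derivative f (at x) v) (g x)" for x v
    using frechet_derivative_at[OF *] by metis
  moreover have "Ck_on k (\<lambda>x. mul (f x) (frechet_derivative g (at x) v)
      + mul (frechet_derivative f (at x) v) (g x)) UNIV" for v
    using Suc.prems Ck_on_SucD[OF Suc.prems(1)] Ck_on_SucD[OF Suc.prems(2)]
    by (intro Ck_on_add Suc.IH) auto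
  moreover have "(\<lambda>x. mul (f x) (g x)) differentiable (at x)" for x
    using * differentiable_def by blast
  ultimately show ?case by simp
qed

text \<open>With a real variable in between, the chain rule is a \<open>scaleR\<close> product, so
  \<open>Ck_on_bilinear\<close> applies. Only the outer function changes in the induction.\<close>

lemma Ck_on_compose_real:
  fixes g :: "real \<Rightarrow> 'b::real_normed_vector" and f :: "'a::euclidean_space \<Rightarrow> real"
  shows "Ck_on k g UNIV \<Longrightarrow> Ck_on k f UNIV \<Longrightarrow> Ck_on k (\<lambda>x. g (f x)) UNIV"
proof (induction k arbitrary: g)
  case 0
  then show ?case using continuous_on_compose2[of UNIV g UNIV f] by simp
next
  case (Suc k)
  have *: "((\<lambda>x. g (f x)) has_derivative
      (\<lambda>h. frechet_derivative f (at x) h *\<^sub>R frechet_derivative g (at (f x)) 1)) (at x)" for x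
  proof -
    have g: "(g has_derivative frechet_derivative g (at (f x))) (at (f x))"
      and f: "(f has_derivative frechet_derivative f (at x)) (at x)"
      using Suc.prems by (auto simp: frechet_derivative_works[symmetric])
    have "frechet_derivative g (at (f x)) h = h *\<^sub>R frechet_derivative g (at (f x)) 1" for h
      using linear_cmul[OF has_derivative_linear[OF g], of h 1] by simp
    then show ?thesis
      by (intro has_derivative_eq_rhs[OF has_derivative_compose[OF f g]] ext)
  qed
  have "frechet_derivative (\<lambda>x. g (f x)) (at x) v =
     frechet_derivative f (at x) v *\<^sub>R frechet_derivative g (at (f x)) 1" for x v
    using frechet_derivative_at[OF *] by metis
  moreover have "Ck_on k (\<lambda>x. frechet_derivative g (at (f x)) 1) UNIV"
    using Suc.prems Ck_on_SucD[OF Suc.prems(2)] by (intro Suc.IH) auto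
  then have "Ck_on k (\<lambda>x. frechet_derivative f (at x) v *\<^sub>R frechet_derivative g (at (f x)) 1) UNIV" for v
    using Suc.prems(2) by (intro Ck_on_bilinear[OF bounded_bilinear_scaleR]) auto
  moreover have "(\<lambda>x. g (f x)) differentiable (at x)" for x
    using * differentiable_def by blast
  ultimately show ?case by simp
qed

text \<open>The exponential is its own derivative, so the induction hypothesis applies to the same
  \<open>f\<close>, with one order less.\<close>

lemma Ck_on_exp:
  fixes f :: "'a::euclidean_space \<Rightarrow> complex"
  shows "Ck_on k f UNIV \<Longrightarrow> Ck_on k (\<lambda>x. exp (f x)) UNIV"
proof (induction k)
  case 0
  then show ?case by (auto intro: continuous_intros)
next
  case (Suc k)
  have *: "((\<lambda>x. exp (f x)) has_derivative (\<lambda>h. exp (f x) * frechet_derivative f (at x) h)) (at x)" for x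
    using Suc.prems
    by (intro has_derivative_compose[where g=exp, OF _ has_field_derivative_imp_has_derivative[OF DERIV_exp]])
      (auto simp: frechet_derivative_works[symmetric])
  have "frechet_derivative (\<lambda>x. exp (f x)) (at x) v = exp (f x) * frechet_derivative f (at x) v" for x v
    using frechet_derivative_at[OF *] by metis
  moreover have "Ck_on k (\<lambda>x. exp (f x) * frechet_derivative f (at x) v) UNIV" for v
    using Suc.prems Suc.IH[OF Ck_on_SucD[OF Suc.prems]] by (intro Ck_on_bilinear[OF bounded_bilinear_mult]) auto
  moreover have "(\<lambda>x. exp (f x)) differentiable (at x)" for x
    using * differentiable_def by blast
  ultimately show ?case by simp
qed

lemma Ck_on_const: "Ck_on k (\<lambda>x. c) UNIV"
  by (induction k arbitrary: c) auto

lemma smooth_const: "smooth (\<lambda>x. c)"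
  by (simp add: smooth_def Ck_on_const)

lemma smooth_linear:
  assumes "bounded_linear L" shows "smooth L"
  unfolding smooth_def
proof
  fix k show "Ck_on k L UNIV"
  proof (cases k)
    case 0
    then show ?thesis using assms by (simp add: linear_continuous_on)
  next
    case (Suc m)
    then show ?thesis using bounded_linear.has_derivative[OF assms has_derivative_ident]
      frechet_derivative_at[OF bounded_linear.has_derivative[OF assms has_derivative_ident]]
      by (auto simp: differentiable_def) (metis Ck_on_const)
  qed
qed

lemma smooth_add: "smooth f \<Longrightarrow> smooth g \<Longrightarrow> smooth (\<lambda>x. f x + g x)"
  by (simp add: smooth_def Ck_on_add)

lemma smooth_linear_compose: "bounded_linear L \<Longrightarrow> smooth f \<Longrightarrow> smooth (\<lambda>x. L (f x))"
  by (simp add: smooth_def Ck_on_linear)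

lemma smooth_mult:
  fixes f :: "'a::euclidean_space \<Rightarrow> 'b::real_normed_algebra"
  shows "smooth f \<Longrightarrow> smooth g \<Longrightarrow> smooth (\<lambda>x. f x * g x)"
  by (simp add: smooth_def Ck_on_bilinear[OF bounded_bilinear_mult])

lemma smooth_inner: "smooth f \<Longrightarrow> smooth g \<Longrightarrow> smooth (\<lambda>x. inner (f x) (g x))"
  by (simp add: smooth_def Ck_on_bilinear[OF bounded_bilinear_inner])

lemma smooth_compose_real:
  fixes f :: "'a::euclidean_space \<Rightarrow> real"
  shows "smooth g \<Longrightarrow> smooth f \<Longrightarrow> smooth (\<lambda>x. g (f x))"
  by (simp add: smooth_def Ck_on_compose_real)

lemma smooth_exp:
  fixes f :: "'a::euclidean_space \<Rightarrow> complex"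
  shows "smooth f \<Longrightarrow> smooth (\<lambda>x. exp (f x))"
  by (simp add: smooth_def Ck_on_exp)

lemma smooth_minus: "smooth f \<Longrightarrow> smooth (\<lambda>x. - f x)"
  by (rule smooth_linear_compose[OF bounded_linear_minus[OF bounded_linear_ident]])

lemma smooth_diff: "smooth f \<Longrightarrow> smooth g \<Longrightarrow> smooth (\<lambda>x. f x - g x)"
  using smooth_add[OF _ smooth_minus] by force

lemma smooth_cnj: "smooth f \<Longrightarrow> smooth (\<lambda>x. cnj (f x))"
  by (rule smooth_linear_compose[OF bounded_linear_cnj])

lemma smooth_of_real: "smooth f \<Longrightarrow> smooth (\<lambda>x. complex_of_real (f x))"
  by (rule smooth_linear_compose[OF bounded_linear_of_real])

lemma smooth_sum: "(\<And>i. i \<in> I \<Longrightarrow> smooth (f i)) \<Longrightarrow> smooth (\<lambda>x. \<Sum>i\<in>I. f i x)"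
  by (induction I rule: infinite_finite_induct) (auto intro: smooth_add smooth_const)

lemma smooth_component: "smooth (\<lambda>x::complex^'m::finite. x $ i)"
  by (rule smooth_linear[OF bounded_linear_vec_nth])

lemma smooth_norm_power2: "smooth f \<Longrightarrow> smooth (\<lambda>x. (norm (f x))\<^sup>2)"
  for f :: "'a::euclidean_space \<Rightarrow> 'b::real_inner"
  by (simp add: power2_norm_eq_inner smooth_inner)

lemmas smooth_intros = smooth_const smooth_add smooth_mult smooth_minus smooth_diff smooth_cnj
  smooth_of_real smooth_exp smooth_sum smooth_component smooth_inner smooth_norm_power2

text \<open>For \<open>k = 0\<close> this is the classical flat function. The powers of
  \<open>1 / x\<close> are included to obtain a family closed under differentiation, so that
  smoothness of all its members is a single induction.\<close>

definition bump :: "nat \<Rightarrow> real \<Rightarrow> real" where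
  "bump k x = (if 0 < x then (1 / x) ^ k * exp (- (1 / x)) else 0)"

text \<open>Substituting \<open>1 / x\<close> turns the limit from the right into that of a power
  over the exponential at infinity.\<close>

lemma bump_tendsto_0: "(bump k \<longlongrightarrow> 0) (at 0)"
proof -
  have "((\<lambda>x::real. x ^ k / exp x) \<longlongrightarrow> 0) at_top"
    by (rule tendsto_power_div_exp_0)
  then have "((\<lambda>x::real. inverse x ^ k / exp (inverse x)) \<longlongrightarrow> 0) (at_right 0)"
    using filterlim_compose filterlim_inverse_at_top_right by blast
  then have "(bump k \<longlongrightarrow> 0) (at_right 0)"
    by (rule Lim_transform_eventually)
      (auto simp: eventually_at_right_less bump_def exp_minus divide_simps inverse_eq_divide
         intro!: eventually_mono[OF eventually_at_right_less[of 0]])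
  moreover have "(bump k \<longlongrightarrow> 0) (at_left 0)"
    by (rule Lim_transform_eventually[OF tendsto_const])
      (auto simp: bump_def eventually_at_left_field intro!: exI[of _ "-1"])
  ultimately show ?thesis
    by (simp add: filterlim_at_split)
qed

lemma DERIV_bump: "(bump k has_real_derivative (bump (k + 2) x - k * bump (k + 1) x)) (at x)"
proof -
  consider "x > 0" | "x < 0" | "x = 0" by linarith
  then show ?thesis
  proof cases
    case 1
    have p: "real k * (1 / x) ^ (k - 1) * (1 / x)\<^sup>2 = real k * (1 / x) ^ (k + 1)"
      by (cases k) (simp_all add: power2_eq_square)
    have i: "((\<lambda>x. 1 / x) has_real_derivative - ((1 / x)\<^sup>2)) (at x)"
      using 1 by (auto intro!: derivative_eq_intros simp: power2_eq_square)
    have "((\<lambda>x. (1 / x) ^ k * exp (- (1 / x))) has_real_derivative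
        (real k * (1 / x) ^ (k - 1) * (- ((1 / x)\<^sup>2))) * exp (- (1 / x))
        + (exp (- (1 / x)) * (- (- ((1 / x)\<^sup>2)))) * (1 / x) ^ k) (at x)"
      using DERIV_mult[OF DERIV_power[OF i, of k] DERIV_fun_exp[OF DERIV_minus[OF i]]]
      by (simp add: mult_ac)
    also have "(real k * (1 / x) ^ (k - 1) * (- ((1 / x)\<^sup>2))) * exp (- (1 / x))
        + (exp (- (1 / x)) * (- (- ((1 / x)\<^sup>2)))) * (1 / x) ^ k = bump (k + 2) x - k * bump (k + 1) x"
      using 1 p unfolding bump_def power_add by (simp del: power_one_over)
    finally have "((\<lambda>x. (1 / x) ^ k * exp (- (1 / x))) has_real_derivative (bump (k + 2) x - k * bump (k + 1) x)) (at x)" .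
    then show ?thesis
      by (rule has_field_derivative_transform_within_open[of _ _ _ "{0<..}"]) (use 1 in \<open>auto simp: bump_def\<close>)
  next
    case 2
    have "((\<lambda>x. 0) has_real_derivative (bump (k + 2) x - k * bump (k + 1) x)) (at x)"
      using 2 by (auto simp: bump_def)
    then show ?thesis
      by (rule has_field_derivative_transform_within_open[of _ _ _ "{..<0}"]) (use 2 in \<open>auto simp: bump_def\<close>)
  next
    case 3
    \<comment> \<open>At 0 the difference quotient of \<open>bump k\<close> is
      \<open>bump (Suc k)\<close>, which tends to 0.\<close>
    have "((\<lambda>h. bump k h / h) \<longlongrightarrow> 0) (at 0)"
      by (rule Lim_transform_eventually[OF bump_tendsto_0[of "Suc k"]]) (simp add: bump_def)
    then show ?thesis
      using 3 by (simp add: DERIV_def bump_def)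
  qed
qed

lemma smooth_bump: "smooth (bump k)"
proof -
  have "Ck_on m (bump k) UNIV" for m
  proof (induction m arbitrary: k)
    case 0
    then show ?case
      by (auto intro!: continuous_at_imp_continuous_on DERIV_isCont[OF DERIV_bump])
  next
    case (Suc m)
    have *: "(bump k has_derivative (\<lambda>h. (bump (k + 2) x + (- real k) * bump (k + 1) x) * h)) (at x)" for x
      using has_field_derivative_imp_has_derivative[OF DERIV_bump[of k x]] by simp
    have "frechet_derivative (bump k) (at x) v = (bump (k + 2) x + (- real k) * bump (k + 1) x) * v" for x v
      using frechet_derivative_at[OF *] by metis
    moreover have "Ck_on m (\<lambda>x. (bump (k + 2) x + (- real k) * bump (k + 1) x) * v) UNIV" for v
      by (rule Ck_on_linear[OF bounded_linear_mult_left]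
          Ck_on_add Ck_on_linear[OF bounded_linear_mult_right] Suc.IH)+
    moreover have "bump k differentiable (at x)" for x
      using * differentiable_def by blast
    ultimately show ?case by simp
  qed
  then show ?thesis by (simp add: smooth_def)
qed

lemma bump_nonneg: "0 \<le> bump k x" by (simp add: bump_def)

lemma bump_0_le_1: "bump 0 x \<le> 1" by (simp add: bump_def)

text \<open>\<open>bump 2\<close> is the derivative of \<open>bump 0\<close>, so this bounds the
  slope of every cut-off below. With \<open>u = 1 / x\<close> it reads
  \<open>u\<^sup>2 * exp (- u) \<le> 2\<close>.\<close>

lemma bump_2_le_2: "bump 2 x \<le> 2"
proof (cases "x > 0")
  case True
  have "(1/x)\<^sup>2 / 2 \<le> exp (1/x)" 
    using exp_lower_Taylor_quadratic[of "1/x"] True by (smt (verit) divide_nonneg_pos)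
  then show ?thesis using True by (simp add: bump_def exp_minus field_simps)
qed (simp add: bump_def)

section \<open>Integration\<close>

lemma integrable_continuous_compact_support:
  fixes h :: "'a::euclidean_space \<Rightarrow> 'b::{banach,second_countable_topology}"
  assumes "continuous_on UNIV h" "compact K" "\<And>x. x \<notin> K \<Longrightarrow> h x = 0"
  shows "integrable lborel h"
proof -
  have "integrable lborel (\<lambda>x. indicator K x *\<^sub>R h x)"
    using assms by (intro borel_integrable_compact) (auto intro: continuous_on_subset)
  also have "(\<lambda>x. indicator K x *\<^sub>R h x) = h"
    using assms(3) by (auto simp: indicator_def fun_eq_iff)
  finally show ?thesis .
qed

lemma frechet_derivative_outside_support:
  assumes "compact K" "\<And>x. x \<notin> K \<Longrightarrow> h x = 0" "x \<notin> K"
  shows "frechet_derivative h (at x) v = 0"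
proof -
  have "(h has_derivative (\<lambda>_. 0)) (at x)"
    by (rule has_derivative_transform_within_open[of "\<lambda>_. 0" _ _ _ "- K"])
      (use assms in \<open>auto simp: compact_imp_closed\<close>)
  then show ?thesis
    by (metis frechet_derivative_at)
qed

text \<open>The integral of a difference quotient vanishes by translation invariance.\<close>

lemma integral_frechet_derivative_eq_0:
  fixes h :: "'a::euclidean_space \<Rightarrow> 'b::euclidean_space"
  assumes diff: "\<And>x. h differentiable (at x)"
    and cont: "continuous_on UNIV (\<lambda>x. frechet_derivative h (at x) v)"
    and K: "compact K" "\<And>x. x \<notin> K \<Longrightarrow> h x = 0"
  shows "(LINT x|lborel. frechet_derivative h (at x) v) = 0"
proof -
  define D where "D x = frechet_derivative h (at x) v" for x
  have der: "(h has_derivative frechet_derivative h (at x)) (at x)" for x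
    using diff frechet_derivative_works by blast
  have lin: "frechet_derivative h (at x) (c *\<^sub>R v) = c *\<^sub>R D x" for x c
    using linear_cmul[OF has_derivative_linear[OF der[of x]], of c v] by (simp add: D_def)
  have curve: "((\<lambda>t. h (x + t *\<^sub>R v)) has_derivative (\<lambda>t. t *\<^sub>R D (x + s *\<^sub>R v))) (at s)" for x s
  proof -
    have "((\<lambda>t. x + t *\<^sub>R v) has_derivative (\<lambda>t. t *\<^sub>R v)) (at s)"
      by (auto intro!: derivative_eq_intros)
    from has_derivative_compose[OF this der] show ?thesis by (simp add: lin)
  qed
  have contD: "continuous_on UNIV D" and conth: "continuous_on UNIV h"
    using cont diff by (auto simp: D_def[abs_def] intro!: continuous_at_imp_continuous_on
        differentiable_imp_continuous_within)
  have "bounded (D ` K)"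
    using K contD by (intro compact_imp_bounded compact_continuous_image) (auto intro: continuous_on_subset)
  then obtain B where B: "\<And>x. x \<in> K \<Longrightarrow> norm (D x) \<le> B" "B \<ge> 0"
    unfolding bounded_pos by (metis imageI less_eq_real_def)
  have D0: "D x = 0" if "x \<notin> K" for x
    unfolding D_def using K that by (intro frechet_derivative_outside_support) auto
  have B': "norm (D x) \<le> B" for x
    using B D0 by (cases "x \<in> K") auto
  \<comment> \<open>Difference quotients with step \<open>1 / Suc n\<close>. The mean value
    inequality bounds them by the maximum \<open>B\<close> of the derivative, uniformly in
    \<open>n\<close>.\<close>
  define q where "q n x = real (Suc n) *\<^sub>R (h (x + (1 / real (Suc n)) *\<^sub>R v) - h x)" for n x
  have qB: "norm (q n x) \<le> B" for n x
  proof -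
    have "\<exists>s\<in>{0<..<1 / real (Suc n)}. norm (h (x + (1 / real (Suc n)) *\<^sub>R v) - h (x + 0 *\<^sub>R v))
        \<le> norm ((1 / real (Suc n) - 0) *\<^sub>R D (x + s *\<^sub>R v))"
      by (rule mvt_general[where f = "\<lambda>t. h (x + t *\<^sub>R v)"])
        (auto intro!: curve continuous_at_imp_continuous_on has_derivative_continuous[OF curve])
    then obtain s where "norm (h (x + (1 / real (Suc n)) *\<^sub>R v) - h x) \<le> (1 / real (Suc n)) * norm (D (x + s *\<^sub>R v))"
      by auto
    also have "\<dots> \<le> (1 / real (Suc n)) * B"
      by (intro mult_left_mono B') auto
    finally have "norm (h (x + (1 / real (Suc n)) *\<^sub>R v) - h x) \<le> (1 / real (Suc n)) * B" .
    then show ?thesis unfolding q_def norm_scaleR by (simp add: field_simps)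
  qed
  \<comment> \<open>\<open>K\<close> swept back along \<open>v\<close> by all step lengths up to 1.
    It contains the supports of all the quotients, so \<open>B\<close> on \<open>K'\<close> is an
    integrable majorant.\<close>
  define K' where "K' = (\<lambda>(y, s). y - s *\<^sub>R v) ` (K \<times> {0..1})"
  have K': "compact K'"
    unfolding K'_def by (intro compact_continuous_image compact_Times K)
      (auto intro!: continuous_intros simp: case_prod_unfold)
  have q0: "q n x = 0" if "x \<notin> K'" for n x
  proof -
    have "x \<notin> K"
      using that unfolding K'_def by (force intro: image_eqI[of _ _ "(x, 0)"])
    moreover have "x + (1 / real (Suc n)) *\<^sub>R v \<notin> K"
    proof
      assume "x + (1 / real (Suc n)) *\<^sub>R v \<in> K"
      then have "x \<in> K'" unfolding K'_def
        by (intro image_eqI[of _ _ "(x + (1 / real (Suc n)) *\<^sub>R v, 1 / real (Suc n))"]) auto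
      with that show False ..
    qed
    ultimately show ?thesis using K(2) by (simp add: q_def)
  qed
  have inth: "integrable lborel h"
    using conth K by (rule integrable_continuous_compact_support)
  have trans: "integrable lborel (\<lambda>x. h (x + c))" "(LINT x|lborel. h (x + c)) = (LINT x|lborel. h x)" for c
  proof -
    have "integrable (distr lborel borel ((+) c)) h" unfolding lborel_distr_plus by (rule inth)
    then show "integrable lborel (\<lambda>x. h (x + c))"
      by (subst (asm) integrable_distr_eq) (auto simp: add.commute intro: borel_measurable_continuous_onI conth)
    have "(LINT x|lborel. h x) = (LINT x|distr lborel borel ((+) c). h x)"
      by (simp add: lborel_distr_plus)
    also have "\<dots> = (LINT x|lborel. h (x + c))"
      by (subst integral_distr) (auto simp: add.commute intro: borel_measurable_continuous_onI conth)
    finally show "(LINT x|lborel. h (x + c)) = (LINT x|lborel. h x)" ..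
  qed
  have int0: "(LINT x|lborel. q n x) = 0" for n
    unfolding q_def using trans inth by simp
  have "(\<lambda>n. LINT x|lborel. q n x) \<longlonglongrightarrow> (LINT x|lborel. D x)"
  proof (rule integral_dominated_convergence[where w = "\<lambda>x. indicator K' x *\<^sub>R B"])
    show "D \<in> borel_measurable lborel"
      using contD by (simp add: borel_measurable_continuous_onI)
    have "q n \<in> borel_measurable borel" for n
      unfolding q_def by (intro borel_measurable_continuous_onI continuous_intros
          continuous_on_compose2[OF conth]) auto
    then show "q n \<in> borel_measurable lborel" for n
      by simp
    show "integrable lborel (\<lambda>x. indicator K' x *\<^sub>R B)"
      using K' by (intro borel_integrable_compact) auto
    show "AE x in lborel. norm (q n x) \<le> indicator K' x *\<^sub>R B" for n
      using qB q0 by (intro AE_I2) (auto simp: indicator_def)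
    show "AE x in lborel. (\<lambda>n. q n x) \<longlonglongrightarrow> D x"
    proof (intro AE_I2)
      fix x
      have "((\<lambda>t. norm (h (x + t *\<^sub>R v) - h x - t *\<^sub>R D x) / norm t) \<longlongrightarrow> 0) (at 0)"
        using curve[of x 0] unfolding has_derivative_at by simp
      moreover have "filterlim (\<lambda>n. 1 / real (Suc n)) (at 0) sequentially"
        by (intro filterlim_atI LIMSEQ_Suc[OF lim_1_over_n] always_eventually) auto
      ultimately have lim: "(\<lambda>n. norm (h (x + (1 / real (Suc n)) *\<^sub>R v) - h x - (1 / real (Suc n)) *\<^sub>R D x)
          / norm (1 / real (Suc n))) \<longlonglongrightarrow> 0"
        by (rule filterlim_compose)
      have scal: "norm (d - (1 / c) *\<^sub>R w) / norm (1 / c) = norm (c *\<^sub>R d - w)"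
        if "c \<noteq> 0" for c :: real and d w :: 'b
      proof -
        have "d - (1 / c) *\<^sub>R w = (1 / c) *\<^sub>R (c *\<^sub>R d - w)"
          using that by (simp add: scaleR_diff_right)
        then show ?thesis using that by (simp only: norm_scaleR) simp
      qed
      have eq: "(\<lambda>n. norm (h (x + (1 / real (Suc n)) *\<^sub>R v) - h x - (1 / real (Suc n)) *\<^sub>R D x)
          / norm (1 / real (Suc n))) = (\<lambda>n. norm (q n x - D x))"
        unfolding q_def by (rule ext, rule scal, rule of_nat_neq_0)
      have "(\<lambda>n. norm (q n x - D x)) \<longlonglongrightarrow> 0"
        using lim unfolding eq .
      then show "(\<lambda>n. q n x) \<longlonglongrightarrow> D x"
        by (rule LIM_zero_cancel[OF tendsto_norm_zero_cancel])
    qed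
  qed
  then show ?thesis
    unfolding int0 by (simp add: LIMSEQ_const_iff D_def)
qed

section \<open>Volume in coordinates that straighten the boundary\<close>

lemma prod_Basis_vec:
  "(\<Prod>b\<in>(Basis :: ('a::euclidean_space ^ 'm::finite) set). f b) = (\<Prod>i\<in>UNIV. \<Prod>c\<in>Basis. f (axis i c))"
proof -
  have B: "(Basis :: ('a ^ 'm) set) = (\<lambda>(i, c). axis i c) ` (UNIV \<times> Basis)"
    by (auto simp: Basis_vec_def)
  have "inj_on (\<lambda>(i, c). axis i c :: 'a ^ 'm) (UNIV \<times> Basis)"
    by (auto simp: inj_on_def axis_eq_axis)
  then show ?thesis
    unfolding B by (simp add: prod.reindex prod.cartesian_product case_prod_unfold)
qed

lemma prod_UNIV_option: "(\<Prod>i\<in>(UNIV :: 'n::finite option set). f i) = f None * (\<Prod>j\<in>UNIV. f (Some j))"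
  by (simp add: UNIV_option_conv prod.reindex)

lemma sum_UNIV_option: "(\<Sum>i\<in>(UNIV :: 'n::finite option set). f i) = f None + (\<Sum>j\<in>UNIV. f (Some j))"
  by (simp add: UNIV_option_conv sum.reindex)

text \<open>The last coordinate is the height over the boundary in the direction of Im w, that is,
  \<open>- siegel_r\<close>. The map is a shear that straightens all level sets of
  \<open>siegel_r\<close>.\<close>

definition siegel_chart :: "((complex ^ 'n::finite) \<times> real) \<times> real \<Rightarrow> complex ^ ('n option)" where
  "siegel_chart = (\<lambda>(p, y). graph_point (\<lambda>(z, x). (norm z)\<^sup>2 + y) p)"

lemma siegel_chart_nth:
  "siegel_chart (p, y) $ None = Complex (snd p) ((norm (fst p))\<^sup>2 + y)"
  "siegel_chart (p, y) $ Some j = fst p $ j"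
  by (auto simp: siegel_chart_def graph_point_def split: prod.splits)

lemma continuous_on_siegel_chart:
  "continuous_on S (siegel_chart :: ((complex ^ 'n::finite) \<times> real) \<times> real \<Rightarrow> _)"
proof -
  have eq: "(siegel_chart :: ((complex ^ 'n) \<times> real) \<times> real \<Rightarrow> _) = (\<lambda>v. \<chi> i. case i of
      None \<Rightarrow> of_real (snd (fst v)) + \<i> * of_real ((norm (fst (fst v)))\<^sup>2 + snd v) | Some j \<Rightarrow> fst (fst v) $ j)"
    by (auto simp: siegel_chart_nth fun_eq_iff vec_eq_iff Complex_eq split: option.splits)
  show ?thesis
    unfolding eq
    apply (rule continuous_on_vec_lambda)
    subgoal for i by (cases i) (auto intro!: continuous_intros)
    done
qed

text \<open>Cavalieri's principle: over each point of its base, the preimage of a box is an interval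
  shifted by the squared norm of \<open>z\<close> but of unchanged length. Boxes determine Lebesgue
  measure.\<close>

lemma lborel_distr_siegel_chart: "distr lborel borel siegel_chart = (lborel :: (complex ^ ('n::finite option)) measure)"
proof (rule lborel_eqI[symmetric])
  fix l u :: "complex ^ ('n option)"
  assume le: "\<And>b. b \<in> Basis \<Longrightarrow> l \<bullet> b \<le> u \<bullet> b"
  have le': "Re (l $ i) \<le> Re (u $ i)" "Im (l $ i) \<le> Im (u $ i)" for i
    using le[of "axis i 1"] le[of "axis i \<i>"] by (auto simp: inner_axis Basis_vec_def Basis_complex_def inner_complex_def)
  define zl zu where "zl = (\<chi> j. l $ Some j)" and "zu = (\<chi> j. u $ Some j)"
  define Q where "Q = box zl zu \<times> box (Re (l $ None)) (Re (u $ None))"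
  have Q: "Q \<in> sets borel"
    unfolding Q_def by (intro borel_open open_Times open_box)
  have chart[measurable]: "siegel_chart \<in> borel_measurable borel"
    by (rule borel_measurable_continuous_onI[OF continuous_on_siegel_chart])
  have mem: "siegel_chart (p, y) \<in> box l u \<longleftrightarrow> p \<in> Q \<and>
      Im (l $ None) - (norm (fst p))\<^sup>2 < y \<and> y < Im (u $ None) - (norm (fst p))\<^sup>2" for p y
    by (cases p) (auto simp: Q_def zl_def zu_def mem_box Basis_vec_def inner_axis Basis_complex_def
        inner_complex_def siegel_chart_nth all_conj_distrib split_option_all)
  have "emeasure (distr lborel borel siegel_chart) (box l u)
      = emeasure (lborel \<Otimes>\<^sub>M lborel) (siegel_chart -` box l u)"
    by (simp add: emeasure_distr lborel_prod)
  also have "\<dots> = (\<integral>\<^sup>+p. emeasure lborel (Pair p -` siegel_chart -` box l u) \<partial>lborel)"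
    by (rule lborel.emeasure_pair_measure_alt)
      (unfold lborel_prod sets_lborel, auto intro: measurable_sets_borel[OF chart])
  also have "\<dots> = (\<integral>\<^sup>+p. ennreal (Im (u $ None) - Im (l $ None)) * indicator Q p \<partial>lborel)"
  proof (rule nn_integral_cong)
    fix p
    have "Pair p -` siegel_chart -` box l u = (if p \<in> Q then
        {Im (l $ None) - (norm (fst p))\<^sup>2 <..< Im (u $ None) - (norm (fst p))\<^sup>2} else {})"
      using mem by (auto simp: vimage_def)
    then show "emeasure lborel (Pair p -` siegel_chart -` box l u)
        = ennreal (Im (u $ None) - Im (l $ None)) * indicator Q p"
      using le'(2)[of None] by auto
  qed
  also have "\<dots> = ennreal (Im (u $ None) - Im (l $ None)) * emeasure (lborel \<Otimes>\<^sub>M lborel) Q"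
    using Q by (simp add: nn_integral_cmult_indicator lborel_prod)
  also have "emeasure (lborel \<Otimes>\<^sub>M lborel) Q = emeasure lborel (box zl zu) * ennreal (Re (u $ None) - Re (l $ None))"
    unfolding Q_def using le'(1)[of None] by (subst lborel.emeasure_pair_measure_Times) auto
  also have "emeasure lborel (box zl zu) = (\<Prod>j\<in>UNIV. \<Prod>c\<in>Basis. (u $ Some j - l $ Some j) \<bullet> c)"
  proof -
    have "zl \<bullet> b \<le> zu \<bullet> b" if "b \<in> Basis" for b
      using that le' by (auto simp: zl_def zu_def Basis_vec_def inner_axis Basis_complex_def inner_complex_def)
    then show ?thesis
      by (simp add: emeasure_lborel_box_eq prod_Basis_vec inner_axis inner_diff_left zl_def zu_def)
  qed
  finally show "emeasure (distr lborel borel siegel_chart) (box l u) = (\<Prod>b\<in>Basis. (u - l) \<bullet> b)"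
    using le' by (simp add: prod_Basis_vec prod_UNIV_option inner_axis Basis_complex_def inner_complex_def
        complex_i_not_one ennreal_mult'[symmetric] mult_ac prod_nonneg)
qed simp

text \<open>Blows up a boundary layer of thickness \<open>e\<close> to thickness 1, which turns
  integrals over shrinking layers into integrals over a fixed set.\<close>

lemma lborel_integral_scale_snd:
  fixes F :: "'a::euclidean_space \<times> real \<Rightarrow> 'b::euclidean_space"
  assumes [measurable]: "F \<in> borel_measurable borel" and e: "e > 0"
  shows "(LINT v|lborel. F v) = e *\<^sub>R (LINT v|lborel. F (fst v, e * snd v))"
proof -
  define c where "c = (\<lambda>j::'a \<times> real. if j = (0, 1) then e else 1)"
  have T: "(\<Sum>j\<in>Basis. (c j * (v \<bullet> j)) *\<^sub>R j) = (fst v, e * snd v)" for v :: "'a \<times> real"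
  proof (rule euclidean_eqI)
    fix b :: "'a \<times> real" assume b: "b \<in> Basis"
    have "(\<Sum>j\<in>Basis. (c j * (v \<bullet> j)) *\<^sub>R j) \<bullet> b = c b * (v \<bullet> b)"
      using b by (simp add: inner_sum_left inner_Basis if_distrib cong: if_cong)
    also have "\<dots> = (fst v, e * snd v) \<bullet> b"
      using b by (cases v) (auto simp: c_def Basis_prod_def)
    finally show "(\<Sum>j\<in>Basis. (c j * (v \<bullet> j)) *\<^sub>R j) \<bullet> b = (fst v, e * snd v) \<bullet> b" .
  qed
  have P: "(\<Prod>j\<in>(Basis :: ('a \<times> real) set). \<bar>c j\<bar>) = e"
  proof -
    have "(\<Prod>j\<in>(Basis :: ('a \<times> real) set). \<bar>c j\<bar>) = (\<Prod>j\<in>(Basis :: ('a \<times> real) set). if j = (0, 1) then e else 1)"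
      using e by (intro prod.cong) (auto simp: c_def)
    also have "\<dots> = e" by (subst prod.delta) (auto simp: Basis_prod_def)
    finally show ?thesis .
  qed
  have [measurable]: "(\<lambda>v :: 'a \<times> real. (fst v, e * snd v)) \<in> borel_measurable borel"
    by (intro borel_measurable_continuous_onI continuous_intros)
  have "(lborel :: ('a \<times> real) measure) = density (distr lborel borel (\<lambda>v. (fst v, e * snd v))) (\<lambda>_. e)"
    using lborel_affine_euclidean[of c "0 :: 'a \<times> real"] e T P by (simp add: c_def)
  then have "(LINT v|lborel. F v) = (LINT v|density (distr lborel borel (\<lambda>v. (fst v, e * snd v))) (\<lambda>_. e). F v)"
    by simp
  also have "\<dots> = e *\<^sub>R (LINT v|lborel. F (fst v, e * snd v))"
    using e by (subst integral_density; (subst integral_distr)?) auto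
  finally show ?thesis .
qed

section \<open>The defining function\<close>

definition zpart :: "complex ^ ('n::finite option) \<Rightarrow> complex ^ 'n" where
  "zpart \<zeta> = (\<chi> j. \<zeta> $ Some j)"

lemma zpart_nth [simp]: "zpart \<zeta> $ j = \<zeta> $ Some j"
  by (simp add: zpart_def)

lemma norm_vec_power2: "(norm (v :: complex ^ 'm::finite))\<^sup>2 = (\<Sum>i\<in>UNIV. (cmod (v $ i))\<^sup>2)"
  by (simp add: power2_norm_eq_inner inner_vec_def)

lemma norm_split_power2: "(norm \<zeta>)\<^sup>2 = (norm (zpart \<zeta>))\<^sup>2 + (cmod (\<zeta> $ None))\<^sup>2"
  by (simp add: norm_vec_power2 sum_UNIV_option)

lemma norm_zpart_le: "norm (zpart \<zeta>) \<le> norm \<zeta>"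
  by (rule power2_le_imp_le) (auto simp: norm_split_power2[of \<zeta>])

lemma bounded_linear_zpart: "bounded_linear zpart"
  by (rule bounded_linear_intro[of _ 1]) (auto simp: vec_eq_iff norm_zpart_le)

lemmas zpart_diff = linear_diff[OF bounded_linear.linear[OF bounded_linear_zpart]]

lemma norm_axis_eq: "norm (axis i x :: 'a::real_inner ^ 'm::finite) = norm x"
  by (simp add: norm_eq_sqrt_inner inner_axis_axis)

definition siegel_r :: "complex ^ ('n::finite option) \<Rightarrow> real" where
  "siegel_r \<zeta> = (norm (zpart \<zeta>))\<^sup>2 - Im (\<zeta> $ None)"

lemma siegel_eq: "siegel = {\<zeta>. siegel_r \<zeta> < 0}"
  by (simp add: siegel_def siegel_r_def zpart_def)

lemma bounded_linear_Im_None: "bounded_linear (\<lambda>\<zeta>::complex ^ ('n::finite option). Im (\<zeta> $ None))"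
  by (intro bounded_linear_compose[OF bounded_linear_Im] bounded_linear_vec_nth)

lemma smooth_zpart: "smooth zpart"
  by (rule smooth_linear[OF bounded_linear_zpart])

lemma smooth_siegel_r: "smooth siegel_r"
  unfolding siegel_r_def[abs_def]
  by (intro smooth_intros smooth_zpart smooth_linear bounded_linear_Im_None)

lemma continuous_on_siegel_r: "continuous_on S siegel_r"
  by (rule smooth_continuous_on[OF smooth_siegel_r])

lemma has_derivative_siegel_r:
  "(siegel_r has_derivative (\<lambda>h. 2 * (zpart \<zeta> \<bullet> zpart h) - Im (h $ None))) (at \<zeta>)"
  unfolding siegel_r_def[abs_def] power2_norm_eq_inner
  by (auto intro!: derivative_eq_intros bounded_linear.has_derivative[OF bounded_linear_zpart]
      has_derivative_ident simp: inner_commute)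
    (rule bounded_linear_imp_has_derivative[OF bounded_linear_vec_nth])

lemma open_siegel: "open siegel"
proof -
  have "siegel = siegel_r -` {..<0}" by (auto simp: siegel_eq)
  then show ?thesis
    using open_vimage[OF open_lessThan continuous_on_siegel_r] by metis
qed

lemma frontier_siegel: "frontier (siegel :: (complex ^ ('n::finite option)) set) = {\<zeta>. siegel_r \<zeta> = 0}"
proof -
  have "closed (siegel_r -` {..0} :: (complex ^ ('n option)) set)"
    by (rule closed_vimage[OF closed_atMost continuous_on_siegel_r])
  then have "closure siegel \<subseteq> (siegel_r -` {..0} :: (complex ^ ('n option)) set)"
    by (intro closure_minimal) (auto simp: siegel_eq)
  moreover have "p \<in> closure siegel" if p: "siegel_r p = 0" for p :: "complex ^ ('n option)"
    unfolding closure_approachable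
  proof (intro allI impI)
    fix e :: real assume e: "e > 0"
    \<comment> \<open>Moving in the direction of increasing Im w leaves \<open>zpart\<close> fixed
      and lowers \<open>siegel_r\<close>, so \<open>y\<close> lies in the domain.\<close>
    define y where "y = p + axis None (of_real (e / 2) * \<i>)"
    have "zpart y = zpart p" by (simp add: y_def vec_eq_iff axis_def)
    moreover have "Im (y $ None) = Im (p $ None) + e / 2" by (simp add: y_def)
    ultimately have "y \<in> siegel" using p e by (simp add: siegel_eq siegel_r_def)
    moreover have "dist y p < e" using e by (simp add: y_def dist_norm norm_axis_eq norm_mult)
    ultimately show "\<exists>y\<in>siegel. dist y p < e" by blast
  qed
  ultimately have "closure siegel - siegel = {\<zeta> :: complex ^ ('n option). siegel_r \<zeta> = 0}"
    by (auto simp: siegel_eq) 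
  then show ?thesis
    by (simp add: frontier_def interior_open open_siegel)
qed

lemma grad_eqI:
  assumes "(f has_derivative (\<lambda>h. G \<bullet> h)) (at x)"
  shows "grad f x = G"
proof -
  have "frechet_derivative f (at x) = (\<lambda>h. G \<bullet> h)"
    using frechet_derivative_at[OF assms] by simp
  then show ?thesis by (simp add: grad_def euclidean_representation)
qed

lemma frechet_derivative_grad:
  assumes "f differentiable (at x)"
  shows "frechet_derivative f (at x) h = grad f x \<bullet> h"
proof -
  interpret linear "frechet_derivative f (at x)"
    using assms by (rule linear_frechet_derivative)
  have "frechet_derivative f (at x) h = frechet_derivative f (at x) (\<Sum>b\<in>Basis. (h \<bullet> b) *\<^sub>R b)"
    by (simp add: euclidean_representation)
  also have "\<dots> = (\<Sum>b\<in>Basis. (h \<bullet> b) * frechet_derivative f (at x) b)"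
    by (simp add: sum scale)
  also have "\<dots> = grad f x \<bullet> h"
    by (simp add: grad_def inner_sum_left inner_commute[of h] mult.commute)
  finally show ?thesis .
qed

definition zembed :: "complex ^ 'n::finite \<Rightarrow> complex \<Rightarrow> complex ^ ('n option)" where
  "zembed z w = (\<chi> i. case i of None \<Rightarrow> w | Some j \<Rightarrow> z $ j)"

lemma zembed_nth [simp]: "zembed z w $ None = w" "zembed z w $ Some j = z $ j" "zpart (zembed z w) = z"
  by (simp_all add: zembed_def vec_eq_iff)

lemma inner_split: "\<zeta> \<bullet> h = zpart \<zeta> \<bullet> zpart h + \<zeta> $ None \<bullet> h $ None"
  by (simp add: inner_vec_def sum_UNIV_option)

lemma grad_siegel_r: "grad siegel_r \<zeta> = zembed (2 *\<^sub>R zpart \<zeta>) (- \<i>)"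
proof (rule grad_eqI)
  have "(\<lambda>h. zembed (2 *\<^sub>R zpart \<zeta>) (- \<i>) \<bullet> h) = (\<lambda>h. 2 * (zpart \<zeta> \<bullet> zpart h) - Im (h $ None))"
    by (auto simp: inner_split fun_eq_iff inner_complex_def)
  then show "(siegel_r has_derivative (\<lambda>h. zembed (2 *\<^sub>R zpart \<zeta>) (- \<i>) \<bullet> h)) (at \<zeta>)"
    using has_derivative_siegel_r by simp
qed

definition siegel_s :: "complex ^ ('n::finite option) \<Rightarrow> real" where
  "siegel_s \<zeta> = sqrt (1 + 4 * (norm (zpart \<zeta>))\<^sup>2)"

lemma siegel_s_ge: "1 \<le> siegel_s \<zeta>" "2 * norm (zpart \<zeta>) \<le> siegel_s \<zeta>"
  unfolding siegel_s_def by (auto intro!: real_le_rsqrt simp: power_mult_distrib)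

lemma siegel_s_pos: "0 < siegel_s \<zeta>"
  using siegel_s_ge(1)[of \<zeta>] by linarith

lemma norm_grad_siegel_r: "norm (grad siegel_r \<zeta>) = siegel_s \<zeta>"
proof -
  have "(norm (grad siegel_r \<zeta>))\<^sup>2 = 1 + 4 * (norm (zpart \<zeta>))\<^sup>2"
    by (simp add: grad_siegel_r norm_split_power2[of "zembed _ _"] power_mult_distrib)
  then show ?thesis
    unfolding siegel_s_def by (metis norm_ge_zero real_sqrt_unique)
qed

lemma has_derivative_siegel_s:
  "(siegel_s has_derivative (\<lambda>h. 4 * (zpart \<zeta> \<bullet> zpart h) / siegel_s \<zeta>)) (at \<zeta>)"
  unfolding siegel_s_def[abs_def] power2_norm_eq_inner
  apply (rule has_derivative_eq_rhs)
   apply (rule has_derivative_real_sqrt)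
    apply (simp add: add_pos_nonneg)
   apply (rule has_derivative_add[OF has_derivative_const has_derivative_mult_right[OF has_derivative_inner[OF
          bounded_linear_imp_has_derivative[OF bounded_linear_zpart] bounded_linear_imp_has_derivative[OF bounded_linear_zpart]]]])
  apply (simp add: fun_eq_iff inner_commute field_simps)
  done

definition siegel_rho :: "complex ^ ('n::finite option) \<Rightarrow> real" where
  "siegel_rho \<zeta> = siegel_r \<zeta> / siegel_s \<zeta>"

text \<open>The derivative is arranged as a polynomial in \<open>siegel_rho\<close>,
  \<open>1 / siegel_s\<close> and quotients
  \<open>(zpart \<zeta> \<bullet> v) / siegel_s \<zeta>\<close>, the generators of the algebra
  below.\<close>

lemma has_derivative_siegel_rho:
  "(siegel_rho has_derivative (\<lambda>h. 2 * ((zpart \<zeta> \<bullet> zpart h) / siegel_s \<zeta>) - Im (h $ None) * (1 / siegel_s \<zeta>)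
     - 4 * siegel_rho \<zeta> * ((zpart \<zeta> \<bullet> zpart h) / siegel_s \<zeta>) * (1 / siegel_s \<zeta>))) (at \<zeta>)"
  unfolding siegel_rho_def[abs_def]
  apply (rule has_derivative_eq_rhs)
   apply (rule has_derivative_divide'[OF has_derivative_siegel_r has_derivative_siegel_s])
  using siegel_s_pos[of \<zeta>] by (auto simp: fun_eq_iff field_simps)

text \<open>The functions \<open>\<rho>\<close>, \<open>1/s\<close>, \<open>z\<^sub>j/s\<close> are bounded near the boundary and generate an algebra that is
  closed under differentiation.\<close>

inductive rho_algebra :: "(complex ^ ('n::finite option) \<Rightarrow> real) \<Rightarrow> bool" where
  const: "rho_algebra (\<lambda>\<zeta>. c)"
| rho: "rho_algebra siegel_rho"
| inv_s: "rho_algebra (\<lambda>\<zeta>. 1 / siegel_s \<zeta>)"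
| z_s: "rho_algebra (\<lambda>\<zeta>. (zpart \<zeta> \<bullet> v) / siegel_s \<zeta>)"
| add: "rho_algebra f \<Longrightarrow> rho_algebra g \<Longrightarrow> rho_algebra (\<lambda>\<zeta>. f \<zeta> + g \<zeta>)"
| mult: "rho_algebra f \<Longrightarrow> rho_algebra g \<Longrightarrow> rho_algebra (\<lambda>\<zeta>. f \<zeta> * g \<zeta>)"

lemma rho_algebra_diff: "rho_algebra f \<Longrightarrow> rho_algebra g \<Longrightarrow> rho_algebra (\<lambda>\<zeta>. f \<zeta> - g \<zeta>)"
  using rho_algebra.add[OF _ rho_algebra.mult[OF rho_algebra.const[of "-1"]], of f g] by simp

lemma rho_algebra_deriv:
  fixes f :: "complex ^ ('n::finite option) \<Rightarrow> real"
  shows "rho_algebra f \<Longrightarrow> \<exists>f'. (\<forall>\<zeta>. (f has_derivative (\<lambda>h. f' h \<zeta>)) (at \<zeta>)) \<and> (\<forall>h. rho_algebra (f' h))"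
proof (induction rule: rho_algebra.induct)
  case (const c)
  show ?case by (rule exI[of _ "\<lambda>h \<zeta>. 0"]) (auto intro: rho_algebra.const)
next
  case rho
  show ?case
    by (rule exI[of _ "\<lambda>h \<zeta>. 2 * ((zpart \<zeta> \<bullet> zpart h) / siegel_s \<zeta>) - Im (h $ None) * (1 / siegel_s \<zeta>)
     - 4 * siegel_rho \<zeta> * ((zpart \<zeta> \<bullet> zpart h) / siegel_s \<zeta>) * (1 / siegel_s \<zeta>)"])
      (intro conjI allI has_derivative_siegel_rho rho_algebra_diff rho_algebra.intros)
next
  case inv_s
  have "((\<lambda>\<zeta>. 1 / siegel_s \<zeta>) has_derivative
      (\<lambda>h. (- 4) * ((zpart \<zeta> \<bullet> zpart h) / siegel_s \<zeta>) * (1 / siegel_s \<zeta>) * (1 / siegel_s \<zeta>))) (at \<zeta>)" for \<zeta> :: "complex ^ ('n option)"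
    apply (rule has_derivative_eq_rhs)
     apply (rule has_derivative_divide'[OF has_derivative_const has_derivative_siegel_s])
    using siegel_s_pos[of \<zeta>] by (auto simp: fun_eq_iff field_simps)
  then show ?case
    by (intro exI[of _ "\<lambda>h \<zeta>. (- 4) * ((zpart \<zeta> \<bullet> zpart h) / siegel_s \<zeta>) * (1 / siegel_s \<zeta>) * (1 / siegel_s \<zeta>)"])
      (intro conjI allI rho_algebra_diff rho_algebra.intros)
next
  case (z_s v)
  have "((\<lambda>\<zeta>. (zpart \<zeta> \<bullet> v) / siegel_s \<zeta>) has_derivative
      (\<lambda>h. (zpart h \<bullet> v) * (1 / siegel_s \<zeta>)
        - 4 * ((zpart \<zeta> \<bullet> v) / siegel_s \<zeta>) * ((zpart \<zeta> \<bullet> zpart h) / siegel_s \<zeta>) * (1 / siegel_s \<zeta>))) (at \<zeta>)"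
    for \<zeta> :: "complex ^ ('n option)"
    apply (rule has_derivative_eq_rhs)
     apply (rule has_derivative_divide'[OF has_derivative_inner_left[OF bounded_linear.has_derivative[OF bounded_linear_zpart has_derivative_ident]] has_derivative_siegel_s])
    using siegel_s_pos[of \<zeta>] by (auto simp: fun_eq_iff field_simps)
  then show ?case
    by (intro exI[of _ "\<lambda>h \<zeta>. (zpart h \<bullet> v) * (1 / siegel_s \<zeta>)
        - 4 * ((zpart \<zeta> \<bullet> v) / siegel_s \<zeta>) * ((zpart \<zeta> \<bullet> zpart h) / siegel_s \<zeta>) * (1 / siegel_s \<zeta>)"])
      (intro conjI allI rho_algebra_diff rho_algebra.intros)
next
  case (add f g)
  then obtain f' g' where *: "\<And>\<zeta>. (f has_derivative (\<lambda>h. f' h \<zeta>)) (at \<zeta>)" "\<And>h. rho_algebra (f' h)"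
    "\<And>\<zeta>. (g has_derivative (\<lambda>h. g' h \<zeta>)) (at \<zeta>)" "\<And>h. rho_algebra (g' h)" by metis
  show ?case
    by (rule exI[of _ "\<lambda>h \<zeta>. f' h \<zeta> + g' h \<zeta>"])
      (intro conjI allI has_derivative_add rho_algebra.add *)
next
  case (mult f g)
  then obtain f' g' where *: "\<And>\<zeta>. (f has_derivative (\<lambda>h. f' h \<zeta>)) (at \<zeta>)" "\<And>h. rho_algebra (f' h)"
    "\<And>\<zeta>. (g has_derivative (\<lambda>h. g' h \<zeta>)) (at \<zeta>)" "\<And>h. rho_algebra (g' h)" by metis
  show ?case
    by (rule exI[of _ "\<lambda>h \<zeta>. f \<zeta> * g' h \<zeta> + f' h \<zeta> * g \<zeta>"])
      (intro conjI allI has_derivative_mult rho_algebra.add rho_algebra.mult * mult.hyps)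
qed

lemma rho_algebra_frechet_derivative:
  assumes "rho_algebra f"
  shows "f differentiable (at \<zeta>)" "rho_algebra (\<lambda>\<zeta>. frechet_derivative f (at \<zeta>) h)"
proof -
  obtain f' where *: "\<And>\<zeta>. (f has_derivative (\<lambda>h. f' h \<zeta>)) (at \<zeta>)" "\<And>h. rho_algebra (f' h)"
    using rho_algebra_deriv[OF assms] by metis
  then show "f differentiable (at \<zeta>)" by (auto simp: differentiable_def)
  have "frechet_derivative f (at \<zeta>) h = f' h \<zeta>" for \<zeta>
    using fun_cong[OF frechet_derivative_at[OF *(1)]] by metis
  then have "(\<lambda>\<zeta>. frechet_derivative f (at \<zeta>) h) = f' h" ..
  then show "rho_algebra (\<lambda>\<zeta>. frechet_derivative f (at \<zeta>) h)" using *(2) by metis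
qed

lemma rho_algebra_Ck: "rho_algebra f \<Longrightarrow> Ck_on k f U"
proof (induction k arbitrary: f)
  case 0
  then show ?case
    by (auto intro!: continuous_at_imp_continuous_on differentiable_imp_continuous_within rho_algebra_frechet_derivative)
qed (simp add: rho_algebra_frechet_derivative)

lemma rho_algebra_iter_partial: "rho_algebra f \<Longrightarrow> rho_algebra (iter_partial f bs)"
  by (induction bs arbitrary: f) (auto intro: rho_algebra_frechet_derivative)

text \<open>The bound \<open>1 / 4\<close> keeps the second term of \<open>grad siegel_rho\<close>
  at norm at most \<open>1 / 2\<close>, while the first term has norm 1. The gradient therefore
  stays away from 0 on the whole neighbourhood.\<close>

definition siegel_nbhd :: "(complex ^ ('n::finite option)) set" where
  "siegel_nbhd = {\<zeta>. \<bar>siegel_rho \<zeta>\<bar> < 1 / 4}"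

lemma rho_algebra_bounded: "rho_algebra f \<Longrightarrow> \<exists>B. \<forall>\<zeta>\<in>siegel_nbhd. \<bar>f \<zeta>\<bar> \<le> B"
proof (induction rule: rho_algebra.induct)
  case rho
  show ?case by (rule exI[of _ "1/4"]) (auto simp: siegel_nbhd_def)
next
  case inv_s
  have "\<bar>1 / siegel_s \<zeta>\<bar> \<le> 1" for \<zeta> :: "complex ^ ('a option)"
    using siegel_s_ge(1)[of \<zeta>] by (simp add: abs_divide)
  then show ?case by blast
next
  case (z_s v)
  have "\<bar>(zpart \<zeta> \<bullet> v) / siegel_s \<zeta>\<bar> \<le> norm v" for \<zeta>
  proof -
    have "\<bar>zpart \<zeta> \<bullet> v\<bar> \<le> norm (zpart \<zeta>) * norm v" by (rule Cauchy_Schwarz_ineq2)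
    also have "\<dots> \<le> siegel_s \<zeta> * norm v"
      using siegel_s_ge(2)[of \<zeta>] norm_ge_zero[of "zpart \<zeta>"] by (intro mult_right_mono norm_ge_zero) linarith
    finally show ?thesis using siegel_s_pos[of \<zeta>] by (simp add: abs_divide divide_simps mult.commute)
  qed
  then show ?case by blast
next
  case (add f g)
  then obtain A B where "\<forall>\<zeta>\<in>siegel_nbhd. \<bar>f \<zeta>\<bar> \<le> A" "\<forall>\<zeta>\<in>siegel_nbhd. \<bar>g \<zeta>\<bar> \<le> B" by blast
  then show ?case by (intro exI[of _ "A + B"]) (smt (verit))
next
  case (mult f g)
  then obtain A B where AB: "\<forall>\<zeta>\<in>siegel_nbhd. \<bar>f \<zeta>\<bar> \<le> A" "\<forall>\<zeta>\<in>siegel_nbhd. \<bar>g \<zeta>\<bar> \<le> B" by blast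
  have "\<bar>f \<zeta> * g \<zeta>\<bar> \<le> A * B" if "\<zeta> \<in> siegel_nbhd" for \<zeta>
    unfolding abs_mult using AB that by (intro mult_mono) (auto intro: order_trans[OF abs_ge_zero])
  then show ?case by blast
qed auto

lemma finite_Ck_norm_siegel_rho:
  "finite_Ck_norm m siegel_rho (siegel_nbhd :: (complex ^ ('n::finite option)) set)"
proof -
  define L where "L = {bs :: (complex ^ ('n option)) list. set bs \<subseteq> Basis \<and> length bs \<le> m}"
  have fin: "finite L" unfolding L_def by (rule finite_lists_length_le) simp
  have "\<exists>B. \<forall>\<zeta>\<in>siegel_nbhd. \<bar>iter_partial siegel_rho bs \<zeta>\<bar> \<le> B" for bs :: "(complex ^ ('n option)) list"
    by (intro rho_algebra_bounded rho_algebra_iter_partial rho_algebra.rho)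
  then obtain B where B: "\<And>bs \<zeta>. \<zeta> \<in> siegel_nbhd \<Longrightarrow> \<bar>iter_partial siegel_rho bs \<zeta>\<bar> \<le> B (bs :: (complex ^ ('n option)) list)"
    by metis
  have "\<bar>iter_partial siegel_rho bs \<zeta>\<bar> \<le> (\<Sum>bs\<in>L. \<bar>B bs\<bar>)" if "bs \<in> L" "\<zeta> \<in> siegel_nbhd" for bs \<zeta>
  proof -
    have "\<bar>iter_partial siegel_rho bs \<zeta>\<bar> \<le> \<bar>B bs\<bar>" using B[OF that(2)] by (meson abs_ge_self order_trans)
    also have "\<dots> \<le> (\<Sum>bs\<in>L. \<bar>B bs\<bar>)" using fin that(1) by (intro member_le_sum) auto
    finally show ?thesis .
  qed
  then show ?thesis unfolding finite_Ck_norm_def L_def by blast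
qed

lemma grad_siegel_rho:
  "grad siegel_rho \<zeta> = (1 / siegel_s \<zeta>) *\<^sub>R grad siegel_r \<zeta>
     - (4 * siegel_rho \<zeta> / (siegel_s \<zeta>)\<^sup>2) *\<^sub>R zembed (zpart \<zeta>) 0"
  apply (rule grad_eqI)
  apply (rule has_derivative_eq_rhs[OF has_derivative_siegel_rho])
  using siegel_s_pos[of \<zeta>]
  by (simp add: fun_eq_iff inner_diff_left grad_siegel_r inner_split[of "zembed _ _"] inner_complex_def
      field_simps power2_eq_square)

lemma norm_zembed_0: "norm (zembed z 0) = norm z"
  using norm_split_power2[of "zembed z 0"] by simp

lemma norm_grad_siegel_rho_frontier:
  "\<zeta> \<in> frontier siegel \<Longrightarrow> norm (grad siegel_rho \<zeta>) = 1"
  using siegel_s_pos[of \<zeta>] by (simp add: grad_siegel_rho frontier_siegel siegel_rho_def norm_grad_siegel_r)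

lemma norm_grad_siegel_rho_ge:
  assumes "\<zeta> \<in> siegel_nbhd"
  shows "1 / 2 \<le> norm (grad siegel_rho \<zeta>)"
proof -
  have s: "siegel_s \<zeta> \<ge> 1" "2 * norm (zpart \<zeta>) \<le> siegel_s \<zeta>" by (rule siegel_s_ge)+
  have "norm ((4 * siegel_rho \<zeta> / (siegel_s \<zeta>)\<^sup>2) *\<^sub>R zembed (zpart \<zeta>) 0)
      = 2 * \<bar>siegel_rho \<zeta>\<bar> * (2 * norm (zpart \<zeta>) / siegel_s \<zeta>) * (1 / siegel_s \<zeta>)"
    using s by (simp add: norm_zembed_0 abs_mult power2_eq_square)
  also have "\<dots> \<le> 2 * (1 / 4) * 1 * 1"
    using s assms by (intro mult_mono) (auto simp: siegel_nbhd_def)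
  finally have 1: "norm ((4 * siegel_rho \<zeta> / (siegel_s \<zeta>)\<^sup>2) *\<^sub>R zembed (zpart \<zeta>) 0) \<le> 1 / 2" by simp
  have 2: "norm ((1 / siegel_s \<zeta>) *\<^sub>R grad siegel_r \<zeta>) = 1"
    using s by (simp add: norm_grad_siegel_r)
  show ?thesis
    unfolding grad_siegel_rho using 1 2 norm_triangle_ineq2[of "(1 / siegel_s \<zeta>) *\<^sub>R grad siegel_r \<zeta>"
      "(4 * siegel_rho \<zeta> / (siegel_s \<zeta>)\<^sup>2) *\<^sub>R zembed (zpart \<zeta>) 0"] by linarith
qed

lemma open_siegel_nbhd: "open (siegel_nbhd :: (complex ^ ('n::finite option)) set)"
proof -
  have "continuous_on UNIV (\<lambda>\<zeta> :: complex ^ ('n option). \<bar>siegel_rho \<zeta>\<bar>)"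
    by (intro continuous_intros rho_algebra_Ck[OF rho_algebra.rho, of 0, simplified])
  then have "open ((\<lambda>\<zeta> :: complex ^ ('n option). \<bar>siegel_rho \<zeta>\<bar>) -` {..<1/4})"
    by (intro open_vimage) auto
  moreover have "(\<lambda>\<zeta> :: complex ^ ('n option). \<bar>siegel_rho \<zeta>\<bar>) -` {..<1/4} = siegel_nbhd"
    by (auto simp: siegel_nbhd_def)
  ultimately show ?thesis by simp
qed

text \<open>To leave the neighbourhood, \<open>\<bar>siegel_r\<bar>\<close> must reach a quarter of
  \<open>siegel_s\<close>. Over a distance \<open>d\<close> the quadratic \<open>siegel_r\<close>
  changes by at most \<open>siegel_s y * (d * (2 + d))\<close>. Both quantities scale with
  \<open>siegel_s\<close>, so the threshold for \<open>d\<close> is the same at all points.\<close>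

lemma siegel_nbhd_dist:
  assumes "x \<in> frontier siegel" "y \<in> frontier siegel_nbhd"
  shows "1 / 16 \<le> dist x y"
proof (rule ccontr)
  assume *: "\<not> ?thesis"
  define d where "d = dist x y"
  have d: "0 \<le> d" "d < 1 / 16" using * by (auto simp: d_def)
  have s: "siegel_s y \<ge> 1" "2 * norm (zpart y) \<le> siegel_s y" by (rule siegel_s_ge)+
  have "y \<notin> siegel_nbhd"
    using assms(2) by (simp add: frontier_def interior_open[OF open_siegel_nbhd])
  then have 1: "siegel_s y / 4 \<le> \<bar>siegel_r y\<bar>"
    using s by (simp add: siegel_nbhd_def siegel_rho_def abs_divide field_simps)
  have zd: "norm (zpart y - zpart x) \<le> d"
    unfolding d_def dist_norm norm_minus_commute[of x] zpart_diff[symmetric] by (rule norm_zpart_le)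
  have wd: "\<bar>Im (y $ None) - Im (x $ None)\<bar> \<le> d"
  proof -
    have "\<bar>Im ((y - x) $ None)\<bar> \<le> cmod ((y - x) $ None)" by (rule abs_Im_le_cmod)
    also have "\<dots> \<le> norm (y - x)" by (rule Finite_Cartesian_Product.norm_nth_le)
    finally show ?thesis by (simp add: d_def dist_norm norm_minus_commute)
  qed
  have "siegel_r y = siegel_r y - siegel_r x" using assms(1) by (simp add: frontier_siegel)
  also have "\<dots> = (norm (zpart y) - norm (zpart x)) * (norm (zpart y) + norm (zpart x))
      - (Im (y $ None) - Im (x $ None))"
    by (simp add: siegel_r_def power2_eq_square algebra_simps)
  finally have "\<bar>siegel_r y\<bar> \<le> \<bar>norm (zpart y) - norm (zpart x)\<bar> * (norm (zpart y) + norm (zpart x)) + d"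
    using wd abs_triangle_ineq4[of "(norm (zpart y) - norm (zpart x)) * (norm (zpart y) + norm (zpart x))"
        "Im (y $ None) - Im (x $ None)"] by (simp add: abs_mult)
  also have "\<dots> \<le> d * (siegel_s y + d) + d"
  proof -
    have a: "\<bar>norm (zpart y) - norm (zpart x)\<bar> \<le> d"
      using norm_triangle_ineq3[of "zpart y" "zpart x"] zd by linarith
    then have "norm (zpart y) + norm (zpart x) \<le> siegel_s y + d" using s(2) by linarith
    with a d show ?thesis by (intro add_right_mono mult_mono) auto
  qed
  \<comment> \<open>Since \<open>siegel_s y\<close> is at least 1, it can be inserted into the two
    terms that lack it.\<close>
  also have "\<dots> \<le> d * (siegel_s y + d * siegel_s y) + d * siegel_s y"
    using s d by (intro add_mono mult_left_mono) (auto simp: mult_le_cancel_left1)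
  also have "\<dots> = siegel_s y * (d * (2 + d))" by (simp add: algebra_simps)
  also have "\<dots> < siegel_s y * (1 / 4)"
  proof -
    have "d * (2 + d) \<le> (1/16) * 3" using d by (intro mult_mono) auto
    then show ?thesis using s by (intro mult_strict_left_mono) auto
  qed
  finally show False using 1 by simp
qed

lemma Ck_defining_function_siegel_rho: "Ck_defining_function m siegel_rho siegel_nbhd siegel"
  unfolding Ck_defining_function_def
proof (intro conjI ballI)
  show "frontier siegel \<subseteq> siegel_nbhd" by (auto simp: frontier_siegel siegel_nbhd_def siegel_rho_def)
  show "siegel \<inter> siegel_nbhd = {x \<in> siegel_nbhd. siegel_rho x < 0}"
    using siegel_s_pos by (auto simp: siegel_eq siegel_rho_def divide_less_0_iff dest: less_asym)
  show "grad siegel_rho p \<noteq> 0" if "p \<in> frontier siegel" for p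
    using norm_grad_siegel_rho_frontier[OF that] by auto
qed (rule open_siegel_nbhd rho_algebra_Ck rho_algebra.rho)+

lemma admits_uniformly_smooth_defining_function_siegel:
  "admits_uniformly_smooth_defining_function (siegel :: (complex ^ ('n::finite option)) set)"
  unfolding admits_uniformly_smooth_defining_function_def uniformly_Ck_defining_function_def
proof (rule exI[of _ siegel_rho], rule exI[of _ siegel_nbhd], intro allI conjI)
  show "\<exists>\<delta>>0. \<forall>x\<in>frontier (siegel :: (complex ^ ('n option)) set). \<forall>y\<in>frontier siegel_nbhd. \<delta> \<le> dist x y"
    using siegel_nbhd_dist by (intro exI[of _ "1/16"]) auto
  show "\<exists>c>0. \<forall>x\<in>(siegel_nbhd :: (complex ^ ('n option)) set). c \<le> norm (grad siegel_rho x)"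
    using norm_grad_siegel_rho_ge by (intro exI[of _ "1/2"]) auto
qed (rule Ck_defining_function_siegel_rho finite_Ck_norm_siegel_rho)+

text \<open>Boundary values may be computed with any smooth defining function; this is the one whose
  layers \<open>siegel_chart\<close> straightens.\<close>

lemma Ck_defining_function_siegel_r: "Ck_defining_function m siegel_r UNIV (siegel :: (complex ^ ('n::finite option)) set)"
  unfolding Ck_defining_function_def
proof (intro conjI ballI)
  show "grad siegel_r p \<noteq> 0" for p :: "complex ^ ('n option)"
    using norm_grad_siegel_r[of p] siegel_s_pos[of p] by auto
qed (auto simp: siegel_eq smooth_Ck[OF smooth_siegel_r])

section \<open>The Levi form\<close>

text \<open>A defining function is prescribed only by its sign. It vanishes on the frontier by
  continuity: a positive value would persist at nearby points of \<open>\<Omega>\<close>, where the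
  sign is negative.\<close>

lemma defining_function_frontier_eq_0:
  assumes "Ck_defining_function m \<rho> U \<Omega>" "open \<Omega>" "p \<in> frontier \<Omega>"
  shows "\<rho> p = 0"
proof -
  have U: "open U" "p \<in> U" and sub: "\<Omega> \<inter> U = {x \<in> U. \<rho> x < 0}"
    using assms by (auto simp: Ck_defining_function_def)
  have "Ck_on m \<rho> U \<Longrightarrow> continuous_on U \<rho>"
    by (cases m) (auto intro!: continuous_at_imp_continuous_on differentiable_imp_continuous_within)
  then have cont: "continuous_on U \<rho>"
    using assms(1) by (simp add: Ck_defining_function_def)
  have "p \<notin> \<Omega>" using assms(2,3) by (simp add: frontier_def interior_open)
  then have ge: "0 \<le> \<rho> p" using sub U by force
  have "\<not> 0 < \<rho> p"
  proof
    assume pos: "0 < \<rho> p"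
    have op: "open (U \<inter> \<rho> -` {0<..})"
      using cont U(1) by (intro continuous_open_preimage) auto
    have "p \<in> closure \<Omega>" using assms(3) by (simp add: frontier_def)
    then have "(U \<inter> \<rho> -` {0<..}) \<inter> closure \<Omega> \<noteq> {}"
      using pos U(2) by auto
    then have "(U \<inter> \<rho> -` {0<..}) \<inter> \<Omega> \<noteq> {}"
      unfolding open_Int_closure_eq_empty[OF op] .
    then obtain x where "x \<in> \<Omega> \<inter> U" "0 < \<rho> x" by auto
    then show False unfolding sub by simp
  qed
  with ge show ?thesis by simp
qed

text \<open>The left sides are twice the complex-linear and twice the antilinear part of
  \<open>L\<close> at \<open>X\<close>. The identities convert coordinate sums of Wirtinger
  derivatives into real derivatives along \<open>X\<close> and \<open>\<i> *s X\<close>.\<close>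

lemma real_linear_d_zeta:
  fixes L :: "complex ^ 'm::finite \<Rightarrow> complex"
  assumes "linear L"
  shows "L X - \<i> * L (\<i> *s X) = (\<Sum>j\<in>UNIV. (L (axis j 1) - \<i> * L (axis j \<i>)) * X $ j)" (is ?g0)
    and "L X + \<i> * L (\<i> *s X) = (\<Sum>j\<in>UNIV. (L (axis j 1) + \<i> * L (axis j \<i>)) * cnj (X $ j))" (is ?g1)
proof -
  interpret linear L by (rule assms)
  have ax: "axis j c = Re c *\<^sub>R axis j 1 + Im c *\<^sub>R axis j \<i>" for j :: 'm and c
    by (auto simp: axis_def vec_eq_iff complex_eq_iff)
  have exp: "L X = (\<Sum>j\<in>UNIV. of_real (Re (X $ j)) * L (axis j 1) + of_real (Im (X $ j)) * L (axis j \<i>))" for X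
  proof -
    have "X = (\<Sum>j\<in>UNIV. axis j (X $ j))"
      by (simp add: vec_eq_iff axis_def if_distrib cong: if_cong)
    then have "L X = (\<Sum>j\<in>UNIV. L (axis j (X $ j)))"
      using sum[of "\<lambda>j. axis j (X $ j)" UNIV] by simp
    also have "\<dots> = (\<Sum>j\<in>UNIV. of_real (Re (X $ j)) * L (axis j 1) + of_real (Im (X $ j)) * L (axis j \<i>))"
      by (intro sum.cong refl) (subst ax, simp only: add scale scaleR_conv_of_real[where 'a=complex])
    finally show ?thesis .
  qed
  have c: "of_real (Re z) = z - \<i> * of_real (Im z)" for z
    by (simp add: complex_eq_iff)
  have d: "cnj z = of_real (Re z) - \<i> * of_real (Im z)" "z = of_real (Re z) + \<i> * of_real (Im z)" for z
    by (simp_all add: complex_eq_iff)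
  show ?g0
    unfolding exp[of X] exp[of "\<i> *s X"] sum_distrib_left sum_subtractf[symmetric]
    by (rule sum.cong[OF refl]) (subst (5) d(2), simp add: algebra_simps)
  show ?g1
    unfolding exp[of X] exp[of "\<i> *s X"] sum_distrib_left sum.distrib[symmetric]
    by (rule sum.cong[OF refl]) (simp add: d(1) algebra_simps)
qed

lemma inner_complex_vec: "X \<bullet> Y = Re (\<Sum>j\<in>UNIV. cnj (X $ j) * Y $ j)" for X :: "complex ^ 'm::finite"
  by (simp add: inner_vec_def inner_complex_def)

lemma d_zeta_real:
  assumes "\<rho> differentiable (at x)"
  shows "d_zeta j (\<lambda>\<zeta>. of_real (\<rho> \<zeta>)) x =
      (of_real (frechet_derivative \<rho> (at x) (axis j 1)) - \<i> * of_real (frechet_derivative \<rho> (at x) (axis j \<i>))) / 2" (is ?g0)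
    and "d_zetabar j (\<lambda>\<zeta>. of_real (\<rho> \<zeta>)) x =
      (of_real (frechet_derivative \<rho> (at x) (axis j 1)) + \<i> * of_real (frechet_derivative \<rho> (at x) (axis j \<i>))) / 2" (is ?g1)
proof -
  have "((\<lambda>\<zeta>. complex_of_real (\<rho> \<zeta>)) has_derivative (\<lambda>h. of_real (frechet_derivative \<rho> (at x) h))) (at x)"
    using assms by (intro bounded_linear.has_derivative[OF bounded_linear_of_real])
      (simp add: frechet_derivative_works[symmetric])
  from frechet_derivative_at[OF this]
  have "frechet_derivative (\<lambda>\<zeta>. complex_of_real (\<rho> \<zeta>)) (at x) = (\<lambda>h. of_real (frechet_derivative \<rho> (at x) h))" ..
  then show ?g0
    and ?g1
    by (simp_all add: d_zeta_def d_zetabar_def)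
qed

text \<open>Reduces the complex Hessian to four real second derivatives along the two vectors and
  their multiples by \<open>\<i>\<close>. On complex tangent vectors all four directions are real
  tangent, where \<open>ndf_second_derivative\<close> evaluates them.\<close>

lemma complex_hessian_real:
  fixes \<rho> :: "complex ^ 'm::finite \<Rightarrow> real"
  assumes U: "open U" "p \<in> U" and C2: "Ck_on 2 \<rho> U"
  defines "H \<equiv> \<lambda>Y X. frechet_derivative (\<lambda>x. frechet_derivative \<rho> (at x) Y) (at p) X"
  shows "complex_hessian \<rho> p \<xi> \<eta> =
    (of_real (H \<eta> \<xi>) + \<i> * of_real (H (\<i> *s \<eta>) \<xi>)
      - \<i> * of_real (H \<eta> (\<i> *s \<xi>)) + of_real (H (\<i> *s \<eta>) (\<i> *s \<xi>))) / 4"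
proof -
  have d1: "\<rho> differentiable (at x)" if "x \<in> U" for x
    using C2 that by (simp add: numeral_2_eq_2)
  have d2: "(\<lambda>x. frechet_derivative \<rho> (at x) Y) differentiable (at p)" for Y
    using C2 U(2) by (simp add: numeral_2_eq_2)
  then have H: "((\<lambda>x. frechet_derivative \<rho> (at x) Y) has_derivative H Y) (at p)" for Y
    unfolding H_def by (simp add: frechet_derivative_works[symmetric])
  have linX: "linear (H Y)" for Y
    using H by (rule has_derivative_linear)
  \<comment> \<open>Near \<open>p\<close> the first derivatives are linear in the direction;
    uniqueness of the derivative at \<open>p\<close> passes this on to \<open>H\<close>.\<close>
  have linY: "linear (\<lambda>Y. H Y X)" for X
  proof (rule linearI)
    have lin: "linear (frechet_derivative \<rho> (at x))" if "x \<in> U" for x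
      using d1[OF that] by (rule linear_frechet_derivative)
    show "H (Y + Z) X = H Y X + H Z X" for Y Z
    proof -
      have "((\<lambda>x. frechet_derivative \<rho> (at x) (Y + Z)) has_derivative (\<lambda>X. H Y X + H Z X)) (at p)"
        by (rule has_derivative_transform_within_open[OF has_derivative_add[OF H H] U])
          (simp add: linear_add[OF lin])
      then show ?thesis using has_derivative_unique[OF H] by metis
    qed
    show "H (c *\<^sub>R Y) X = c *\<^sub>R H Y X" for c Y
    proof -
      have "((\<lambda>x. frechet_derivative \<rho> (at x) (c *\<^sub>R Y)) has_derivative (\<lambda>X. c *\<^sub>R H Y X)) (at p)"
        by (rule has_derivative_transform_within_open[OF has_derivative_scaleR_right[OF H] U])
          (simp add: linear_cmul[OF lin])
      then show ?thesis using has_derivative_unique[OF H] by metis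
    qed
  qed
  define M where "M k X = (of_real (H (axis k 1) X) + \<i> * of_real (H (axis k \<i>) X)) / 2" for k X
  have M: "(d_zetabar k (\<lambda>\<zeta>. of_real (\<rho> \<zeta>)) has_derivative M k) (at p)" for k
  proof -
    have "((\<lambda>x. (of_real (frechet_derivative \<rho> (at x) (axis k 1)) + \<i> * of_real (frechet_derivative \<rho> (at x) (axis k \<i>))) / 2)
        has_derivative M k) (at p)"
      unfolding M_def[abs_def]
      by (intro bounded_linear.has_derivative[OF bounded_linear_divide] has_derivative_add has_derivative_mult_right
          bounded_linear.has_derivative[OF bounded_linear_of_real] H)
    then show ?thesis
      by (rule has_derivative_transform_within_open[OF _ U]) (simp add: d_zeta_real d1)
  qed
  have linM: "linear (M k)" for k using M by (rule has_derivative_linear)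
  have dz: "d_zeta j (d_zetabar k (\<lambda>\<zeta>. of_real (\<rho> \<zeta>))) p = (M k (axis j 1) - \<i> * M k (axis j \<i>)) / 2" for j k
    unfolding d_zeta_def frechet_derivative_at[OF M, symmetric] ..
  have linc: "linear (\<lambda>Y. complex_of_real (H Y X))" for X
    using linear_compose[OF linY bounded_linear.linear[OF bounded_linear_of_real]] by (simp add: o_def)
  have MX: "(\<Sum>k\<in>UNIV. M k X * cnj (\<eta> $ k)) = (of_real (H \<eta> X) + \<i> * of_real (H (\<i> *s \<eta>) X)) / 2" for X
    unfolding real_linear_d_zeta(2)[OF linc] by (simp add: M_def sum_divide_distrib)
  have "complex_hessian \<rho> p \<xi> \<eta> = (\<Sum>k\<in>UNIV. (\<Sum>j\<in>UNIV. (M k (axis j 1) - \<i> * M k (axis j \<i>)) * \<xi> $ j) * cnj (\<eta> $ k)) / 2"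
    unfolding complex_hessian_def dz
    by (subst sum.swap) (simp add: sum_distrib_right sum_divide_distrib)
  also have "\<dots> = ((\<Sum>k\<in>UNIV. M k \<xi> * cnj (\<eta> $ k)) - \<i> * (\<Sum>k\<in>UNIV. M k (\<i> *s \<xi>) * cnj (\<eta> $ k))) / 2"
    unfolding real_linear_d_zeta(1)[OF linM, symmetric]
    by (simp add: sum_distrib_left sum_subtractf[symmetric] algebra_simps)
  also have "\<dots> = (of_real (H \<eta> \<xi>) + \<i> * of_real (H (\<i> *s \<eta>) \<xi>)
      - \<i> * of_real (H \<eta> (\<i> *s \<xi>)) + of_real (H (\<i> *s \<eta>) (\<i> *s \<xi>))) / 4"
    unfolding MX by (simp add: field_simps)
  finally show ?thesis .
qed

definition siegel_curve :: "complex ^ ('n::finite option) \<Rightarrow> complex ^ ('n option) \<Rightarrow> real \<Rightarrow> complex ^ ('n option)" where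
  "siegel_curve p X a = p + a *\<^sub>R X + (a\<^sup>2 * (norm (zpart X))\<^sup>2) *\<^sub>R axis None \<i>"

lemma zpart_siegel_curve: "zpart (siegel_curve p X a) = zpart p + a *\<^sub>R zpart X"
  by (simp add: siegel_curve_def vec_eq_iff axis_def)

lemma siegel_curve_frontier:
  assumes "p \<in> frontier siegel" "grad siegel_r p \<bullet> X = 0"
  shows "siegel_curve p X a \<in> frontier siegel"
proof -
  have "2 * (zpart p \<bullet> zpart X) = Im (X $ None)"
    using assms(2) by (simp add: grad_siegel_r inner_split[of "zembed _ _"] inner_complex_def)
  moreover have "Im (siegel_curve p X a $ None) = Im (p $ None) + a * Im (X $ None) + a\<^sup>2 * (norm (zpart X))\<^sup>2"
    by (simp add: siegel_curve_def)
  moreover have "(norm (zpart p + a *\<^sub>R zpart X))\<^sup>2 = (norm (zpart p))\<^sup>2 + a * (2 * (zpart p \<bullet> zpart X)) + a\<^sup>2 * (norm (zpart X))\<^sup>2"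
    unfolding power2_norm_eq_inner
    by (simp add: inner_add_left inner_add_right inner_commute power2_eq_square algebra_simps)
  ultimately show ?thesis
    using assms(1) by (simp add: frontier_siegel siegel_r_def zpart_siegel_curve)
qed

lemma has_derivative_siegel_curve: "(siegel_curve p X has_derivative (\<lambda>t. t *\<^sub>R X)) (at 0)"
  unfolding siegel_curve_def[abs_def] by (auto intro!: derivative_eq_intros)

lemma siegel_curve_0: "siegel_curve p X 0 = p"
  by (simp add: siegel_curve_def)

section \<open>The Levi form for an arbitrary normalized defining function\<close>

context
  fixes \<rho> :: "complex ^ ('n::finite option) \<Rightarrow> real" and U
  assumes ndf: "normalized_defining_function \<rho> U siegel"
begin

lemma ndf_props:
  "open U" "frontier siegel \<subseteq> U" "Ck_on 2 \<rho> U" "siegel \<inter> U = {x \<in> U. \<rho> x < 0}"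
  "p \<in> frontier siegel \<Longrightarrow> norm (grad \<rho> p) = 1"
  "p \<in> frontier siegel \<Longrightarrow> \<rho> p = 0"
  "x \<in> U \<Longrightarrow> \<rho> differentiable (at x)"
  "x \<in> U \<Longrightarrow> (\<lambda>x. frechet_derivative \<rho> (at x) Y) differentiable (at x)"
proof -
  have *: "Ck_defining_function 2 \<rho> U siegel"
    using ndf by (simp add: normalized_defining_function_def)
  then show "open U" "frontier siegel \<subseteq> U" "Ck_on 2 \<rho> U" "siegel \<inter> U = {x \<in> U. \<rho> x < 0}"
    by (simp_all add: Ck_defining_function_def)
  then show "x \<in> U \<Longrightarrow> \<rho> differentiable (at x)"
    "x \<in> U \<Longrightarrow> (\<lambda>x. frechet_derivative \<rho> (at x) Y) differentiable (at x)"
    by (simp_all add: numeral_2_eq_2)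
  show "p \<in> frontier siegel \<Longrightarrow> norm (grad \<rho> p) = 1"
    using ndf by (simp add: normalized_defining_function_def)
  show "p \<in> frontier siegel \<Longrightarrow> \<rho> p = 0"
    using defining_function_frontier_eq_0[OF * open_siegel] .
qed

text \<open>\<open>\<rho>\<close> is identically 0 along \<open>siegel_curve p X\<close>, whose
  velocity at 0 is \<open>X\<close>.\<close>

lemma ndf_tangential:
  assumes p: "p \<in> frontier siegel" and X: "grad siegel_r p \<bullet> X = 0"
  shows "frechet_derivative \<rho> (at p) X = 0"
proof -
  have d: "(\<rho> has_derivative frechet_derivative \<rho> (at p)) (at p)"
    using ndf_props(2,7) p by (auto simp: frechet_derivative_works[symmetric])
  have "((\<lambda>a. \<rho> (siegel_curve p X a)) has_derivative (\<lambda>t. frechet_derivative \<rho> (at p) (t *\<^sub>R X))) (at 0)"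
    by (rule has_derivative_compose[OF has_derivative_siegel_curve]) (simp add: siegel_curve_0 d)
  moreover have "(\<lambda>a. \<rho> (siegel_curve p X a)) = (\<lambda>a. 0)"
    using siegel_curve_frontier[OF p X] ndf_props(6) by blast
  ultimately have "(\<lambda>t. frechet_derivative \<rho> (at p) (t *\<^sub>R X)) = (\<lambda>t. 0)"
    using has_derivative_unique has_derivative_const by metis
  from fun_cong[OF this, of 1] show ?thesis by simp
qed

text \<open>Tangentiality makes the gradient a multiple \<open>c\<close> of that of
  \<open>siegel_r\<close>, and the normalization gives \<open>\<bar>c\<bar>\<close>. The sign of
  \<open>c\<close> is found by moving from \<open>p\<close> into the domain, where
  \<open>\<rho>\<close> must be negative.\<close>

lemma ndf_grad:
  assumes p: "p \<in> frontier siegel"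
  shows "grad \<rho> p = (1 / siegel_s p) *\<^sub>R grad siegel_r p"
proof -
  have pU: "p \<in> U" using ndf_props(2) p by auto
  have d: "(\<rho> has_derivative frechet_derivative \<rho> (at p)) (at p)"
    using ndf_props(7)[OF pU] by (simp add: frechet_derivative_works[symmetric])
  define g G where "g = grad \<rho> p" and "G = grad siegel_r p"
  define c where "c = (g \<bullet> G) / (G \<bullet> G)"
  have G: "G \<bullet> G \<noteq> 0" using norm_grad_siegel_r[of p] siegel_s_pos[of p] by (auto simp: G_def)
  have fd: "frechet_derivative \<rho> (at p) X = g \<bullet> X" for X
    unfolding g_def using ndf_props(7)[OF pU] by (rule frechet_derivative_grad)
  define X where "X = g - c *\<^sub>R G"
  have XG: "G \<bullet> X = 0" using G by (simp add: X_def c_def inner_diff_right inner_commute)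
  then have "g \<bullet> X = 0" using ndf_tangential[OF p, of X] by (simp add: fd G_def)
  then have "X \<bullet> X = 0" using XG by (simp add: X_def inner_diff_left inner_diff_right inner_commute)
  then have g: "g = c *\<^sub>R G" by (simp add: X_def)
  have "norm g = 1" using ndf_props(5)[OF p] by (simp add: g_def)
  then have c1: "\<bar>c\<bar> * siegel_s p = 1" by (simp add: g G_def norm_grad_siegel_r)
  define V :: "complex ^ ('n option)" where "V = axis None \<i>"
  have GV: "G \<bullet> V = - 1"
    by (simp add: G_def V_def grad_siegel_r inner_axis inner_complex_def)
  have "0 \<le> c"
  proof (rule ccontr)
    assume "\<not> 0 \<le> c"
    then have pos: "0 < g \<bullet> V" by (simp add: g GV)
    have "((\<lambda>t. p + t *\<^sub>R V) has_derivative (\<lambda>t. t *\<^sub>R V)) (at 0)"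
      by (auto intro!: derivative_eq_intros)
    from has_derivative_compose[OF this, of \<rho> "frechet_derivative \<rho> (at p)"] d
    have "((\<lambda>t. \<rho> (p + t *\<^sub>R V)) has_derivative (\<lambda>t. t * (g \<bullet> V))) (at 0)"
      by (simp add: fd)
    then have "((\<lambda>t. \<rho> (p + t *\<^sub>R V)) has_real_derivative (g \<bullet> V)) (at 0)"
      by (simp add: has_field_derivative_def mult_commute_abs)
    from DERIV_pos_inc_right[OF this pos] obtain e where e: "e > 0"
      "\<And>h. 0 < h \<Longrightarrow> h < e \<Longrightarrow> \<rho> p < \<rho> (p + h *\<^sub>R V)" by auto
    obtain d where dd: "d > 0" "ball p d \<subseteq> U" using ndf_props(1) pU by (meson openE)
    define h where "h = min d e / 2"
    have h: "0 < h" "h < e" "h < d" using e(1) dd(1) by (auto simp: h_def)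
    have "p + h *\<^sub>R V \<in> U"
      using dd h by (auto simp: subset_iff dist_norm V_def norm_axis_eq)
    moreover have "p + h *\<^sub>R V \<in> siegel"
    proof -
      have "zpart (p + h *\<^sub>R V) = zpart p" by (simp add: V_def vec_eq_iff axis_def)
      moreover have "siegel_r p = 0" using p by (simp add: frontier_siegel)
      ultimately show ?thesis using h by (simp add: siegel_eq siegel_r_def V_def)
    qed
    ultimately have "\<rho> (p + h *\<^sub>R V) < 0" using ndf_props(4) by auto
    with e(2)[OF h(1,2)] ndf_props(6)[OF p] show False by simp
  qed
  with c1 have "c = 1 / siegel_s p" using siegel_s_pos[of p] by (simp add: field_simps)
  with g show ?thesis by (simp add: g_def G_def)
qed

text \<open>The tangential derivatives of \<open>\<rho>\<close> vanish along \<open>siegel_curve\<close>; differentiating this identity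
  at \<open>p\<close> gives the second derivative in terms of the gradient.\<close>

lemma ndf_second_derivative:
  assumes p: "p \<in> frontier siegel" and X: "grad siegel_r p \<bullet> X = 0" and Y: "grad siegel_r p \<bullet> Y = 0"
  shows "frechet_derivative (\<lambda>x. frechet_derivative \<rho> (at x) Y) (at p) X = 2 * (zpart X \<bullet> zpart Y) / siegel_s p"
proof -
  define V :: "complex ^ ('n option)" where "V = axis None \<i>"
  define k where "k = 2 * (zpart X \<bullet> zpart Y)"
  have pU: "p \<in> U" using ndf_props(2) p by auto
  have cU: "siegel_curve p X a \<in> U" for a using siegel_curve_frontier[OF p X] ndf_props(2) by auto
  \<comment> \<open>The tangent space turns along the curve; adding
    \<open>(a * k) *\<^sub>R V\<close> to \<open>Y\<close> keeps it tangent at parameter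
    \<open>a\<close>.\<close>
  have eq: "frechet_derivative \<rho> (at (siegel_curve p X a)) Y
      + a * (k * frechet_derivative \<rho> (at (siegel_curve p X a)) V) = 0" for a
  proof -
    have lin: "linear (frechet_derivative \<rho> (at (siegel_curve p X a)))"
      using ndf_props(7)[OF cU] by (rule linear_frechet_derivative)
    have "zpart (Y + (a * k) *\<^sub>R V) = zpart Y"
      by (simp add: V_def vec_eq_iff axis_def)
    then have "grad siegel_r (siegel_curve p X a) \<bullet> (Y + (a * k) *\<^sub>R V)
        = 2 * ((zpart p + a *\<^sub>R zpart X) \<bullet> zpart Y) - Im (Y $ None) - a * k"
      unfolding grad_siegel_r inner_split[of "zembed _ _"]
      by (simp add: inner_complex_def zpart_siegel_curve V_def)
    also have "\<dots> = 0"
      using Y by (simp add: grad_siegel_r inner_split[of "zembed _ _"] inner_complex_def k_def inner_add_left)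
    finally have "grad siegel_r (siegel_curve p X a) \<bullet> (Y + (a * k) *\<^sub>R V) = 0" .
    from ndf_tangential[OF siegel_curve_frontier[OF p X] this] show ?thesis
      by (simp add: linear_add[OF lin] linear_cmul[OF lin])
  qed
  have d: "((\<lambda>a. frechet_derivative \<rho> (at (siegel_curve p X a)) W) has_derivative
      (\<lambda>t. frechet_derivative (\<lambda>x. frechet_derivative \<rho> (at x) W) (at p) (t *\<^sub>R X))) (at 0)" for W
    by (rule has_derivative_compose[OF has_derivative_siegel_curve])
      (use ndf_props(8)[OF pU] in \<open>simp add: siegel_curve_0 frechet_derivative_works[symmetric]\<close>)
  have d1: "((\<lambda>a. frechet_derivative \<rho> (at (siegel_curve p X a)) Y
      + a * (k * frechet_derivative \<rho> (at (siegel_curve p X a)) V)) has_derivative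
      (\<lambda>t. frechet_derivative (\<lambda>x. frechet_derivative \<rho> (at x) Y) (at p) (t *\<^sub>R X)
        + (0 * (k * frechet_derivative (\<lambda>x. frechet_derivative \<rho> (at x) V) (at p) (t *\<^sub>R X))
           + t * (k * frechet_derivative \<rho> (at (siegel_curve p X 0)) V)))) (at 0)"
    by (intro has_derivative_add d has_derivative_mult has_derivative_ident has_derivative_mult_right)
  have d2: "((\<lambda>a. frechet_derivative \<rho> (at (siegel_curve p X a)) Y
      + a * (k * frechet_derivative \<rho> (at (siegel_curve p X a)) V)) has_derivative (\<lambda>t. 0)) (at 0)"
    unfolding eq by (rule has_derivative_const)
  have "frechet_derivative (\<lambda>x. frechet_derivative \<rho> (at x) Y) (at p) (1 *\<^sub>R X)
        + (0 * (k * frechet_derivative (\<lambda>x. frechet_derivative \<rho> (at x) V) (at p) (1 *\<^sub>R X))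
           + 1 * (k * frechet_derivative \<rho> (at (siegel_curve p X 0)) V)) = 0"
    by (rule fun_cong[OF has_derivative_unique[OF d1 d2]])
  moreover have "frechet_derivative \<rho> (at p) V = - (1 / siegel_s p)"
    using frechet_derivative_grad[OF ndf_props(7)[OF pU]] ndf_grad[OF p]
    by (simp add: grad_siegel_r V_def inner_axis inner_complex_def)
  ultimately show ?thesis by (simp add: siegel_curve_0 k_def)
qed

lemma ndf_T10:
  assumes p: "p \<in> frontier siegel"
  shows "\<xi> \<in> T10 \<rho> p \<longleftrightarrow> \<xi> $ None = 2 * \<i> * (\<Sum>j\<in>UNIV. cnj (p $ Some j) * \<xi> $ Some j)"
    and "\<xi> \<in> T10 \<rho> p \<Longrightarrow> grad siegel_r p \<bullet> \<xi> = 0"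
    and "\<xi> \<in> T10 \<rho> p \<Longrightarrow> \<i> *s \<xi> \<in> T10 \<rho> p"
proof -
  have pU: "p \<in> U" using ndf_props(2) p by auto
  have "d_zeta j (\<lambda>\<zeta>. of_real (\<rho> \<zeta>)) p = cnj (grad siegel_r p $ j) / (2 * of_real (siegel_s p))" for j
    unfolding d_zeta_real(1)[OF ndf_props(7)[OF pU]] frechet_derivative_grad[OF ndf_props(7)[OF pU]]
    using siegel_s_pos[of p]
    by (simp add: ndf_grad[OF p] inner_axis complex_eq_iff inner_complex_def)
  then have "(\<Sum>j\<in>UNIV. d_zeta j (\<lambda>\<zeta>. of_real (\<rho> \<zeta>)) p * \<xi> $ j)
      = (\<Sum>j\<in>UNIV. cnj (grad siegel_r p $ j) * \<xi> $ j) / (2 * of_real (siegel_s p))" for \<xi>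
    by (simp add: sum_divide_distrib)
  then have T: "\<xi> \<in> T10 \<rho> p \<longleftrightarrow> (\<Sum>j\<in>UNIV. cnj (grad siegel_r p $ j) * \<xi> $ j) = 0" for \<xi>
    using siegel_s_pos[of p] by (simp add: T10_def)
  have "(\<Sum>j\<in>UNIV. cnj (grad siegel_r p $ j) * \<xi> $ j)
      = \<i> * (\<xi> $ None - 2 * \<i> * (\<Sum>j\<in>UNIV. cnj (p $ Some j) * \<xi> $ Some j))"
    by (simp add: grad_siegel_r sum_UNIV_option scaleR_conv_of_real sum_distrib_left sum_negf algebra_simps)
  then show "\<xi> \<in> T10 \<rho> p \<longleftrightarrow> \<xi> $ None = 2 * \<i> * (\<Sum>j\<in>UNIV. cnj (p $ Some j) * \<xi> $ Some j)"
    unfolding T by simp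
  show "\<xi> \<in> T10 \<rho> p \<Longrightarrow> grad siegel_r p \<bullet> \<xi> = 0"
    unfolding T by (simp add: inner_complex_vec)
  show "\<xi> \<in> T10 \<rho> p \<Longrightarrow> \<i> *s \<xi> \<in> T10 \<rho> p"
    unfolding T by (simp add: mult.left_commute[of _ \<i>] sum_distrib_left[symmetric])
qed

text \<open>By \<open>ndf_second_derivative\<close> the four real second derivatives are, up to sign
  and the factor \<open>2 / siegel_s p\<close>, real and imaginary parts of one hermitian product,
  and they recombine to it.\<close>

lemma ndf_levi_form:
  assumes p: "p \<in> frontier siegel" and \<xi>: "\<xi> \<in> T10 \<rho> p" and \<eta>: "\<eta> \<in> T10 \<rho> p"
  shows "complex_hessian \<rho> p \<xi> \<eta> = (\<Sum>j\<in>UNIV. \<xi> $ Some j * cnj (\<eta> $ Some j)) / of_real (siegel_s p)"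
proof -
  have pU: "p \<in> U" using ndf_props(2) p by auto
  define h where "h = (\<Sum>j\<in>UNIV. \<xi> $ Some j * cnj (\<eta> $ Some j))"
  have "zpart \<xi> \<bullet> zpart \<eta> = Re h" "zpart (\<i> *s \<xi>) \<bullet> zpart \<eta> = - Im h" "zpart \<xi> \<bullet> zpart (\<i> *s \<eta>) = Im h"
    "zpart (\<i> *s \<xi>) \<bullet> zpart (\<i> *s \<eta>) = Re h"
    by (simp_all add: h_def inner_vec_def inner_complex_def sum_negf[symmetric] algebra_simps)
  with p show ?thesis
    unfolding complex_hessian_real[OF ndf_props(1) pU ndf_props(3)] h_def[symmetric]
    using siegel_s_pos[of p]
    by (simp add: ndf_second_derivative ndf_T10(2)[OF p] ndf_T10(3)[OF p] \<xi> \<eta> complex_eq_iff field_simps)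
qed

end

lemma strictly_pseudoconvex_siegel: "strictly_pseudoconvex (siegel :: (complex ^ ('n::finite option)) set)"
proof -
  have ndf: "normalized_defining_function siegel_rho siegel_nbhd (siegel :: (complex ^ ('n option)) set)"
    unfolding normalized_defining_function_def
    using Ck_defining_function_siegel_rho norm_grad_siegel_rho_frontier by blast
  have "\<mu> > 0" if p: "p \<in> frontier siegel" and \<mu>: "levi_eigenvalue siegel_rho p \<mu>"
    for p :: "complex ^ ('n option)" and \<mu>
  proof -
    obtain \<xi> where \<xi>: "\<xi> \<in> T10 siegel_rho p" "\<xi> \<noteq> 0"
      "complex_hessian siegel_rho p \<xi> \<xi> = of_real \<mu> * (\<Sum>j\<in>UNIV. \<xi> $ j * cnj (\<xi> $ j))"
      using \<mu> unfolding levi_eigenvalue_def by blast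
    have sq: "(\<Sum>j\<in>UNIV. v $ j * cnj (v $ j)) = of_real ((norm v)\<^sup>2)" for v :: "complex ^ 'm::finite"
      by (simp add: norm_vec_power2 complex_norm_square[symmetric])
    have "of_real ((norm (zpart \<xi>))\<^sup>2 / siegel_s p) = complex_of_real (\<mu> * (norm \<xi>)\<^sup>2)"
      using \<xi>(3) unfolding ndf_levi_form[OF ndf p \<xi>(1) \<xi>(1)] sq sq[of "zpart \<xi>", unfolded zpart_nth] by simp
    then have eq: "(norm (zpart \<xi>))\<^sup>2 / siegel_s p = \<mu> * (norm \<xi>)\<^sup>2"
      unfolding of_real_eq_iff .
    \<comment> \<open>The tangency equation determines the \<open>None\<close> component from the
      z-part, so a nonzero tangent vector has a nonzero z-part.\<close>
    have "zpart \<xi> \<noteq> 0"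
    proof
      assume z: "zpart \<xi> = 0"
      then have S: "\<xi> $ Some j = 0" for j by (simp add: vec_eq_iff)
      then have N: "\<xi> $ None = 0" using ndf_T10(1)[OF ndf p, of \<xi>] \<xi>(1) by simp
      have "\<xi> $ i = 0" for i by (cases i) (simp_all add: S N)
      then have "\<xi> = 0" by (simp add: vec_eq_iff)
      with \<xi>(2) show False ..
    qed
    then have "0 < \<mu> * (norm \<xi>)\<^sup>2" unfolding eq[symmetric] using siegel_s_pos[of p] by simp
    then show "\<mu> > 0" by (simp add: zero_less_mult_iff)
  qed
  with ndf show ?thesis unfolding strictly_pseudoconvex_def by blast
qed

text \<open>At \<open>(R e\<^sub>j, i R\<^sup>2)\<close> the complex tangent direction \<open>e\<^sub>j + 2iR e\<^sub>w\<close> has eigenvalue \<open>(1 + 4R\<^sup>2)\<^bsup>-3/2\<^esup>\<close>.\<close>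

lemma not_uniformly_strictly_pseudoconvex_siegel:
  "\<not> uniformly_strictly_pseudoconvex (siegel :: (complex ^ ('n::finite option)) set)"
proof
  assume "uniformly_strictly_pseudoconvex (siegel :: (complex ^ ('n option)) set)"
  then obtain \<rho> U c where ndf: "normalized_defining_function \<rho> U (siegel :: (complex ^ ('n option)) set)"
    and c: "c > 0" "\<And>p \<mu>. p \<in> frontier siegel \<Longrightarrow> levi_eigenvalue \<rho> p \<mu> \<Longrightarrow> \<mu> > c"
    unfolding uniformly_strictly_pseudoconvex_def by blast
  \<comment> \<open>Chosen so that \<open>1 / (2 * R)\<close>, an upper bound for the eigenvalue
    found below, equals \<open>c\<close>.\<close>
  define R where "R = 1 / (2 * c)"
  obtain j :: 'n where True by simp
  define p where "p = zembed (axis j (of_real R)) (\<i> * of_real (R\<^sup>2))"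
  have R: "R > 0" using c by (simp add: R_def)
  have p: "p \<in> frontier siegel"
    by (simp add: frontier_siegel siegel_r_def p_def norm_axis_eq)
  have s: "siegel_s p = sqrt (1 + 4 * R\<^sup>2)"
    using R by (simp add: siegel_s_def p_def norm_axis_eq)
  define \<xi> where "\<xi> = zembed (axis j 1) (2 * \<i> * of_real R)"
  have T: "\<eta> \<in> T10 \<rho> p \<longleftrightarrow> \<eta> $ None = 2 * \<i> * (of_real R * \<eta> $ Some j)" for \<eta>
  proof -
    have "(\<Sum>k\<in>UNIV. cnj (p $ Some k) * \<eta> $ Some k) = (\<Sum>k\<in>UNIV. if k = j then of_real R * \<eta> $ Some j else 0)"
      by (intro sum.cong) (auto simp: p_def axis_def)
    then show ?thesis unfolding ndf_T10(1)[OF ndf p] by simp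
  qed
  have \<xi>: "\<xi> \<in> T10 \<rho> p" by (simp add: T \<xi>_def)
  \<comment> \<open>The Levi form contributes one factor \<open>1 / siegel_s p\<close>. The other
    two come from the squared length of \<open>\<xi>\<close>, which is
    \<open>(siegel_s p)\<^sup>2\<close>.\<close>
  have "levi_eigenvalue \<rho> p (1 / (siegel_s p) ^ 3)"
    unfolding levi_eigenvalue_def
  proof (intro bexI[OF _ \<xi>] conjI ballI)
    have "\<xi> $ Some j \<noteq> 0" by (simp add: \<xi>_def)
    then show "\<xi> \<noteq> 0" by auto
    fix \<eta> assume \<eta>: "\<eta> \<in> T10 \<rho> p"
    have S: "(\<Sum>k\<in>UNIV. \<xi> $ Some k * cnj (\<eta> $ Some k)) = cnj (\<eta> $ Some j)"
    proof -
      have "(\<Sum>k\<in>UNIV. \<xi> $ Some k * cnj (\<eta> $ Some k)) = (\<Sum>k\<in>UNIV. if k = j then cnj (\<eta> $ Some j) else 0)"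
        by (intro sum.cong) (auto simp: \<xi>_def axis_def)
      then show ?thesis by simp
    qed
    have "(\<Sum>k\<in>UNIV. \<xi> $ k * cnj (\<eta> $ k)) = of_real (1 + 4 * R\<^sup>2) * cnj (\<eta> $ Some j)"
      using \<eta>[unfolded T] by (simp add: sum_UNIV_option S) (simp add: \<xi>_def power2_eq_square algebra_simps)
    also have "1 + 4 * R\<^sup>2 = (siegel_s p)\<^sup>2"
      unfolding s by (simp add: add_nonneg_nonneg)
    finally show "complex_hessian \<rho> p \<xi> \<eta> = of_real (1 / (siegel_s p) ^ 3) * (\<Sum>k\<in>UNIV. \<xi> $ k * cnj (\<eta> $ k))"
      using siegel_s_pos[of p] unfolding ndf_levi_form[OF ndf p \<xi> \<eta>] S
      by (simp add: power2_eq_square power3_eq_cube)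
  qed
  then have "c < 1 / (siegel_s p) ^ 3" using c(2)[OF p] by blast
  also have "\<dots> \<le> 1 / siegel_s p"
    using siegel_s_ge(1)[of p] self_le_power[of "siegel_s p" 3] by (intro divide_left_mono) auto
  also have "\<dots> \<le> 1 / (2 * R)"
    using siegel_s_ge(2)[of p] R by (intro divide_left_mono) (auto simp: p_def norm_axis_eq)
  also have "\<dots> = c" using c by (simp add: R_def)
  finally show False by simp
qed

section \<open>Smooth forms in the domains of the operators\<close>

lemma d_zeta_eqI:
  assumes "(f has_derivative D) (at x)"
  shows "d_zeta j f x = (D (axis j 1) - \<i> * D (axis j \<i>)) / 2"
    and "d_zetabar j f x = (D (axis j 1) + \<i> * D (axis j \<i>)) / 2"
  unfolding d_zeta_def d_zetabar_def frechet_derivative_at[OF assms, symmetric] by simp_all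

lemma smooth_d_zeta: "smooth f \<Longrightarrow> smooth (d_zeta j f)" "smooth f \<Longrightarrow> smooth (d_zetabar j f)"
proof -
  assume "smooth f"
  then have *: "smooth (\<lambda>\<zeta>. frechet_derivative f (at \<zeta>) v)" for v
    by (rule smooth_frechet_derivative)
  show "smooth (d_zeta j f)" "smooth (d_zetabar j f)"
    unfolding d_zeta_def[abs_def] d_zetabar_def[abs_def]
    by (intro smooth_linear_compose[OF bounded_linear_divide] smooth_intros *)+
qed

lemma d_zeta_mult:
  assumes "smooth f" "smooth g"
  shows "d_zeta j (\<lambda>x. f x * g x) x = d_zeta j f x * g x + f x * d_zeta j g x"
    and "d_zetabar j (\<lambda>x. f x * g x) x = d_zetabar j f x * g x + f x * d_zetabar j g x"
  unfolding d_zeta_eqI[OF has_derivative_mult[OF smooth_has_derivative[OF assms(1)] smooth_has_derivative[OF assms(2)]]]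
  by (simp_all add: d_zeta_def d_zetabar_def field_simps)

lemma d_zeta_add:
  assumes "smooth f" "smooth g"
  shows "d_zeta j (\<lambda>x. f x + g x) x = d_zeta j f x + d_zeta j g x"
    and "d_zetabar j (\<lambda>x. f x + g x) x = d_zetabar j f x + d_zetabar j g x"
  unfolding d_zeta_eqI[OF has_derivative_add[OF smooth_has_derivative[OF assms(1)] smooth_has_derivative[OF assms(2)]]]
  by (simp_all add: d_zeta_def d_zetabar_def field_simps)

lemma d_zeta_const: "d_zeta j (\<lambda>x. c) x = 0" "d_zetabar j (\<lambda>x. c) x = 0"
  unfolding d_zeta_eqI[OF has_derivative_const] by simp_all

lemma d_zeta_sum:
  assumes "\<And>i. i \<in> I \<Longrightarrow> smooth (f i)"
  shows "d_zeta j (\<lambda>x. \<Sum>i\<in>I. f i x) x = (\<Sum>i\<in>I. d_zeta j (f i) x)"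
    and "d_zetabar j (\<lambda>x. \<Sum>i\<in>I. f i x) x = (\<Sum>i\<in>I. d_zetabar j (f i) x)"
  using assms by (induction I rule: infinite_finite_induct)
    (auto simp: d_zeta_const d_zeta_add smooth_sum)

lemma d_zeta_cnj:
  assumes "smooth f"
  shows "d_zeta j (\<lambda>x. cnj (f x)) x = cnj (d_zetabar j f x)"
    and "d_zetabar j (\<lambda>x. cnj (f x)) x = cnj (d_zeta j f x)"
  unfolding d_zeta_eqI[OF has_derivative_cnj[OF smooth_has_derivative[OF assms]]]
  by (simp_all add: d_zeta_def d_zetabar_def)

lemma d_zeta_component:
  "d_zeta j (\<lambda>\<zeta>. \<zeta> $ k) x = (if j = k then 1 else 0)" "d_zetabar j (\<lambda>\<zeta>. \<zeta> $ k) x = 0"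
  unfolding d_zeta_eqI[OF bounded_linear_imp_has_derivative[OF bounded_linear_vec_nth]]
  by (simp_all add: axis_def)

lemma d_zeta_exp:
  assumes "smooth f"
  shows "d_zeta j (\<lambda>x. exp (f x)) x = exp (f x) * d_zeta j f x"
    and "d_zetabar j (\<lambda>x. exp (f x)) x = exp (f x) * d_zetabar j f x"
  unfolding d_zeta_eqI[OF has_derivative_compose[OF smooth_has_derivative[OF assms]
        has_field_derivative_imp_has_derivative[OF DERIV_exp]]]
  by (simp_all add: d_zeta_def d_zetabar_def field_simps)

lemma d_zeta_compose_real:
  fixes \<theta> :: "complex ^ 'm::finite \<Rightarrow> real"
  assumes "smooth \<theta>" "(g has_real_derivative g') (at (\<theta> x))"
  shows "d_zeta j (\<lambda>x. of_real (g (\<theta> x))) x = of_real g' * d_zeta j (\<lambda>x. of_real (\<theta> x)) x" (is ?g0)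
    and "d_zetabar j (\<lambda>x. of_real (g (\<theta> x))) x = of_real g' * d_zetabar j (\<lambda>x. of_real (\<theta> x)) x" (is ?g1)
proof -
  have "((\<lambda>x. complex_of_real (g (\<theta> x))) has_derivative (\<lambda>h. of_real (g' * frechet_derivative \<theta> (at x) h))) (at x)"
    by (rule has_derivative_of_real[OF has_derivative_compose[OF smooth_has_derivative[OF assms(1)]
        has_field_derivative_imp_has_derivative[OF assms(2)]]])
  note * = d_zeta_eqI[OF this]
  show ?g0
    and ?g1
    unfolding * d_zeta_real[OF smooth_differentiable[OF assms(1)]] by (simp_all add: field_simps)
qed

lemma complex_norm_sq_vec: "complex_of_real ((norm \<zeta>)\<^sup>2) = (\<Sum>j\<in>UNIV. \<zeta> $ j * cnj (\<zeta> $ j))"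
  for \<zeta> :: "complex ^ 'm::finite"
  by (simp add: norm_vec_power2 complex_norm_square[symmetric])

lemma d_zeta_norm_sq:
  "d_zeta k (\<lambda>\<zeta>. complex_of_real ((norm \<zeta>)\<^sup>2)) \<zeta> = cnj (\<zeta> $ k)" (is ?g0)
  "d_zetabar k (\<lambda>\<zeta>. complex_of_real ((norm \<zeta>)\<^sup>2)) \<zeta> = \<zeta> $ k" (is ?g1)
proof -
  have s: "smooth (\<lambda>\<zeta>::complex^'m::finite. \<zeta> $ j * cnj (\<zeta> $ j))" for j
    by (intro smooth_intros)
  have "d_zeta k (\<lambda>\<zeta>. \<zeta> $ j * cnj (\<zeta> $ j)) \<zeta> = (if j = k then cnj (\<zeta> $ k) else 0)"
    "d_zetabar k (\<lambda>\<zeta>. \<zeta> $ j * cnj (\<zeta> $ j)) \<zeta> = (if j = k then \<zeta> $ k else 0)" for j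
    by (simp_all add: d_zeta_mult d_zeta_cnj d_zeta_component smooth_component smooth_cnj)
  then show ?g0
    ?g1
    unfolding complex_norm_sq_vec by (simp_all add: d_zeta_sum s)
qed

lemma smooth_weight: "smooth (\<lambda>\<zeta>. complex_of_real (weight t \<zeta>))"
  unfolding weight_def exp_of_real[symmetric]
  by (intro smooth_intros smooth_linear bounded_linear_ident)

lemma weight_pos: "0 < weight t \<zeta>" by (simp add: weight_def)

lemma d_zetabar_weight:
  "d_zetabar k (\<lambda>\<zeta>. complex_of_real (weight t \<zeta>)) \<zeta> = - of_real t * \<zeta> $ k * of_real (weight t \<zeta>)"
proof -
  have s: "smooth (\<lambda>\<zeta>::complex^'m::finite. (norm \<zeta>)\<^sup>2)"
    by (intro smooth_intros smooth_linear bounded_linear_ident)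
  have "((\<lambda>x. exp (- t * x)) has_real_derivative (exp (- t * (norm \<zeta>)\<^sup>2) * (- t))) (at ((norm \<zeta>)\<^sup>2))"
    by (auto intro!: derivative_eq_intros)
  from d_zeta_compose_real(2)[OF s this, of k] show ?thesis
    unfolding weight_def d_zeta_norm_sq by simp
qed

lemma continuous_on_weight: "continuous_on S (weight t)"
  unfolding weight_def[abs_def] by (intro continuous_intros)

text \<open>Compactness is meant in the whole space, not in the domain: the forms to be tested must
  not vanish on the boundary.\<close>

definition compact_support :: "('a::topological_space \<Rightarrow> 'b::zero) \<Rightarrow> bool" where
  "compact_support f \<longleftrightarrow> (\<exists>K. compact K \<and> (\<forall>x. x \<notin> K \<longrightarrow> f x = 0))"

lemma compact_support_mult:
  fixes f g :: "'a::topological_space \<Rightarrow> 'b::mult_zero"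
  shows "compact_support f \<Longrightarrow> compact_support (\<lambda>x. f x * g x)"
    and "compact_support g \<Longrightarrow> compact_support (\<lambda>x. f x * g x)"
  unfolding compact_support_def by force+

lemma compact_support_compose:
  "compact_support f \<Longrightarrow> (\<And>x. f x = 0 \<Longrightarrow> g x = 0) \<Longrightarrow> compact_support g"
  unfolding compact_support_def by blast

lemma compact_support_add:
  fixes f g :: "'a::t2_space \<Rightarrow> 'b::monoid_add"
  assumes "compact_support f" "compact_support g"
  shows "compact_support (\<lambda>x. f x + g x)"
proof -
  obtain K L where "compact K" "\<forall>x. x \<notin> K \<longrightarrow> f x = 0" "compact L" "\<forall>x. x \<notin> L \<longrightarrow> g x = 0"
    using assms unfolding compact_support_def by blast
  then show ?thesis
    unfolding compact_support_def by (intro exI[of _ "K \<union> L"]) auto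
qed

lemma compact_support_sum:
  fixes f :: "'i \<Rightarrow> 'a::t2_space \<Rightarrow> 'b::comm_monoid_add"
  shows "(\<And>i. i \<in> I \<Longrightarrow> compact_support (f i)) \<Longrightarrow> compact_support (\<lambda>x. \<Sum>i\<in>I. f i x)"
proof (induction I rule: infinite_finite_induct)
  case (insert i I)
  then show ?case by (simp add: compact_support_add)
qed (auto simp: compact_support_def intro: exI[of _ "{}"])

lemma compact_support_d_zeta:
  assumes "compact_support f"
  shows "compact_support (d_zeta j f)" "compact_support (d_zetabar j f)"
proof -
  obtain K where K: "compact K" "\<And>x. x \<notin> K \<Longrightarrow> f x = 0"
    using assms unfolding compact_support_def by blast
  have "d_zeta j f x = 0 \<and> d_zetabar j f x = 0" if "x \<notin> K" for x
    unfolding d_zeta_def d_zetabar_def using frechet_derivative_outside_support[OF K that] by simp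
  with K(1) show "compact_support (d_zeta j f)" "compact_support (d_zetabar j f)"
    unfolding compact_support_def by blast+
qed

lemma integrable_compact_support:
  fixes h :: "'a::euclidean_space \<Rightarrow> 'b::{banach,second_countable_topology}"
  assumes "continuous_on UNIV h" "compact_support h"
  shows "integrable lborel h" "integrable lebesgue h"
    "\<Omega> \<in> sets borel \<Longrightarrow> set_integrable lebesgue \<Omega> h"
proof -
  show 1: "integrable lborel h"
    using assms integrable_continuous_compact_support unfolding compact_support_def by metis
  show 2: "integrable lebesgue h"
    using 1 assms(1) by (subst integrable_completion) (auto intro: borel_measurable_continuous_onI)
  show "\<Omega> \<in> sets borel \<Longrightarrow> set_integrable lebesgue \<Omega> h"
    unfolding set_integrable_def using 2 by (intro integrable_mult_indicator) auto
qed

lemma set_integral_compact_support: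
  fixes h :: "'a::euclidean_space \<Rightarrow> 'b::{banach,second_countable_topology}"
  assumes "continuous_on UNIV h" "\<And>x. x \<notin> \<Omega> \<Longrightarrow> h x = 0"
  shows "(LINT x:\<Omega>|lebesgue. h x) = (LINT x|lborel. h x)"
proof -
  have "(\<lambda>x. indicator \<Omega> x *\<^sub>R h x) = h"
    using assms(2) by (auto simp: indicator_def fun_eq_iff)
  then show ?thesis
    using assms(1) unfolding set_lebesgue_integral_def
    by (simp add: integral_completion borel_measurable_continuous_onI)
qed

lemma integral_d_zetabar_eq_0:
  assumes "smooth h" "compact_support h"
  shows "(LINT \<zeta>|lborel. d_zetabar k h \<zeta>) = 0"
proof -
  obtain K where K: "compact K" "\<And>x. x \<notin> K \<Longrightarrow> h x = 0"
    using assms unfolding compact_support_def by blast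
  have c: "continuous_on UNIV (\<lambda>x. frechet_derivative h (at x) v)" for v
    by (intro smooth_continuous_on smooth_frechet_derivative assms)
  have "compact_support (\<lambda>x. frechet_derivative h (at x) v)" for v
    unfolding compact_support_def
    by (intro exI[of _ K] conjI allI impI K(1) frechet_derivative_outside_support[OF K])
  then have i: "integrable lborel (\<lambda>x. frechet_derivative h (at x) v)" for v
    by (intro integrable_compact_support c)
  have z: "(LINT x|lborel. frechet_derivative h (at x) v) = 0" for v
    by (rule integral_frechet_derivative_eq_0[OF smooth_differentiable[OF assms(1)] c K])
  show ?thesis
    unfolding d_zetabar_def using i z by simp
qed

lemma L2_form_smooth:
  assumes "\<And>J. smooth (f J)" "\<And>J. compact_support (f J)" "\<Omega> \<in> sets borel"
  shows "L2_form \<Omega> t q f"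
  unfolding L2_form_def
proof (intro allI impI conjI)
  fix J
  have c: "continuous_on UNIV (f J)" by (rule smooth_continuous_on[OF assms(1)])
  show "set_borel_measurable lebesgue \<Omega> (f J)"
    unfolding set_borel_measurable_def
    by (intro borel_measurable_scaleR borel_measurable_indicator measurable_completion)
      (use assms(3) c in \<open>auto intro: borel_measurable_continuous_onI\<close>)
  show "set_integrable lebesgue \<Omega> (\<lambda>\<zeta>. (cmod (f J \<zeta>))\<^sup>2 * weight t \<zeta>)"
    by (intro integrable_compact_support assms(3) continuous_intros c continuous_on_weight)
      (rule compact_support_compose[OF assms(2)[of J]], simp)
qed

lemma set_integrable_sum:
  fixes f :: "'i \<Rightarrow> 'a \<Rightarrow> 'b::{banach,second_countable_topology}"
  assumes "\<And>i. i \<in> I \<Longrightarrow> set_integrable M A (f i)"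
  shows "set_integrable M A (\<lambda>x. \<Sum>i\<in>I. f i x)"
  using assms unfolding set_integrable_def scaleR_sum_right by (rule Bochner_Integration.integrable_sum)

lemma set_integral_sum:
  fixes f :: "'i \<Rightarrow> 'a \<Rightarrow> 'b::{banach,second_countable_topology}"
  assumes "\<And>i. i \<in> I \<Longrightarrow> set_integrable M A (f i)"
  shows "(LINT x:A|M. \<Sum>i\<in>I. f i x) = (\<Sum>i\<in>I. LINT x:A|M. f i x)"
  using assms unfolding set_integrable_def set_lebesgue_integral_def scaleR_sum_right
  by (rule Bochner_Integration.integral_sum)

definition dbar_smooth :: "('m::{finite,linorder}) form \<Rightarrow> 'm form" where
  "dbar_smooth f K \<zeta> = (\<Sum>k\<in>K. wedge_sign k K * d_zetabar k (f (K - {k})) \<zeta>)"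

lemma test_function_props:
  assumes "test_function U \<phi>"
  shows "smooth \<phi>" "compact_support \<phi>" "x \<notin> U \<Longrightarrow> \<phi> x = 0"
  using assms unfolding test_function_def smooth_def compact_support_def by blast+

text \<open>Integration by parts: the test function vanishes off a compact subset of
  \<open>\<Omega>\<close>, so the integrals extend to the whole space. There the
  \<open>d_zetabar\<close> derivative of each product of a coefficient with the test function
  integrates to 0.\<close>

lemma has_dbar_smooth:
  fixes f :: "('m::{finite,linorder}) form"
  assumes f: "\<And>J. smooth (f J)" "\<And>J. compact_support (f J)" and \<Omega>: "open \<Omega>"
  shows "has_dbar \<Omega> t q f (dbar_smooth f)"
  unfolding has_dbar_def
proof (intro conjI allI impI)
  have g: "smooth (dbar_smooth f K)" "compact_support (dbar_smooth f K)" for K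
    unfolding dbar_smooth_def[abs_def]
    by (intro smooth_intros smooth_d_zeta f compact_support_sum compact_support_mult(2) compact_support_d_zeta)+
  show "L2_form \<Omega> t q f" "L2_form \<Omega> t (Suc q) (dbar_smooth f)"
    by (rule L2_form_smooth; rule f g borel_open[OF \<Omega>])+
  fix K :: "'m set" and \<phi> assume "card K = Suc q \<and> test_function \<Omega> \<phi>"
  then have \<phi>: "smooth \<phi>" "compact_support \<phi>" "\<And>x. x \<notin> \<Omega> \<Longrightarrow> \<phi> x = 0"
    using test_function_props by blast+
  have d\<phi>: "d_zetabar k \<phi> x = 0" if "x \<notin> \<Omega>" for k x
  proof -
    obtain L where L: "compact L" "L \<subseteq> \<Omega>" "\<And>x. x \<notin> L \<Longrightarrow> \<phi> x = 0"
      using \<open>card K = Suc q \<and> test_function \<Omega> \<phi>\<close> unfolding test_function_def by blast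
    with that have "x \<notin> L" by blast
    then show ?thesis
      unfolding d_zetabar_def using frechet_derivative_outside_support[OF L(1,3)] by simp
  qed
  have 1: "(LINT \<zeta>:\<Omega>|lebesgue. dbar_smooth f K \<zeta> * \<phi> \<zeta>) = (LINT \<zeta>|lborel. dbar_smooth f K \<zeta> * \<phi> \<zeta>)"
    by (rule set_integral_compact_support) (use \<phi> g in \<open>auto intro!: smooth_continuous_on smooth_mult\<close>)
  have 2: "(LINT \<zeta>:\<Omega>|lebesgue. \<Sum>k\<in>K. wedge_sign k K * f (K - {k}) \<zeta> * d_zetabar k \<phi> \<zeta>)
      = (LINT \<zeta>|lborel. (\<Sum>k\<in>K. wedge_sign k K * f (K - {k}) \<zeta> * d_zetabar k \<phi> \<zeta>))"
    by (rule set_integral_compact_support)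
      (use d\<phi> in \<open>auto intro!: smooth_continuous_on smooth_intros smooth_d_zeta f \<phi>\<close>)
  have i1: "integrable lborel (\<lambda>\<zeta>. dbar_smooth f K \<zeta> * \<phi> \<zeta>)"
    by (intro integrable_compact_support smooth_continuous_on smooth_mult g \<phi> compact_support_mult(2))
  have i2: "integrable lborel (\<lambda>\<zeta>. \<Sum>k\<in>K. wedge_sign k K * f (K - {k}) \<zeta> * d_zetabar k \<phi> \<zeta>)"
    by (intro integrable_compact_support smooth_continuous_on smooth_intros smooth_d_zeta f \<phi>
        compact_support_sum compact_support_mult(2) compact_support_d_zeta)
  have sm: "smooth (\<lambda>\<zeta>. f J \<zeta> * \<phi> \<zeta>)" "compact_support (\<lambda>\<zeta>. f J \<zeta> * \<phi> \<zeta>)" for J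
    by (intro smooth_mult f \<phi> compact_support_mult(2))+
  have "(LINT \<zeta>|lborel. dbar_smooth f K \<zeta> * \<phi> \<zeta>)
      + (LINT \<zeta>|lborel. (\<Sum>k\<in>K. wedge_sign k K * f (K - {k}) \<zeta> * d_zetabar k \<phi> \<zeta>))
      = (LINT \<zeta>|lborel. dbar_smooth f K \<zeta> * \<phi> \<zeta> + (\<Sum>k\<in>K. wedge_sign k K * f (K - {k}) \<zeta> * d_zetabar k \<phi> \<zeta>))"
    using i1 i2 by simp
  also have "\<dots> = (LINT \<zeta>|lborel. (\<Sum>k\<in>K. wedge_sign k K * d_zetabar k (\<lambda>\<zeta>. f (K - {k}) \<zeta> * \<phi> \<zeta>) \<zeta>))"
    by (simp add: d_zeta_mult f \<phi> dbar_smooth_def sum_distrib_right sum_distrib_left sum.distrib algebra_simps)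
  also have "\<dots> = (\<Sum>k\<in>K. wedge_sign k K * (LINT \<zeta>|lborel. d_zetabar k (\<lambda>\<zeta>. f (K - {k}) \<zeta> * \<phi> \<zeta>) \<zeta>))"
    by (subst Bochner_Integration.integral_sum)
      (auto intro!: integrable_mult_right integrable_compact_support smooth_continuous_on smooth_d_zeta
        compact_support_d_zeta sm)
  also have "\<dots> = 0"
    by (simp add: integral_d_zetabar_eq_0 sm)
  finally show "(LINT \<zeta>:\<Omega>|lebesgue. dbar_smooth f K \<zeta> * \<phi> \<zeta>) =
      - (LINT \<zeta>:\<Omega>|lebesgue. \<Sum>k\<in>K. wedge_sign k K * f (K - {k}) \<zeta> * d_zetabar k \<phi> \<zeta>)"
    unfolding 1 2 by (rule add_eq_0_iff2[THEN iffD1])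
qed

text \<open>The formal adjoint: the bracket is the \<open>d_zeta\<close> derivative of the
  coefficient times \<open>weight t\<close>, divided by \<open>weight t\<close>.\<close>

definition theta_smooth :: "real \<Rightarrow> ('m::{finite,linorder}) form \<Rightarrow> 'm form" where
  "theta_smooth t f K \<zeta> = - (\<Sum>k\<in>- K. wedge_sign k (insert k K) *
     (d_zeta k (f (insert k K)) \<zeta> - of_real t * cnj (\<zeta> $ k) * f (insert k K) \<zeta>))"

lemma cnj_wedge_sign [simp]: "cnj (wedge_sign k K) = wedge_sign k K"
  by (simp add: wedge_sign_def)

text \<open>Deleting \<open>k\<close> from \<open>J\<close> and inserting \<open>k\<close> into
  \<open>K\<close> are inverse to each other on the index pairs. This moves the sum from the
  coefficients of \<open>\<partial>bar\<close> to those of its adjoint.\<close>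

lemma sum_insert_reindex:
  fixes F :: "'m::finite \<Rightarrow> 'm set \<Rightarrow> 'm set \<Rightarrow> 'b::comm_monoid_add"
  shows "(\<Sum>J | card J = Suc q. \<Sum>k\<in>J. F k J (J - {k})) = (\<Sum>K | card K = q. \<Sum>k\<in>- K. F k (insert k K) K)"
proof -
  have fin: "finite A" for A :: "'m set" by simp
  have "(\<Sum>J | card J = Suc q. \<Sum>k\<in>J. F k J (J - {k}))
      = (\<Sum>(J, k)\<in>Sigma {J. card J = Suc q} (\<lambda>J. J). F k J (J - {k}))"
    by (subst sum.Sigma) auto
  also have "\<dots> = (\<Sum>(K, k)\<in>Sigma {K. card K = q} (\<lambda>K. - K). F k (insert k K) K)"
    by (rule sum.reindex_bij_witness[where i = "\<lambda>(K, k). (insert k K, k)" and j = "\<lambda>(J, k). (J - {k}, k)"])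
      (auto simp: insert_absorb)
  also have "\<dots> = (\<Sum>K | card K = q. \<Sum>k\<in>- K. F k (insert k K) K)"
    by (subst sum.Sigma) auto
  finally show ?thesis .
qed

text \<open>With \<open>w\<close> the weight, \<open>|a b|\<close> is at most
  \<open>|a|^2 w + |b|^2 / w\<close>. The second term is integrable because \<open>b\<close> has
  compact support and \<open>w\<close> is continuous and positive.\<close>

lemma set_integrable_L2_mult:
  fixes a b :: "complex ^ 'm::finite \<Rightarrow> complex"
  assumes a: "set_borel_measurable lebesgue \<Omega> a" "set_integrable lebesgue \<Omega> (\<lambda>\<zeta>. (cmod (a \<zeta>))\<^sup>2 * weight t \<zeta>)"
    and b: "continuous_on UNIV b" "compact_support b" and \<Omega>: "\<Omega> \<in> sets borel"
  shows "set_integrable lebesgue \<Omega> (\<lambda>\<zeta>. a \<zeta> * b \<zeta>)"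
proof -
  have "continuous_on UNIV (\<lambda>\<zeta>. (cmod (b \<zeta>))\<^sup>2 / weight t \<zeta>)"
    by (intro continuous_on_divide continuous_on_power continuous_on_norm b(1) continuous_on_weight)
      (simp add: weight_def)
  moreover have "compact_support (\<lambda>\<zeta>. (cmod (b \<zeta>))\<^sup>2 / weight t \<zeta>)"
    by (rule compact_support_compose[OF b(2)]) simp
  ultimately have "set_integrable lebesgue \<Omega> (\<lambda>\<zeta>. (cmod (b \<zeta>))\<^sup>2 / weight t \<zeta>)"
    using \<Omega> by (rule integrable_compact_support(3))
  then have int: "set_integrable lebesgue \<Omega> (\<lambda>\<zeta>. (cmod (a \<zeta>))\<^sup>2 * weight t \<zeta> + (cmod (b \<zeta>))\<^sup>2 / weight t \<zeta>)"
    using a(2) by (rule set_integral_add[rotated])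
  have meas: "(\<lambda>\<zeta>. indicator \<Omega> \<zeta> *\<^sub>R (a \<zeta> * b \<zeta>)) \<in> borel_measurable lebesgue"
  proof -
    have "b \<in> borel_measurable lebesgue"
      using b(1) by (intro measurable_completion) (auto intro: borel_measurable_continuous_onI)
    then have "(\<lambda>\<zeta>. (indicator \<Omega> \<zeta> *\<^sub>R a \<zeta>) * b \<zeta>) \<in> borel_measurable lebesgue"
      using a(1) unfolding set_borel_measurable_def by (rule borel_measurable_times[rotated])
    then show ?thesis by simp
  qed
  show ?thesis
    unfolding set_integrable_def
  proof (rule Bochner_Integration.integrable_bound[OF int[unfolded set_integrable_def] meas], rule AE_I2)
    fix \<zeta> :: "complex ^ 'm"
    have w: "0 < weight t \<zeta>" by (rule weight_pos)
    define x y where "x = cmod (a \<zeta>) * sqrt (weight t \<zeta>)" and "y = cmod (b \<zeta>) / sqrt (weight t \<zeta>)"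
    have "x * y = cmod (a \<zeta>) * cmod (b \<zeta>)" using w by (simp add: x_def y_def)
    moreover have "x\<^sup>2 = (cmod (a \<zeta>))\<^sup>2 * weight t \<zeta>" "y\<^sup>2 = (cmod (b \<zeta>))\<^sup>2 / weight t \<zeta>"
      using w by (simp_all add: x_def y_def power_mult_distrib power_divide)
    moreover have "x * y \<le> x\<^sup>2 + y\<^sup>2"
      using sum_squares_bound[of x y] zero_le_power2[of x] zero_le_power2[of y] by linarith
    ultimately show "norm (indicator \<Omega> \<zeta> *\<^sub>R (a \<zeta> * b \<zeta>))
        \<le> norm (indicator \<Omega> \<zeta> *\<^sub>R ((cmod (a \<zeta>))\<^sup>2 * weight t \<zeta> + (cmod (b \<zeta>))\<^sup>2 / weight t \<zeta>))"
      by (auto simp: indicator_def norm_mult)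
  qed
qed

text \<open>At height \<open>y = - siegel_r \<zeta>\<close> above \<open>\<epsilon>\<close> the
  value is \<open>exp (- (\<epsilon> / (y - \<epsilon>)))\<close>. It never reaches 1, but tends to
  1 at each point of the domain as \<open>\<epsilon>\<close> tends to 0, and dominated convergence
  asks for no more.\<close>

definition cutoff :: "real \<Rightarrow> complex ^ ('n::finite option) \<Rightarrow> real" where
  "cutoff \<epsilon> \<zeta> = bump 0 ((- siegel_r \<zeta> - \<epsilon>) / \<epsilon>)"

lemma smooth_cutoff: "smooth (cutoff \<epsilon> :: complex ^ ('n::finite option) \<Rightarrow> real)"
proof -
  have "smooth (\<lambda>\<zeta> :: complex ^ ('n option). (- siegel_r \<zeta> - \<epsilon>) / \<epsilon>)"
    by (rule smooth_linear_compose[OF bounded_linear_divide]) (intro smooth_intros smooth_siegel_r)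
  from smooth_compose_real[OF smooth_bump this] show ?thesis
    unfolding cutoff_def[abs_def] .
qed

lemma cutoff_bounds: "0 \<le> cutoff \<epsilon> \<zeta>" "cutoff \<epsilon> \<zeta> \<le> 1"
  by (simp_all add: cutoff_def bump_nonneg bump_0_le_1)

lemma cutoff_eq_0: "0 < \<epsilon> \<Longrightarrow> - siegel_r \<zeta> \<le> \<epsilon> \<Longrightarrow> cutoff \<epsilon> \<zeta> = 0"
  by (simp add: cutoff_def bump_def zero_less_divide_iff)

lemma cutoff_tendsto:
  assumes "\<zeta> \<in> siegel"
  shows "(\<lambda>n. cutoff (1 / real (Suc n)) \<zeta>) \<longlonglongrightarrow> 1"
proof -
  define y where "y = - siegel_r \<zeta>"
  have y: "y > 0" using assms by (simp add: y_def siegel_eq)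
  have e: "(\<lambda>n. 1 / real (Suc n)) \<longlonglongrightarrow> 0" by (rule LIMSEQ_Suc[OF lim_1_over_n])
  have "(\<lambda>n. exp (- ((1 / real (Suc n)) / (y - 1 / real (Suc n))))) \<longlonglongrightarrow> exp (- (0 / (y - 0)))"
    using y by (intro tendsto_intros e) auto
  then have lim: "(\<lambda>n. exp (- ((1 / real (Suc n)) / (y - 1 / real (Suc n))))) \<longlonglongrightarrow> 1" by simp
  show ?thesis
  proof (rule Lim_transform_eventually[OF lim])
    show "\<forall>\<^sub>F n in sequentially. exp (- ((1 / real (Suc n)) / (y - 1 / real (Suc n)))) = cutoff (1 / real (Suc n)) \<zeta>"
      using order_tendstoD(2)[OF e y]
    proof eventually_elim
      case (elim n)
      then show ?case by (simp add: cutoff_def bump_def y_def[symmetric] del: of_nat_Suc)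
    qed
  qed
qed

text \<open>The point is that \<open>c\<close> does not depend on \<open>k\<close>: the derivative
  of the cut-off is then a multiple of the normal covector, which pairs to 0 with a tangential
  form.\<close>

lemma d_zetabar_cutoff:
  "\<exists>c. \<forall>k. d_zetabar k (\<lambda>\<zeta>. complex_of_real (cutoff \<epsilon> \<zeta>)) \<zeta>
     = of_real c * cnj (d_zeta k (\<lambda>\<zeta>. of_real (siegel_r \<zeta>)) \<zeta>)"
proof -
  have "\<exists>c. ((\<lambda>r. bump 0 ((- r - \<epsilon>) / \<epsilon>)) has_real_derivative c) (at (siegel_r \<zeta>))"
    by (rule exI, rule DERIV_chain2[OF DERIV_bump],
        rule DERIV_cdivide[OF DERIV_diff[OF DERIV_minus[OF DERIV_ident] DERIV_const]])
  then obtain c where c: "((\<lambda>r. bump 0 ((- r - \<epsilon>) / \<epsilon>)) has_real_derivative c) (at (siegel_r \<zeta>))" ..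
  have "d_zetabar k (\<lambda>\<zeta>. of_real (siegel_r \<zeta>)) \<zeta> = cnj (d_zeta k (\<lambda>\<zeta>. of_real (siegel_r \<zeta>)) \<zeta>)" for k
    unfolding d_zeta_real[OF smooth_differentiable[OF smooth_siegel_r]] by simp
  with d_zeta_compose_real(2)[OF smooth_siegel_r c] show ?thesis
    unfolding cutoff_def by metis
qed

text \<open>A form tangential to all level sets of \<open>r\<close> can be cut off near the boundary by a function of \<open>r\<close>
  without creating an error term, so the weak definition of \<open>\<partial>bar\<close> applies.\<close>

lemma has_dbar_adjoint_tangential:
  fixes f :: "('n::{finite,linorder} option) form"
  assumes f: "\<And>J. smooth (f J)" "\<And>J. compact_support (f J)"
    and tang: "\<And>K \<zeta>. card K = q \<Longrightarrow>
      (\<Sum>k\<in>- K. wedge_sign k (insert k K) * d_zeta k (\<lambda>\<zeta>. of_real (siegel_r \<zeta>)) \<zeta> * f (insert k K) \<zeta>) = 0"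
  shows "has_dbar_adjoint siegel t q f (theta_smooth t f)"
  unfolding has_dbar_adjoint_def
proof (intro conjI allI impI)
  let ?S = "siegel :: (complex ^ ('n option)) set"
  let ?W = "\<lambda>\<zeta>. complex_of_real (weight t \<zeta>)"
  have S: "?S \<in> sets borel" by (rule borel_open[OF open_siegel])
  have u: "smooth (theta_smooth t f K)" "compact_support (theta_smooth t f K)" for K
  proof -
    show "smooth (theta_smooth t f K)"
      unfolding theta_smooth_def[abs_def] by (intro smooth_intros smooth_d_zeta f)
    have "compact_support (\<lambda>\<zeta>. \<Sum>k\<in>- K. wedge_sign k (insert k K) *
        (d_zeta k (f (insert k K)) \<zeta> + (- of_real t * cnj (\<zeta> $ k)) * f (insert k K) \<zeta>))"
      by (intro compact_support_sum compact_support_mult(2) compact_support_add compact_support_d_zeta f)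
    then show "compact_support (theta_smooth t f K)"
      by (rule compact_support_compose) (simp add: theta_smooth_def)
  qed
  show "L2_form ?S t (Suc q) f" "L2_form ?S t q (theta_smooth t f)"
    by (rule L2_form_smooth; rule f u S)+
  fix v g assume vg: "has_dbar ?S t q v g"
  have L2: "L2_form ?S t q v" "L2_form ?S t (Suc q) g"
    using vg by (simp_all add: has_dbar_def)
  have int_g: "set_integrable lebesgue ?S (\<lambda>\<zeta>. g J \<zeta> * b \<zeta>)"
    if "card J = Suc q" "continuous_on UNIV b" "compact_support b" for J b
    using L2(2) that S unfolding L2_form_def by (intro set_integrable_L2_mult[where t = t]) auto
  have int_v: "set_integrable lebesgue ?S (\<lambda>\<zeta>. v K \<zeta> * b \<zeta>)"
    if "card K = q" "continuous_on UNIV b" "compact_support b" for K b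
    using L2(1) that S unfolding L2_form_def by (intro set_integrable_L2_mult[where t = t]) auto
  have cf: "continuous_on UNIV (\<lambda>\<zeta>. cnj (f J \<zeta>) * ?W \<zeta>)" "compact_support (\<lambda>\<zeta>. cnj (f J \<zeta>) * ?W \<zeta>)" for J
    by (intro smooth_continuous_on smooth_intros smooth_weight f)
      (rule compact_support_compose[OF f(2)[of J]], simp)
  have cu: "continuous_on UNIV (\<lambda>\<zeta>. cnj (theta_smooth t f J \<zeta>) * ?W \<zeta>)"
    "compact_support (\<lambda>\<zeta>. cnj (theta_smooth t f J \<zeta>) * ?W \<zeta>)" for J
    by (intro smooth_continuous_on smooth_intros smooth_weight u)
      (rule compact_support_compose[OF u(2)[of J]], simp)
  define A where "A \<zeta> = (\<Sum>J | card J = Suc q. g J \<zeta> * cnj (f J \<zeta>)) * ?W \<zeta>" for \<zeta>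
  define B where "B \<zeta> = (\<Sum>K | card K = q. v K \<zeta> * cnj (theta_smooth t f K \<zeta>)) * ?W \<zeta>" for \<zeta>
  have A: "A = (\<lambda>\<zeta>. \<Sum>J | card J = Suc q. g J \<zeta> * (cnj (f J \<zeta>) * ?W \<zeta>))"
    by (simp add: A_def[abs_def] sum_distrib_right mult.assoc)
  have B: "B = (\<lambda>\<zeta>. \<Sum>K | card K = q. v K \<zeta> * (cnj (theta_smooth t f K \<zeta>) * ?W \<zeta>))"
    by (simp add: B_def[abs_def] sum_distrib_right mult.assoc)
  have intA: "set_integrable lebesgue ?S A" and intB: "set_integrable lebesgue ?S B"
    unfolding A B by (intro set_integrable_sum int_g int_v cf cu; simp)+
  have lim: "(\<lambda>n. LINT \<zeta>:?S|lebesgue. of_real (cutoff (1 / real (Suc n)) \<zeta>) * F \<zeta>) \<longlonglongrightarrow> (LINT \<zeta>:?S|lebesgue. F \<zeta>)"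
    if F: "set_integrable lebesgue ?S F" for F :: "complex ^ ('n option) \<Rightarrow> complex"
    unfolding set_lebesgue_integral_def
  proof (rule integral_dominated_convergence)
    have mF: "(\<lambda>\<zeta>. indicator ?S \<zeta> *\<^sub>R F \<zeta>) \<in> borel_measurable lebesgue"
      using F unfolding set_integrable_def by (rule borel_measurable_integrable)
    show "(\<lambda>\<zeta>. indicator ?S \<zeta> *\<^sub>R F \<zeta>) \<in> borel_measurable lebesgue" by (rule mF)
    show "integrable lebesgue (\<lambda>\<zeta>. norm (indicator ?S \<zeta> *\<^sub>R F \<zeta>))"
      using F unfolding set_integrable_def by (rule integrable_norm)
    fix n
    have "(\<lambda>\<zeta>. complex_of_real (cutoff (1 / real (Suc n)) \<zeta>)) \<in> borel_measurable lebesgue"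
      by (intro measurable_completion)
        (auto intro!: borel_measurable_continuous_onI smooth_continuous_on smooth_of_real smooth_cutoff)
    then have "(\<lambda>\<zeta>. complex_of_real (cutoff (1 / real (Suc n)) \<zeta>) * (indicator ?S \<zeta> *\<^sub>R F \<zeta>)) \<in> borel_measurable lebesgue"
      using mF by (rule borel_measurable_times)
    then show "(\<lambda>\<zeta>. indicator ?S \<zeta> *\<^sub>R (complex_of_real (cutoff (1 / real (Suc n)) \<zeta>) * F \<zeta>)) \<in> borel_measurable lebesgue"
      by simp
    show "AE \<zeta> in lebesgue. norm (indicator ?S \<zeta> *\<^sub>R (complex_of_real (cutoff (1 / real (Suc n)) \<zeta>) * F \<zeta>))
        \<le> norm (indicator ?S \<zeta> *\<^sub>R F \<zeta>)"
      by (intro AE_I2) (auto simp: norm_mult indicator_def cutoff_bounds intro!: mult_left_le_one_le)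
  next
    show "AE \<zeta> in lebesgue. (\<lambda>n. indicator ?S \<zeta> *\<^sub>R (complex_of_real (cutoff (1 / real (Suc n)) \<zeta>) * F \<zeta>))
        \<longlonglongrightarrow> indicator ?S \<zeta> *\<^sub>R F \<zeta>"
    proof (intro AE_I2)
      fix \<zeta> :: "complex ^ ('n option)"
      show "(\<lambda>n. indicator ?S \<zeta> *\<^sub>R (complex_of_real (cutoff (1 / real (Suc n)) \<zeta>) * F \<zeta>))
        \<longlonglongrightarrow> indicator ?S \<zeta> *\<^sub>R F \<zeta>"
      proof (cases "\<zeta> \<in> ?S")
        case True
        have "(\<lambda>n. complex_of_real (cutoff (1 / real (Suc n)) \<zeta>) * F \<zeta>) \<longlonglongrightarrow> of_real 1 * F \<zeta>"
          by (intro tendsto_mult tendsto_of_real cutoff_tendsto[OF True] tendsto_const)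
        with True show ?thesis by simp
      qed simp
    qed
  qed
  have eq: "(LINT \<zeta>:?S|lebesgue. of_real (cutoff \<epsilon> \<zeta>) * A \<zeta>) = (LINT \<zeta>:?S|lebesgue. of_real (cutoff \<epsilon> \<zeta>) * B \<zeta>)"
    if \<epsilon>: "\<epsilon> > 0" for \<epsilon>
  proof -
    \<comment> \<open>Conjugate and weight go into the test function, so that pairing it with
      \<open>g\<close> yields the cut-off integrand of the weighted inner product of
      \<open>g\<close> and \<open>f\<close>.\<close>
    define \<phi> where "\<phi> J \<zeta> = complex_of_real (cutoff \<epsilon> \<zeta>) * (cnj (f J \<zeta>) * ?W \<zeta>)" for J \<zeta>
    have sm\<phi>: "smooth (\<phi> J)" for J
      unfolding \<phi>_def by (intro smooth_intros smooth_cutoff smooth_weight f)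
    have cs\<phi>: "compact_support (\<phi> J)" for J
      unfolding \<phi>_def by (intro compact_support_mult(2) cf)
    have test: "test_function ?S (\<phi> J)" for J
    proof -
      obtain K where K: "compact K" "\<And>x. x \<notin> K \<Longrightarrow> f J x = 0"
        using f(2)[of J] unfolding compact_support_def by blast
      have "closed (siegel_r -` {..- \<epsilon>} :: (complex ^ ('n option)) set)"
        by (rule closed_vimage[OF closed_atMost continuous_on_siegel_r])
      then have "compact (K \<inter> siegel_r -` {..- \<epsilon>})" by (rule compact_Int_closed[OF K(1)])
      moreover have "K \<inter> siegel_r -` {..- \<epsilon>} \<subseteq> ?S" using \<epsilon> by (auto simp: siegel_eq)
      moreover have "\<phi> J x = 0" if "x \<notin> K \<inter> siegel_r -` {..- \<epsilon>}" for x
        using that K(2)[of x] cutoff_eq_0[OF \<epsilon>, of x] by (auto simp: \<phi>_def)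
      ultimately show ?thesis
        using sm\<phi>[of J] unfolding test_function_def smooth_def by blast
    qed
    have d\<phi>: "(\<Sum>k\<in>- K. wedge_sign k (insert k K) * d_zetabar k (\<phi> (insert k K)) \<zeta>)
        = - (of_real (cutoff \<epsilon> \<zeta>) * (cnj (theta_smooth t f K \<zeta>) * ?W \<zeta>))" if K: "card K = q" for K \<zeta>
    proof -
      obtain c where c: "\<And>k. d_zetabar k (\<lambda>\<zeta>. complex_of_real (cutoff \<epsilon> \<zeta>)) \<zeta>
          = of_real c * cnj (d_zeta k (\<lambda>\<zeta>. of_real (siegel_r \<zeta>)) \<zeta>)"
        using d_zetabar_cutoff by metis
      \<comment> \<open>The first term comes from the cut-off and disappears by \<open>tang\<close>
        after summation over \<open>k\<close>; the second sums to the conjugate of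
        \<open>theta_smooth\<close>, up to sign.\<close>
      have dk: "d_zetabar k (\<phi> J) \<zeta> = of_real c * ?W \<zeta> * cnj (d_zeta k (\<lambda>\<zeta>. of_real (siegel_r \<zeta>)) \<zeta> * f J \<zeta>)
          + of_real (cutoff \<epsilon> \<zeta>) * ?W \<zeta> * cnj (d_zeta k (f J) \<zeta> - of_real t * cnj (\<zeta> $ k) * f J \<zeta>)" for k J
        unfolding \<phi>_def
        by (subst d_zeta_mult(2), intro smooth_intros smooth_cutoff, intro smooth_intros smooth_weight f,
            subst d_zeta_mult(2), intro smooth_intros f, rule smooth_weight)
          (simp add: c d_zeta_cnj f d_zetabar_weight algebra_simps)
      have "(\<Sum>k\<in>- K. wedge_sign k (insert k K) * d_zetabar k (\<phi> (insert k K)) \<zeta>)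
        = of_real c * ?W \<zeta> * cnj (\<Sum>k\<in>- K. wedge_sign k (insert k K) * d_zeta k (\<lambda>\<zeta>. of_real (siegel_r \<zeta>)) \<zeta> * f (insert k K) \<zeta>)
          + of_real (cutoff \<epsilon> \<zeta>) * ?W \<zeta> * cnj (\<Sum>k\<in>- K. wedge_sign k (insert k K) *
              (d_zeta k (f (insert k K)) \<zeta> - of_real t * cnj (\<zeta> $ k) * f (insert k K) \<zeta>))"
        unfolding dk cnj_sum sum_distrib_left sum.distrib[symmetric]
        by (intro sum.cong refl) (simp add: algebra_simps)
      also have "\<dots> = - (of_real (cutoff \<epsilon> \<zeta>) * (cnj (theta_smooth t f K \<zeta>) * ?W \<zeta>))"
        unfolding tang[OF K] theta_smooth_def by simp
      finally show ?thesis .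
    qed
    have intv: "set_integrable lebesgue ?S (\<lambda>\<zeta>. \<Sum>k\<in>J. wedge_sign k J * v (J - {k}) \<zeta> * d_zetabar k (\<phi> J) \<zeta>)"
      if "card J = Suc q" for J
    proof -
      have "set_integrable lebesgue ?S (\<lambda>\<zeta>. \<Sum>k\<in>J. v (J - {k}) \<zeta> * (wedge_sign k J * d_zetabar k (\<phi> J) \<zeta>))"
        using that by (intro set_integrable_sum int_v smooth_continuous_on smooth_intros smooth_d_zeta sm\<phi>
            compact_support_mult(2) compact_support_d_zeta cs\<phi>) auto
      then show ?thesis by (simp add: mult_ac)
    qed
    have "(LINT \<zeta>:?S|lebesgue. of_real (cutoff \<epsilon> \<zeta>) * A \<zeta>)
        = (LINT \<zeta>:?S|lebesgue. \<Sum>J | card J = Suc q. g J \<zeta> * \<phi> J \<zeta>)"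
      unfolding A by (simp add: \<phi>_def sum_distrib_left mult_ac)
    also have "\<dots> = (\<Sum>J | card J = Suc q. LINT \<zeta>:?S|lebesgue. g J \<zeta> * \<phi> J \<zeta>)"
      by (rule set_integral_sum) (auto intro!: int_g smooth_continuous_on sm\<phi> cs\<phi>)
    also have "\<dots> = (\<Sum>J | card J = Suc q. - (LINT \<zeta>:?S|lebesgue. \<Sum>k\<in>J. wedge_sign k J * v (J - {k}) \<zeta> * d_zetabar k (\<phi> J) \<zeta>))"
      using vg test unfolding has_dbar_def by (intro sum.cong refl) auto
    also have "\<dots> = - (LINT \<zeta>:?S|lebesgue. \<Sum>J | card J = Suc q. \<Sum>k\<in>J. wedge_sign k J * v (J - {k}) \<zeta> * d_zetabar k (\<phi> J) \<zeta>)"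
      unfolding sum_negf by (subst set_integral_sum) (auto intro!: intv)
    also have "\<dots> = - (LINT \<zeta>:?S|lebesgue. \<Sum>K | card K = q. v K \<zeta> * (\<Sum>k\<in>- K. wedge_sign k (insert k K) * d_zetabar k (\<phi> (insert k K)) \<zeta>))"
      unfolding sum_insert_reindex[where F = "\<lambda>k J K. wedge_sign k J * v K _ * d_zetabar k (\<phi> J) _"]
      by (simp add: sum_distrib_left mult_ac)
    also have "\<dots> = (LINT \<zeta>:?S|lebesgue. of_real (cutoff \<epsilon> \<zeta>) * B \<zeta>)"
    proof -
      have "(\<Sum>K | card K = q. v K \<zeta> * (\<Sum>k\<in>- K. wedge_sign k (insert k K) * d_zetabar k (\<phi> (insert k K)) \<zeta>))
          = - (of_real (cutoff \<epsilon> \<zeta>) * B \<zeta>)" for \<zeta>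
        unfolding B by (simp add: d\<phi> sum_distrib_left sum_negf mult_ac)
      then show ?thesis by (simp add: set_integral_uminus set_lebesgue_integral_def)
    qed
    finally show ?thesis .
  qed
  have "(\<lambda>n. LINT \<zeta>:?S|lebesgue. of_real (cutoff (1 / real (Suc n)) \<zeta>) * B \<zeta>) \<longlonglongrightarrow> (LINT \<zeta>:?S|lebesgue. A \<zeta>)"
    using lim[OF intA] by (simp add: eq)
  then have "(LINT \<zeta>:?S|lebesgue. A \<zeta>) = (LINT \<zeta>:?S|lebesgue. B \<zeta>)"
    using lim[OF intB] by (rule LIMSEQ_unique)
  then show "L2_inner ?S t (Suc q) g f = L2_inner ?S t q v (theta_smooth t f)"
    by (simp add: L2_inner_def A_def B_def)
qed

section \<open>Boundary values\<close>

abbreviation siegel_graph :: "(complex ^ 'n::finite) \<times> real \<Rightarrow> complex ^ ('n option)" where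
  "siegel_graph \<equiv> graph_point (\<lambda>(z, x). (norm z)\<^sup>2)"

lemma siegel_graph_eq: "siegel_graph p = siegel_chart (p, 0)"
  by (simp add: siegel_chart_def)

lemma zpart_siegel_chart [simp]: "zpart (siegel_chart (p, y)) = fst p"
  by (simp add: vec_eq_iff siegel_chart_nth)

lemma siegel_r_chart [simp]: "siegel_r (siegel_chart (p, y)) = - y"
  by (simp add: siegel_r_def siegel_chart_nth)

lemma siegel_s_chart: "siegel_s (siegel_chart (p, y)) = sqrt (1 + 4 * (norm (fst p))\<^sup>2)"
  by (simp add: siegel_s_def)

lemma siegel_graph_frontier: "siegel_graph p \<in> frontier siegel"
  by (simp add: frontier_siegel siegel_graph_eq)

lemma continuous_on_siegel_graph: "continuous_on S siegel_graph"
  unfolding siegel_graph_eq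
  by (rule continuous_on_compose2[OF continuous_on_siegel_chart[of UNIV]]) (auto intro!: continuous_intros)

lemma continuous_on_siegel_s: "continuous_on S siegel_s"
  unfolding siegel_s_def[abs_def]
  by (intro continuous_intros smooth_continuous_on smooth_zpart)

text \<open>The area factor of the graph is the norm of the gradient of \<open>siegel_r\<close>. The
  same factor weights the layers in \<open>has_boundary_values\<close>, so the two sides of the
  limit there agree.\<close>

lemma siegel_density: "sqrt (1 + (norm (grad (\<lambda>(z, x). (norm z)\<^sup>2) p))\<^sup>2) = siegel_s (siegel_graph p)"
  for p :: "(complex ^ 'n::finite) \<times> real"
proof -
  have "grad (\<lambda>(z, x). (norm z)\<^sup>2) p = (2 *\<^sub>R fst p, 0)"
  proof (rule grad_eqI)
    have "((\<lambda>p :: (complex ^ 'n) \<times> real. fst p \<bullet> fst p) has_derivative (\<lambda>h. fst p \<bullet> fst h + fst h \<bullet> fst p)) (at p)"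
      by (intro has_derivative_inner has_derivative_fst has_derivative_ident)
    then show "((\<lambda>(z, x). (norm z)\<^sup>2) has_derivative (\<lambda>h. (2 *\<^sub>R fst p, 0) \<bullet> h)) (at p)"
      by (simp add: case_prod_unfold power2_norm_eq_inner inner_prod_def inner_commute)
  qed
  then show ?thesis
    by (simp add: siegel_s_def siegel_graph_eq norm_Pair power_mult_distrib)
qed

lemma siegel_surface_measure_eq:
  "siegel_surface_measure = distr (density lborel (\<lambda>p. ennreal (siegel_s (siegel_graph p)))) borel siegel_graph"
  unfolding siegel_surface_measure_def graph_surface_measure_def siegel_density ..

lemma measurable_siegel_graph [measurable]: "siegel_graph \<in> borel_measurable borel"
  by (rule borel_measurable_continuous_onI[OF continuous_on_siegel_graph])

lemma measurable_siegel_s [measurable]: "siegel_s \<in> borel_measurable borel"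
  by (rule borel_measurable_continuous_onI[OF continuous_on_siegel_s])

lemma measurable_siegel_chart [measurable]: "siegel_chart \<in> borel_measurable borel"
  by (rule borel_measurable_continuous_onI[OF continuous_on_siegel_chart])

lemma frontier_siegel_borel [measurable]: "frontier siegel \<in> sets borel"
  by simp

text \<open>The support is projected to the coordinates \<open>(z, Re w)\<close>. One compact set
  then works at all heights, as a majorant independent of the layer requires.\<close>

lemma compact_support_chart:
  fixes F :: "complex ^ ('n::finite option) \<Rightarrow> 'b::zero"
  assumes "compact_support F"
  obtains K :: "((complex ^ 'n) \<times> real) set" where "compact K" "\<And>p y. p \<notin> K \<Longrightarrow> F (siegel_chart (p, y)) = 0"
proof -
  obtain L where L: "compact L" "\<And>x. x \<notin> L \<Longrightarrow> F x = 0"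
    using assms unfolding compact_support_def by blast
  define \<pi> where "\<pi> = (\<lambda>\<zeta> :: complex ^ ('n option). (zpart \<zeta>, Re (\<zeta> $ None)))"
  have "continuous_on L \<pi>"
    unfolding \<pi>_def by (intro continuous_intros smooth_continuous_on smooth_zpart)
  then have "compact (\<pi> ` L)" using L(1) by (rule compact_continuous_image)
  moreover have "F (siegel_chart (p, y)) = 0" if "p \<notin> \<pi> ` L" for p y
  proof (rule L(2))
    have "\<pi> (siegel_chart (p, y)) = p" by (simp add: \<pi>_def siegel_chart_nth)
    then show "siegel_chart (p, y) \<notin> L" using that by (metis image_eqI)
  qed
  ultimately show ?thesis using that by blast
qed

lemma siegel_surface_integral:
  fixes F :: "complex ^ ('n::finite option) \<Rightarrow> complex"
  assumes F: "continuous_on UNIV F" "compact_support F"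
  shows "set_integrable siegel_surface_measure (frontier siegel) F"
    and "(LINT \<zeta>:frontier siegel|siegel_surface_measure. F \<zeta>)
      = (LINT p|lborel. siegel_s (siegel_graph p) *\<^sub>R F (siegel_graph p))"
proof -
  have [measurable]: "F \<in> borel_measurable borel"
    by (rule borel_measurable_continuous_onI[OF F(1)])
  obtain K :: "((complex ^ 'n) \<times> real) set" where K: "compact K" "\<And>p y. p \<notin> K \<Longrightarrow> F (siegel_chart (p, y)) = 0"
    using compact_support_chart[OF F(2)] by metis
  have s: "0 \<le> siegel_s \<zeta>" for \<zeta> :: "complex ^ ('n option)" using siegel_s_pos[of \<zeta>] by linarith
  have "compact_support (\<lambda>p. siegel_s (siegel_graph p) *\<^sub>R F (siegel_graph p))"
    unfolding compact_support_def siegel_graph_eq using K by (intro exI[of _ K]) auto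
  moreover have "continuous_on UNIV (\<lambda>p. siegel_s (siegel_graph p) *\<^sub>R F (siegel_graph p))"
    by (intro continuous_intros continuous_on_compose2[OF continuous_on_siegel_s[of UNIV]]
        continuous_on_compose2[OF F(1)] continuous_on_siegel_graph) auto
  ultimately have int: "integrable lborel (\<lambda>p. siegel_s (siegel_graph p) *\<^sub>R F (siegel_graph p))"
    by (intro integrable_compact_support)
  show "set_integrable siegel_surface_measure (frontier siegel) F"
    unfolding set_integrable_def siegel_surface_measure_eq
    using int s by (simp add: integrable_distr_eq integrable_density siegel_graph_frontier)
  show "(LINT \<zeta>:frontier siegel|siegel_surface_measure. F \<zeta>)
      = (LINT p|lborel. siegel_s (siegel_graph p) *\<^sub>R F (siegel_graph p))"
    unfolding set_lebesgue_integral_def siegel_surface_measure_eq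
    using s by (simp add: integral_distr integral_density siegel_graph_frontier)
qed

text \<open>In the chart the layer is \<open>0 < y < \<epsilon>\<close>. Rescaling \<open>y\<close>
  makes the average an integral over \<open>0 < y < 1\<close> of \<open>F\<close> at height
  \<open>\<epsilon> * y\<close>, to which dominated convergence applies.\<close>

lemma layer_average_tendsto:
  fixes F :: "complex ^ ('n::finite option) \<Rightarrow> complex"
  assumes F: "continuous_on UNIV F" "compact_support F"
  shows "((\<lambda>\<epsilon>. (LINT \<zeta>:{\<zeta> \<in> siegel. - \<epsilon> < siegel_r \<zeta>}|lebesgue. F \<zeta>) / of_real \<epsilon>)
    \<longlongrightarrow> (LINT p|lborel. F (siegel_graph p))) (at_right 0)"
proof -
  have [measurable]: "F \<in> borel_measurable borel"
    by (rule borel_measurable_continuous_onI[OF F(1)])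
  have [measurable]: "siegel_r \<in> borel_measurable borel"
    by (rule borel_measurable_continuous_onI[OF continuous_on_siegel_r])
  obtain K :: "((complex ^ 'n) \<times> real) set" where K: "compact K" "\<And>p y. p \<notin> K \<Longrightarrow> F (siegel_chart (p, y)) = 0"
    using compact_support_chart[OF F(2)] by metis
  obtain L where L: "compact L" "\<And>x. x \<notin> L \<Longrightarrow> F x = 0"
    using F(2) unfolding compact_support_def by blast
  have "bounded (F ` L)"
    by (intro compact_imp_bounded compact_continuous_image L(1) continuous_on_subset[OF F(1)]) simp
  then obtain B0 where B0: "\<And>x. x \<in> L \<Longrightarrow> norm (F x) \<le> B0"
    unfolding bounded_iff by blast
  define B where "B = \<bar>B0\<bar>"
  have B_nonneg: "0 \<le> B" by (simp add: B_def)
  have B: "norm (F x) \<le> B" for x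
    using B0[of x] L(2)[of x] by (cases "x \<in> L") (auto simp: B_def)
  define \<Phi> where "\<Phi> \<epsilon> v = indicator {0<..<1} (snd v) *\<^sub>R F (siegel_chart (fst v, \<epsilon> * snd v))"
    for \<epsilon> and v :: "((complex ^ 'n) \<times> real) \<times> real"
  have m: "\<Phi> \<epsilon> \<in> borel_measurable lborel" for \<epsilon>
  proof -
    have "(\<lambda>v :: ((complex ^ 'n) \<times> real) \<times> real. F (siegel_chart (fst v, \<epsilon> * snd v))) \<in> borel_measurable borel"
      by (intro borel_measurable_continuous_onI continuous_on_compose2[OF F(1)]
          continuous_on_compose2[OF continuous_on_siegel_chart[of UNIV]] continuous_intros) auto
    moreover have "(\<lambda>v :: ((complex ^ 'n) \<times> real) \<times> real. indicator {0<..<1} (snd v) :: real) \<in> borel_measurable borel"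
    proof -
      have "open (UNIV \<times> {0<..<1} :: (((complex ^ 'n) \<times> real) \<times> real) set)" by (intro open_Times) auto
      then have "indicat_real (UNIV \<times> {0<..<1} :: (((complex ^ 'n) \<times> real) \<times> real) set) \<in> borel_measurable (borel :: _ measure)"
        by (intro borel_measurable_indicator borel_open)
      moreover have "indicator (UNIV \<times> {0<..<1}) = (\<lambda>v :: ((complex ^ 'n) \<times> real) \<times> real. indicator {0<..<1} (snd v) :: real)"
        by (auto simp: indicator_def fun_eq_iff)
      ultimately show ?thesis by simp
    qed
    ultimately show ?thesis unfolding \<Phi>_def by simp
  qed
  have rescale: "(LINT \<zeta>:{\<zeta> \<in> siegel. - \<epsilon> < siegel_r \<zeta>}|lebesgue. F \<zeta>) / of_real \<epsilon> = (LINT v|lborel. \<Phi> \<epsilon> v)"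
    if \<epsilon>: "\<epsilon> > 0" for \<epsilon>
  proof -
    define G where "G \<zeta> = indicator {\<zeta> \<in> siegel. - \<epsilon> < siegel_r \<zeta>} \<zeta> *\<^sub>R F \<zeta>" for \<zeta>
    have set: "{\<zeta> \<in> (siegel :: (complex ^ ('n option)) set). - \<epsilon> < siegel_r \<zeta>} \<in> sets borel"
    proof -
      have "open (siegel_r -` {- \<epsilon><..<0} :: (complex ^ ('n option)) set)"
        by (rule open_vimage[OF open_greaterThanLessThan continuous_on_siegel_r])
      moreover have "siegel_r -` {- \<epsilon><..<0} = {\<zeta> \<in> (siegel :: (complex ^ ('n option)) set). - \<epsilon> < siegel_r \<zeta>}"
        by (auto simp: siegel_eq)
      ultimately show ?thesis by (metis borel_open)
    qed
    then have G[measurable]: "G \<in> borel_measurable borel"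
      unfolding G_def by (intro borel_measurable_scaleR borel_measurable_indicator) auto
    have "(LINT \<zeta>:{\<zeta> \<in> siegel. - \<epsilon> < siegel_r \<zeta>}|lebesgue. F \<zeta>) = (LINT \<zeta>|lborel. G \<zeta>)"
      unfolding set_lebesgue_integral_def G_def[symmetric] by (simp add: integral_completion)
    also have "\<dots> = (LINT \<zeta>|distr lborel borel siegel_chart. G \<zeta>)"
      unfolding lborel_distr_siegel_chart ..
    also have "\<dots> = (LINT v|lborel. G (siegel_chart v))"
      by (rule integral_distr) auto
    also have "\<dots> = \<epsilon> *\<^sub>R (LINT v|lborel. G (siegel_chart (fst v, \<epsilon> * snd v)))"
      by (rule lborel_integral_scale_snd[OF _ \<epsilon>]) measurable
    also have "(\<lambda>v. G (siegel_chart (fst v, \<epsilon> * snd v))) = \<Phi> \<epsilon>"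
      using \<epsilon> by (auto simp: G_def \<Phi>_def fun_eq_iff indicator_def siegel_eq zero_less_mult_iff)
    finally show ?thesis using \<epsilon> by (simp add: scaleR_conv_of_real)
  qed
  have limit: "(LINT v|lborel. \<Phi> 0 v) = (LINT p|lborel. F (siegel_graph p))"
  proof -
    have int: "integrable lborel (\<lambda>p. F (siegel_graph p))"
      using K continuous_on_siegel_graph
      by (intro integrable_continuous_compact_support[OF _ K(1)] continuous_on_compose2[OF F(1)])
        (auto simp: siegel_graph_eq)
    have \<Phi>0: "\<Phi> 0 (p, y) = indicator {0<..<1} y *\<^sub>R F (siegel_graph p)" for p y
      by (simp add: \<Phi>_def siegel_graph_eq)
    have I: "integrable (lborel \<Otimes>\<^sub>M lborel) (\<Phi> 0)"
    proof (rule lborel_pair.Fubini_integrable)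
      show "\<Phi> 0 \<in> borel_measurable (lborel \<Otimes>\<^sub>M lborel)"
        using m unfolding lborel_prod .
      show "integrable lborel (\<lambda>p. LINT y|lborel. norm (\<Phi> 0 (p, y)))"
        using integrable_norm[OF int] by (simp add: \<Phi>0)
      show "AE p in lborel. integrable lborel (\<lambda>y. \<Phi> 0 (p, y))"
        by (simp add: \<Phi>0)
    qed
    have "(LINT v|lborel. \<Phi> 0 v) = (LINT p|lborel. LINT y|lborel. \<Phi> 0 (p, y))"
      using lborel_pair.integral_fst'[OF I] by (simp add: lborel_prod)
    also have "\<dots> = (LINT p|lborel. LINT y|(lborel :: real measure). indicator {0<..<1} y *\<^sub>R F (siegel_graph p))"
      by (simp only: \<Phi>0)
    also have "\<dots> = (LINT p|lborel. F (siegel_graph p))"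
      by (intro Bochner_Integration.integral_cong refl) simp
    finally show ?thesis .
  qed
  show ?thesis
  proof (rule tendsto_at_right_sequentially[of 0 1])
    fix S :: "nat \<Rightarrow> real"
    assume S: "\<And>n. 0 < S n" "\<And>n. S n < 1" "S \<longlonglongrightarrow> 0"
    have "(\<lambda>n. LINT v|lborel. \<Phi> (S n) v) \<longlonglongrightarrow> (LINT v|lborel. \<Phi> 0 v)"
    proof (rule integral_dominated_convergence[where w = "\<lambda>v. indicator (K \<times> {0..1::real}) v *\<^sub>R B"])
      show "integrable lborel (\<lambda>v. indicator (K \<times> {0..1::real}) v *\<^sub>R B)"
        by (intro borel_integrable_compact compact_Times K(1)) auto
      show "AE v in lborel. norm (\<Phi> (S n) v) \<le> indicator (K \<times> {0..1::real}) v *\<^sub>R B" for n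
        using B B_nonneg K(2) by (intro AE_I2) (auto simp: \<Phi>_def indicator_def mem_Times_iff)
      show "AE v in lborel. (\<lambda>n. \<Phi> (S n) v) \<longlonglongrightarrow> \<Phi> 0 v"
      proof (intro AE_I2)
        fix v :: "((complex ^ 'n) \<times> real) \<times> real"
        have "continuous_on UNIV (\<lambda>e :: real. F (siegel_chart (fst v, e * snd v)))"
          by (intro continuous_on_compose2[OF F(1)]
              continuous_on_compose2[OF continuous_on_siegel_chart[of UNIV]] continuous_intros) auto
        then have "isCont (\<lambda>e :: real. F (siegel_chart (fst v, e * snd v))) 0"
          by (simp add: continuous_on_eq_continuous_at)
        from isCont_tendsto_compose[OF this S(3)]
        show "(\<lambda>n. \<Phi> (S n) v) \<longlonglongrightarrow> \<Phi> 0 v"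
          unfolding \<Phi>_def by (intro tendsto_scaleR tendsto_const)
      qed
    qed (rule m)+
    then show "(\<lambda>n. (LINT \<zeta>:{\<zeta> \<in> siegel. - S n < siegel_r \<zeta>}|lebesgue. F \<zeta>) / of_real (S n)) \<longlonglongrightarrow> (LINT p|lborel. F (siegel_graph p))"
      by (simp add: rescale S limit)
  qed simp
qed

lemma has_boundary_values_continuous:
  fixes f :: "('n::finite option) form"
  assumes f: "\<And>J. continuous_on UNIV (f J)"
  shows "has_boundary_values siegel siegel_surface_measure q f f"
  unfolding has_boundary_values_def
proof (rule exI[of _ siegel_r], rule exI[of _ UNIV], intro conjI allI impI)
  show "Ck_defining_function m siegel_r UNIV (siegel :: (complex ^ ('n option)) set)" for m
    by (rule Ck_defining_function_siegel_r)
  fix J :: "'n option set"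
  have "sets (siegel_surface_measure :: (complex ^ ('n option)) measure) = sets borel"
    by (simp add: siegel_surface_measure_eq)
  then show "set_borel_measurable siegel_surface_measure (frontier siegel) (f J)"
    unfolding set_borel_measurable_def using borel_measurable_continuous_onI[OF f[of J]]
    by (subst measurable_cong_sets[of _ borel _ borel]) (auto intro!: borel_measurable_scaleR borel_measurable_indicator)
  fix \<psi> :: "complex ^ ('n option) \<Rightarrow> complex" assume "test_function UNIV \<psi>"
  then have \<psi>: "continuous_on UNIV \<psi>" "compact_support \<psi>"
    using test_function_props smooth_continuous_on by blast+
  have G: "continuous_on UNIV (\<lambda>\<zeta>. f J \<zeta> * \<psi> \<zeta>)" "compact_support (\<lambda>\<zeta>. f J \<zeta> * \<psi> \<zeta>)"
    by (intro continuous_intros f \<psi> compact_support_mult(2))+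
  show "set_integrable siegel_surface_measure (frontier siegel) (\<lambda>p. f J p * \<psi> p)"
    by (rule siegel_surface_integral(1)[OF G])
  have "continuous_on UNIV (\<lambda>\<zeta>. f J \<zeta> * \<psi> \<zeta> * complex_of_real (siegel_s \<zeta>))"
    by (intro continuous_intros f \<psi> continuous_on_siegel_s)
  moreover have "compact_support (\<lambda>\<zeta>. f J \<zeta> * \<psi> \<zeta> * complex_of_real (siegel_s \<zeta>))"
    by (intro compact_support_mult(1) G)
  ultimately have "((\<lambda>\<epsilon>. (LINT \<zeta>:{\<zeta> \<in> siegel. - \<epsilon> < siegel_r \<zeta>}|lebesgue. f J \<zeta> * \<psi> \<zeta> * complex_of_real (siegel_s \<zeta>)) / of_real \<epsilon>)
    \<longlongrightarrow> (LINT p|lborel. f J (siegel_graph p) * \<psi> (siegel_graph p) * complex_of_real (siegel_s (siegel_graph p)))) (at_right 0)"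
    by (rule layer_average_tendsto)
  then show "((\<lambda>\<epsilon>. (LINT \<zeta>:{\<zeta> \<in> siegel \<inter> UNIV. - \<epsilon> < siegel_r \<zeta>}|lebesgue.
      f J \<zeta> * \<psi> \<zeta> * of_real (norm (grad siegel_r \<zeta>))) / of_real \<epsilon>)
    \<longlongrightarrow> (LINT p:frontier siegel|siegel_surface_measure. f J p * \<psi> p)) (at_right 0)"
    unfolding siegel_surface_integral(2)[OF G] by (simp add: norm_grad_siegel_r scaleR_conv_of_real mult_ac)
qed

section \<open>Peak forms\<close>

text \<open>For \<open>k < l\<close>, removing \<open>l\<close> leaves the position of
  \<open>k\<close> unchanged, while removing \<open>k\<close> lowers the position of
  \<open>l\<close> by one.\<close>

lemma wedge_sign_antisym:
  fixes P :: "'m::{finite,linorder} set"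
  assumes "k \<in> P" "l \<in> P" "k \<noteq> l"
  shows "wedge_sign k (P - {l}) * wedge_sign l P = - (wedge_sign l (P - {k}) * wedge_sign k P)"
proof -
  have *: "wedge_sign k (P - {l}) * wedge_sign l P = - (wedge_sign l (P - {k}) * wedge_sign k P)"
    if "k < l" "k \<in> P" for k l
  proof -
    have "{j \<in> P - {l}. j < k} = {j \<in> P. j < k}" using that by auto
    moreover have "{j \<in> P. j < l} = insert k {j \<in> P - {k}. j < l}" using that by auto
    then have "card {j \<in> P. j < l} = Suc (card {j \<in> P - {k}. j < l})" by simp
    ultimately show ?thesis by (simp add: wedge_sign_def)
  qed
  show ?thesis
    using *[of k l] *[of l k] assms by (cases k l rule: linorder_cases) auto
qed

lemma norm_wedge_sign [simp]: "cmod (wedge_sign k K) = 1"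
  by (simp add: wedge_sign_def norm_power)

text \<open>The contraction of \<open>d\<zeta>bar\<^sub>P\<close> with the field \<open>\<Sum> \<zeta>bar\<^sub>l \<partial>/\<partial>\<zeta>bar\<^sub>l\<close>. Since \<open>\<partial>r/\<partial>z\<^sub>l = zbar\<^sub>l\<close>, for \<open>P\<close>
  consisting of \<open>z\<close>-indices a second contraction, which gives \<open>0\<close>, computes the normal component.\<close>

definition contraction :: "'m set \<Rightarrow> ('m::{finite,linorder}) form" where
  "contraction P J \<zeta> = (\<Sum>l\<in>P. if J = P - {l} then wedge_sign l P * cnj (\<zeta> $ l) else 0)"

lemma contraction_eq_0: "k \<notin> P \<Longrightarrow> contraction P (insert k K) \<zeta> = 0"
  unfolding contraction_def by (intro sum.neutral) auto

lemma contraction_remove: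
  assumes "j \<in> P"
  shows "contraction P (P - {j}) \<zeta> = wedge_sign j P * cnj (\<zeta> $ j)"
proof -
  have "contraction P (P - {j}) \<zeta> = (\<Sum>l\<in>P. if l = j then wedge_sign j P * cnj (\<zeta> $ j) else 0)"
    unfolding contraction_def using assms by (intro sum.cong) auto
  then show ?thesis using assms by simp
qed

text \<open>Contracting twice with the same vector field gives 0: the terms for
  \<open>(k, l)\<close> and \<open>(l, k)\<close> cancel by
  \<open>wedge_sign_antisym\<close>.\<close>

lemma contraction_contraction:
  fixes P K :: "'m::{finite,linorder} set"
  shows "(\<Sum>k\<in>- K. wedge_sign k (insert k K) * cnj (\<zeta> $ k) * contraction P (insert k K) \<zeta>) = 0"
proof -
  \<comment> \<open>Extends the summand by 0 to all pairs of indices, so that exchanging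
    \<open>k\<close> and \<open>l\<close> maps the range of summation to itself.\<close>
  define T where "T k l = (if k \<notin> K \<and> l \<in> P \<and> insert k K = P - {l}
    then wedge_sign k (P - {l}) * wedge_sign l P * (cnj (\<zeta> $ k) * cnj (\<zeta> $ l)) else 0)" for k l
  have "(\<Sum>k\<in>- K. wedge_sign k (insert k K) * cnj (\<zeta> $ k) * contraction P (insert k K) \<zeta>)
      = (\<Sum>k\<in>- K. \<Sum>l\<in>P. T k l)"
    unfolding contraction_def sum_distrib_left by (intro sum.cong refl) (auto simp: T_def)
  also have "\<dots> = (\<Sum>k\<in>- K. \<Sum>l\<in>UNIV. T k l)"
    by (intro sum.cong refl sum.mono_neutral_left) (auto simp: T_def)
  also have "\<dots> = (\<Sum>k\<in>UNIV. \<Sum>l\<in>UNIV. T k l)"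
    by (intro sum.mono_neutral_left) (auto simp: T_def)
  finally have S: "(\<Sum>k\<in>- K. wedge_sign k (insert k K) * cnj (\<zeta> $ k) * contraction P (insert k K) \<zeta>)
      = (\<Sum>k\<in>UNIV. \<Sum>l\<in>UNIV. T k l)" .
  have anti: "T k l = - T l k" for k l
  proof (cases "k \<notin> K \<and> l \<in> P \<and> insert k K = P - {l}")
    case True
    then have "l \<notin> K" "k \<in> P" "k \<noteq> l" "insert l K = P - {k}" by auto
    with True show ?thesis
      using wedge_sign_antisym[of k P l] by (simp add: T_def mult.commute[of "cnj (\<zeta> $ l)"])
  next
    case False
    then have "\<not> (l \<notin> K \<and> k \<in> P \<and> insert l K = P - {k})" by auto
    then have "T l k = 0" unfolding T_def by (rule if_not_P)
    moreover have "T k l = 0" unfolding T_def by (rule if_not_P[OF False])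
    ultimately show ?thesis by simp
  qed
  have "(\<Sum>k\<in>UNIV. \<Sum>l\<in>UNIV. T k l) = (\<Sum>l\<in>UNIV. \<Sum>k\<in>UNIV. T k l)" by (rule sum.swap)
  also have "\<dots> = - (\<Sum>l\<in>UNIV. \<Sum>k\<in>UNIV. T l k)"
    unfolding sum_negf[symmetric] by (intro sum.cong refl anti)
  finally have "(\<Sum>k\<in>UNIV. \<Sum>l\<in>UNIV. T k l) = 0" by simp
  with S show ?thesis by simp
qed

lemma smooth_contraction_term: "smooth (\<lambda>\<zeta>. if b then c * cnj (\<zeta> $ l) else 0)"
  by (cases b) (auto intro!: smooth_intros)

lemma smooth_contraction: "smooth (contraction P J)"
  unfolding contraction_def[abs_def] by (intro smooth_sum smooth_contraction_term)

lemma d_zeta_contraction: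
  "d_zeta k (contraction P J) \<zeta> = 0"
  "cmod (d_zetabar k (contraction P J) \<zeta>) \<le> CARD('m)" for P :: "'m::{finite,linorder} set"
proof -
  have t: "d_zeta k (\<lambda>\<zeta>. if b then wedge_sign l P * cnj (\<zeta> $ l) else 0) \<zeta> = 0"
    "cmod (d_zetabar k (\<lambda>\<zeta>. if b then wedge_sign l P * cnj (\<zeta> $ l) else 0) \<zeta>) \<le> 1" for b l
    by (cases b; simp add: d_zeta_const d_zeta_mult smooth_const smooth_cnj smooth_component d_zeta_cnj
        d_zeta_component norm_mult)+
  show "d_zeta k (contraction P J) \<zeta> = 0"
    unfolding contraction_def[abs_def] by (subst d_zeta_sum[OF smooth_contraction_term]) (simp add: t)
  have "cmod (d_zetabar k (contraction P J) \<zeta>) \<le> (\<Sum>l\<in>P. 1)"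
    unfolding contraction_def[abs_def] d_zeta_sum(2)[OF smooth_contraction_term]
    by (rule order_trans[OF norm_sum sum_mono]) (rule t)
  also have "\<dots> \<le> CARD('m)" by (simp add: card_mono)
  finally show "cmod (d_zetabar k (contraction P J) \<zeta>) \<le> CARD('m)" .
qed

lemma norm_contraction_le:
  fixes B :: real and P :: "'m::{finite,linorder} set"
  assumes "\<And>l. l \<in> P \<Longrightarrow> cmod (\<zeta> $ l) \<le> B" "0 \<le> B"
  shows "cmod (contraction P J \<zeta>) \<le> CARD('m) * B"
proof -
  have "cmod (contraction P J \<zeta>) \<le> (\<Sum>l\<in>P. B)"
    unfolding contraction_def
    by (rule order_trans[OF norm_sum sum_mono]) (use assms in \<open>auto simp: norm_mult\<close>)
  also have "\<dots> \<le> CARD('m) * B"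
    using assms(2) by (simp add: card_mono mult_right_mono)
  finally show ?thesis .
qed

lemma d_zeta_siegel_r: "d_zeta (Some j) (\<lambda>\<zeta>. of_real (siegel_r \<zeta>)) \<zeta> = cnj (\<zeta> $ Some j)"
  unfolding d_zeta_real[OF smooth_differentiable[OF smooth_siegel_r]]
    frechet_derivative_grad[OF smooth_differentiable[OF smooth_siegel_r]]
  by (simp add: grad_siegel_r inner_axis complex_eq_iff inner_complex_def)

text \<open>\<open>hol_w\<close> is the last coordinate after the Heisenberg translation taking \<open>(R e\<^sub>j, i R\<^sup>2)\<close> to \<open>0\<close>.\<close>

definition hol_w :: "real \<Rightarrow> 'n \<Rightarrow> complex ^ ('n::finite option) \<Rightarrow> complex" where
  "hol_w R j \<zeta> = \<zeta> $ None + (- 2 * \<i> * of_real R) * \<zeta> $ Some j + \<i> * of_real (R\<^sup>2)"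

definition center :: "real \<Rightarrow> 'n \<Rightarrow> complex ^ 'n::finite" where
  "center R j = axis j (of_real R)"

text \<open>On the support the peak has width \<open>R\<^bsup>-4\<^esup>\<close> in \<open>z\<close>, the scale of the exponential below, and width
  \<open>R\<^bsup>-2\<^esup>\<close> in \<open>w\<close>, so that \<open>|\<zeta>|\<^sup>2\<close>, which is about \<open>R\<^sup>4\<close>, varies only by a bounded amount and the
  derivatives of the cut-off are of size \<open>R\<^sup>4\<close>, the square root of the exponent \<open>R\<^sup>8\<close>.\<close>

definition phase :: "real \<Rightarrow> 'n \<Rightarrow> complex ^ ('n::finite option) \<Rightarrow> real" where
  "phase R j \<zeta> = 1 - R ^ 8 * (norm (zpart \<zeta> - center R j))\<^sup>2 - R ^ 4 * (cmod (hol_w R j \<zeta>))\<^sup>2"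

definition peak :: "real \<Rightarrow> 'n \<Rightarrow> complex ^ ('n::finite option) \<Rightarrow> complex" where
  "peak R j \<zeta> = exp (\<i> * of_real (R ^ 8) * hol_w R j \<zeta>)"

text \<open>Dividing by \<open>R\<close> normalizes the form: near the centre the coefficient of the
  contraction at the index set without \<open>j\<close> has modulus about \<open>R\<close>.\<close>

definition peak_form :: "real \<Rightarrow> 'n \<Rightarrow> 'n set \<Rightarrow> ('n::{finite,linorder} option) form" where
  "peak_form R j P J \<zeta> =
     contraction (Some ` P) J \<zeta> / of_real R * (of_real (bump 0 (phase R j \<zeta>)) * peak R j \<zeta>)"

section \<open>The peak function, its support and its derivatives\<close>

lemma smooth_hol_w: "smooth (hol_w R j)"
  unfolding hol_w_def[abs_def] by (intro smooth_intros)

lemma d_zeta_hol_w: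
  "d_zeta k (hol_w R j) \<zeta> = (case k of None \<Rightarrow> 1 | Some l \<Rightarrow> - 2 * \<i> * cnj (center R j $ l))" (is ?g0)
  "d_zetabar k (hol_w R j) \<zeta> = 0"
proof -
  have s: "smooth (\<lambda>\<zeta>::complex^('n::finite option). \<zeta> $ None + (- 2 * \<i> * of_real R) * \<zeta> $ Some j)"
    "smooth (\<lambda>\<zeta>::complex^('n option). (- 2 * \<i> * of_real R) * \<zeta> $ Some j)" for j
    by (intro smooth_intros)+
  show ?g0
    "d_zetabar k (hol_w R j) \<zeta> = 0"
    unfolding hol_w_def[abs_def] d_zeta_add[OF s(1) smooth_const] d_zeta_add[OF smooth_component s(2)]
      d_zeta_mult[OF smooth_const smooth_component] d_zeta_const d_zeta_component
    by (auto simp: center_def axis_def split: option.splits)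
qed

lemma smooth_peak: "smooth (peak R j)"
  unfolding peak_def[abs_def] by (intro smooth_intros smooth_hol_w)

lemma d_zeta_peak:
  "d_zeta k (peak R j) \<zeta> = peak R j \<zeta> * (\<i> * of_real (R ^ 8) * d_zeta k (hol_w R j) \<zeta>)" (is ?g0)
  "d_zetabar k (peak R j) \<zeta> = 0"
proof -
  have s: "smooth (\<lambda>\<zeta>. \<i> * of_real (R ^ 8) * hol_w R j \<zeta>)" by (intro smooth_intros smooth_hol_w)
  show ?g0
    "d_zetabar k (peak R j) \<zeta> = 0"
    unfolding peak_def[abs_def] d_zeta_exp[OF s] d_zeta_mult[OF smooth_const smooth_hol_w] d_zeta_const
    by (simp_all add: d_zeta_hol_w(2))
qed

text \<open>The square is completed around the centre. Hence \<open>|peak|\<close> is at most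
  \<open>exp (R ^ 8 * siegel_r \<zeta>)\<close>, and along the boundary it is a Gaussian in
  \<open>z\<close> of width about \<open>R ^ (-4)\<close>.\<close>

lemma Im_hol_w: "Im (hol_w R j \<zeta>) = - siegel_r \<zeta> + (norm (zpart \<zeta> - center R j))\<^sup>2"
  unfolding power2_norm_eq_inner siegel_r_def
  by (simp add: hol_w_def center_def inner_diff_left inner_diff_right inner_axis inner_axis' inner_complex_def
      power2_eq_square algebra_simps)

lemma norm_peak: "cmod (peak R j \<zeta>) = exp (- (R ^ 8 * Im (hol_w R j \<zeta>)))"
  by (simp add: peak_def)

lemma smooth_phase: "smooth (phase R j)"
  unfolding phase_def[abs_def]
  by (intro smooth_intros smooth_zpart smooth_hol_w)

lemma norm_center: "norm (center R j) = \<bar>R\<bar>"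
  by (simp add: center_def norm_axis_eq)

text \<open>The number 18 is \<open>3 + 15\<close>, the deviations of \<open>|z|^2\<close> from
  \<open>R\<^sup>2\<close> and of \<open>|w|^2\<close> from \<open>R ^ 4\<close>. The second is the
  demanding one: \<open>w\<close> moves by up to \<open>h + 2 * R * d\<close>, and this is
  multiplied by about \<open>R\<^sup>2\<close>, so \<open>R\<^sup>2 * h\<close> and
  \<open>R ^ 3 * d\<close> must stay bounded.\<close>

lemma phase_pos_bounds:
  assumes R: "1 \<le> R" and pos: "0 < phase R j \<zeta>"
  shows "norm (zpart \<zeta> - center R j) \<le> 1 / R ^ 4" "cmod (hol_w R j \<zeta>) \<le> 1 / R\<^sup>2"
    "norm (zpart \<zeta>) \<le> 2 * R" "\<bar>(norm \<zeta>)\<^sup>2 - (R\<^sup>2 + R ^ 4)\<bar> \<le> 18"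
proof -
  define d where "d = norm (zpart \<zeta> - center R j)"
  define h where "h = cmod (hol_w R j \<zeta>)"
  have dh: "0 \<le> d" "0 \<le> h" by (simp_all add: d_def h_def)
  have "(R ^ 4 * d)\<^sup>2 + (R\<^sup>2 * h)\<^sup>2 < 1\<^sup>2"
    using pos by (simp add: phase_def d_def h_def power_mult_distrib flip: power_mult)
  then have "(R ^ 4 * d)\<^sup>2 \<le> 1\<^sup>2" "(R\<^sup>2 * h)\<^sup>2 \<le> 1\<^sup>2"
    using zero_le_power2[of "R ^ 4 * d"] zero_le_power2[of "R\<^sup>2 * h"] by linarith+
  then have dh1: "R ^ 4 * d \<le> 1" "R\<^sup>2 * h \<le> 1"
    by (auto intro: power2_le_imp_le)
  then show b: "norm (zpart \<zeta> - center R j) \<le> 1 / R ^ 4" "cmod (hol_w R j \<zeta>) \<le> 1 / R\<^sup>2"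
    using R by (simp_all add: d_def[symmetric] h_def[symmetric] pos_le_divide_eq mult.commute)
  have R1: "1 \<le> R ^ k" for k using R by (rule one_le_power)
  have Rk: "R * d \<le> 1" "R\<^sup>2 * d \<le> 1" "R ^ 3 * d \<le> 1" "d \<le> 1" "h \<le> 1"
  proof -
    have "R ^ k * d \<le> R ^ 4 * d" if "k \<le> 4" for k
      using that R dh by (intro mult_right_mono power_increasing) auto
    from this[of 0] this[of 1] this[of 2] this[of 3] dh1(1)
    show "R * d \<le> 1" "R\<^sup>2 * d \<le> 1" "R ^ 3 * d \<le> 1" "d \<le> 1" by simp_all
    have "1 * h \<le> R\<^sup>2 * h" using R1[of 2] dh by (intro mult_right_mono) auto
    with dh1 show "h \<le> 1" by simp
  qed
  have zR: "\<bar>norm (zpart \<zeta>) - R\<bar> \<le> d"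
    using norm_triangle_ineq3[of "zpart \<zeta>" "center R j"] R by (simp add: d_def norm_center)
  then show z2: "norm (zpart \<zeta>) \<le> 2 * R" using Rk R by linarith
  define a where "a = norm (zpart \<zeta>) - R"
  have a: "\<bar>a\<bar> \<le> d" using zR by (simp add: a_def)
  have A: "\<bar>(norm (zpart \<zeta>))\<^sup>2 - R\<^sup>2\<bar> \<le> 3"
  proof -
    have "(norm (zpart \<zeta>))\<^sup>2 - R\<^sup>2 = 2 * (R * a) + a\<^sup>2"
      by (simp add: a_def power2_eq_square algebra_simps)
    moreover have "\<bar>R * a\<bar> \<le> R * d" using R a by (simp add: abs_mult)
    moreover have "a\<^sup>2 \<le> 1" using a Rk by (simp add: abs_square_le_1)
    ultimately show ?thesis using Rk(1) zero_le_power2[of a] by linarith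
  qed
  define e where "e = \<zeta> $ None - \<i> * of_real (R\<^sup>2)"
  have "e = hol_w R j \<zeta> + 2 * \<i> * of_real R * ((zpart \<zeta> - center R j) $ j)"
    by (simp add: e_def hol_w_def center_def power2_eq_square algebra_simps)
  then have "cmod e \<le> h + cmod (2 * \<i> * of_real R * ((zpart \<zeta> - center R j) $ j))"
    unfolding h_def by (metis norm_triangle_ineq)
  also have "cmod (2 * \<i> * of_real R * ((zpart \<zeta> - center R j) $ j)) = 2 * R * cmod ((zpart \<zeta> - center R j) $ j)"
    using R by (simp add: norm_mult)
  also have "\<dots> \<le> 2 * R * d"
    unfolding d_def using R by (intro mult_left_mono Finite_Cartesian_Product.norm_nth_le) auto
  finally have e: "cmod e \<le> h + 2 * R * d" by simp
  define c where "c = cmod (\<zeta> $ None) - R\<^sup>2"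
  have c: "\<bar>c\<bar> \<le> h + 2 * R * d"
    using norm_triangle_ineq3[of "\<zeta> $ None" "\<i> * of_real (R\<^sup>2)"] e by (simp add: c_def e_def norm_mult norm_power)
  have B: "\<bar>(cmod (\<zeta> $ None))\<^sup>2 - R ^ 4\<bar> \<le> 15"
  proof -
    have "(cmod (\<zeta> $ None))\<^sup>2 - R ^ 4 = 2 * (R\<^sup>2 * c) + c\<^sup>2"
      by (simp add: c_def power2_eq_square power4_eq_xxxx algebra_simps)
    moreover have "\<bar>R\<^sup>2 * c\<bar> \<le> 3"
    proof -
      have "\<bar>R\<^sup>2 * c\<bar> = R\<^sup>2 * \<bar>c\<bar>" by (simp add: abs_mult)
      also have "\<dots> \<le> R\<^sup>2 * (h + 2 * R * d)" using c by (intro mult_left_mono) auto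
      also have "\<dots> = R\<^sup>2 * h + 2 * (R ^ 3 * d)" by (simp add: algebra_simps power2_eq_square power3_eq_cube)
      finally show ?thesis using dh1 Rk by linarith
    qed
    moreover have "c\<^sup>2 \<le> 9"
    proof -
      have "\<bar>c\<bar> \<le> 3" using c Rk by linarith
      then have "\<bar>c\<bar>\<^sup>2 \<le> 3\<^sup>2" by (intro power_mono) auto
      then show ?thesis by simp
    qed
    ultimately show ?thesis using zero_le_power2[of c] by linarith
  qed
  show "\<bar>(norm \<zeta>)\<^sup>2 - (R\<^sup>2 + R ^ 4)\<bar> \<le> 18"
    using A B unfolding norm_split_power2[of \<zeta>] by linarith
qed

lemma compact_support_phase:
  assumes "1 \<le> R"
  shows "compact_support (\<lambda>\<zeta>. of_real (bump 0 (phase R j \<zeta>)) * F \<zeta> :: complex)"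
  unfolding compact_support_def
proof (intro exI conjI allI impI)
  show "compact (cball 0 (sqrt (R\<^sup>2 + R ^ 4 + 18)) :: (complex ^ ('a option)) set)" by simp
  fix \<zeta> :: "complex ^ ('a option)" assume "\<zeta> \<notin> cball 0 (sqrt (R\<^sup>2 + R ^ 4 + 18))"
  then have "sqrt (R\<^sup>2 + R ^ 4 + 18) < norm \<zeta>" by simp
  then have "R\<^sup>2 + R ^ 4 + 18 < (norm \<zeta>)\<^sup>2"
    using real_sqrt_less_iff[of "R\<^sup>2 + R ^ 4 + 18" "(norm \<zeta>)\<^sup>2"] by simp
  then have "\<not> 0 < phase R j \<zeta>" using phase_pos_bounds(4)[OF assms, of j \<zeta>] by force
  then show "of_real (bump 0 (phase R j \<zeta>)) * F \<zeta> = 0" by (simp add: bump_def)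
qed

lemma norm_d_zeta_real_le:
  assumes "smooth g" "\<And>h. \<bar>frechet_derivative g (at \<zeta>) h\<bar> \<le> B * norm h"
  shows "cmod (d_zeta k (\<lambda>\<zeta>. of_real (g \<zeta>)) \<zeta>) \<le> B" "cmod (d_zetabar k (\<lambda>\<zeta>. of_real (g \<zeta>)) \<zeta>) \<le> B"
proof -
  have b: "\<bar>frechet_derivative g (at \<zeta>) (axis k 1)\<bar> \<le> B" "\<bar>frechet_derivative g (at \<zeta>) (axis k \<i>)\<bar> \<le> B"
    using assms(2)[of "axis k 1"] assms(2)[of "axis k \<i>"] by (simp_all add: norm_axis_eq)
  have "cmod ((of_real x - \<i> * of_real y) / 2) \<le> B" "cmod ((of_real x + \<i> * of_real y) / 2) \<le> B"
    if "\<bar>x\<bar> \<le> B" "\<bar>y\<bar> \<le> B" for x y :: real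
    using that norm_triangle_ineq4[of "complex_of_real x" "\<i> * of_real y"]
      norm_triangle_ineq[of "complex_of_real x" "\<i> * of_real y"] by (auto simp: norm_mult norm_divide)
  with b show "cmod (d_zeta k (\<lambda>\<zeta>. of_real (g \<zeta>)) \<zeta>) \<le> B" "cmod (d_zetabar k (\<lambda>\<zeta>. of_real (g \<zeta>)) \<zeta>) \<le> B"
    unfolding d_zeta_real[OF smooth_differentiable[OF assms(1)]] by blast+
qed

text \<open>The z-term gives \<open>R ^ 8 * (1 / R ^ 4)\<close>. The derivative of
  \<open>hol_w\<close> has norm at most \<open>3 * R\<close>, so the other term gives
  \<open>R ^ 4 * (1 / R\<^sup>2) * (3 * R)\<close>, which is at most \<open>3 * R ^ 4\<close>.
  Doubling both makes 8.\<close>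

lemma phase_derivative_le:
  assumes R: "1 \<le> R" and pos: "0 < phase R j \<zeta>"
  shows "\<bar>frechet_derivative (phase R j) (at \<zeta>) h\<bar> \<le> 8 * R ^ 4 * norm h"
proof -
  define D where "D h = h $ None + (- 2 * \<i> * of_real R) * h $ Some j" for h :: "complex ^ ('a option)"
  have hol: "(hol_w R j has_derivative D) (at \<zeta>)"
    unfolding hol_w_def[abs_def] D_def[abs_def]
    by (auto intro!: derivative_eq_intros bounded_linear_imp_has_derivative[OF bounded_linear_vec_nth])
  have z: "((\<lambda>\<zeta>. zpart \<zeta> - center R j) has_derivative zpart) (at \<zeta>)"
    by (auto intro!: derivative_eq_intros bounded_linear_imp_has_derivative[OF bounded_linear_zpart])
  have "(phase R j has_derivative (\<lambda>h. 0 - R ^ 8 * ((zpart \<zeta> - center R j) \<bullet> zpart h + zpart h \<bullet> (zpart \<zeta> - center R j))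
      - R ^ 4 * (hol_w R j \<zeta> \<bullet> D h + D h \<bullet> hol_w R j \<zeta>))) (at \<zeta>)"
    unfolding phase_def[abs_def] power2_norm_eq_inner
    by (intro has_derivative_diff has_derivative_const has_derivative_mult_right has_derivative_inner z hol)
  from fun_cong[OF frechet_derivative_at[OF this], of h]
  have fd: "frechet_derivative (phase R j) (at \<zeta>) h = - (2 * (R ^ 8 * ((zpart \<zeta> - center R j) \<bullet> zpart h)))
      - 2 * (R ^ 4 * (hol_w R j \<zeta> \<bullet> D h))"
    by (simp add: inner_commute[of "zpart h"] inner_commute[of "D h"] distrib_left)
  have "\<bar>R ^ 8 * ((zpart \<zeta> - center R j) \<bullet> zpart h)\<bar> \<le> R ^ 8 * ((1 / R ^ 4) * norm h)"
  proof -
    have "\<bar>(zpart \<zeta> - center R j) \<bullet> zpart h\<bar> \<le> norm (zpart \<zeta> - center R j) * norm (zpart h)"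
      by (rule Cauchy_Schwarz_ineq2)
    also have "\<dots> \<le> (1 / R ^ 4) * norm h"
      using R by (intro mult_mono phase_pos_bounds[OF R pos] norm_zpart_le) auto
    finally have "\<bar>(zpart \<zeta> - center R j) \<bullet> zpart h\<bar> \<le> (1 / R ^ 4) * norm h" .
    from mult_left_mono[OF this, of "R ^ 8"] show ?thesis using R by (simp add: abs_mult)
  qed
  also have "\<dots> = R ^ 4 * norm h" using R by (simp add: field_simps flip: power_add)
  finally have 1: "\<bar>R ^ 8 * ((zpart \<zeta> - center R j) \<bullet> zpart h)\<bar> \<le> R ^ 4 * norm h" .
  have Dh: "cmod (D h) \<le> 3 * R * norm h"
  proof -
    have "cmod (D h) \<le> cmod (h $ None) + 2 * R * cmod (h $ Some j)"
      unfolding D_def by (rule order_trans[OF norm_triangle_ineq]) (use R in \<open>simp add: norm_mult\<close>)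
    also have "\<dots> \<le> norm h + 2 * R * norm h"
      using R by (intro add_mono mult_left_mono Finite_Cartesian_Product.norm_nth_le) auto
    also have "\<dots> \<le> R * norm h + 2 * R * norm h"
      using R mult_right_mono[OF R norm_ge_zero[of h]] by simp
    finally show ?thesis by (simp add: algebra_simps)
  qed
  have "\<bar>R ^ 4 * (hol_w R j \<zeta> \<bullet> D h)\<bar> \<le> R ^ 4 * ((1 / R\<^sup>2) * (3 * R * norm h))"
  proof -
    have "\<bar>hol_w R j \<zeta> \<bullet> D h\<bar> \<le> cmod (hol_w R j \<zeta>) * cmod (D h)"
      by (rule Cauchy_Schwarz_ineq2)
    also have "\<dots> \<le> (1 / R\<^sup>2) * (3 * R * norm h)"
      using R by (intro mult_mono phase_pos_bounds[OF R pos] Dh) auto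
    finally have "\<bar>hol_w R j \<zeta> \<bullet> D h\<bar> \<le> (1 / R\<^sup>2) * (3 * R * norm h)" .
    from mult_left_mono[OF this, of "R ^ 4"] show ?thesis using R by (simp add: abs_mult)
  qed
  also have "\<dots> = 3 * (R ^ 3 * norm h)" using R by (simp add: field_simps power2_eq_square power3_eq_cube power4_eq_xxxx)
  also have "\<dots> \<le> 3 * (R ^ 4 * norm h)"
    using R by (intro mult_left_mono mult_right_mono power_increasing) auto
  finally have 2: "\<bar>R ^ 4 * (hol_w R j \<zeta> \<bullet> D h)\<bar> \<le> 3 * (R ^ 4 * norm h)" .
  show ?thesis unfolding fd using 1 2 by linarith
qed

lemma d_zeta_bump_phase:
  "d_zeta k (\<lambda>\<zeta>. of_real (bump 0 (phase R j \<zeta>))) \<zeta> = of_real (bump 2 (phase R j \<zeta>)) * d_zeta k (\<lambda>\<zeta>. of_real (phase R j \<zeta>)) \<zeta>" (is ?g0)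
  "d_zetabar k (\<lambda>\<zeta>. of_real (bump 0 (phase R j \<zeta>))) \<zeta> = of_real (bump 2 (phase R j \<zeta>)) * d_zetabar k (\<lambda>\<zeta>. of_real (phase R j \<zeta>)) \<zeta>" (is ?g1)
proof -
  have "(bump 0 has_real_derivative bump 2 (phase R j \<zeta>)) (at (phase R j \<zeta>))"
    using DERIV_bump[of 0 "phase R j \<zeta>"] by (simp add: numeral_2_eq_2)
  from d_zeta_compose_real[OF smooth_phase this]
  show ?g0
    ?g1 .
qed

lemma norm_d_zeta_bump_phase:
  assumes R: "1 \<le> R" and pos: "0 < phase R j \<zeta>"
  shows "cmod (d_zeta k (\<lambda>\<zeta>. of_real (bump 0 (phase R j \<zeta>))) \<zeta>) \<le> 16 * R ^ 4" (is ?g0)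
    "cmod (d_zetabar k (\<lambda>\<zeta>. of_real (bump 0 (phase R j \<zeta>))) \<zeta>) \<le> 16 * R ^ 4" (is ?g1)
proof -
  have b: "\<bar>bump 2 (phase R j \<zeta>)\<bar> \<le> 2" using bump_2_le_2 bump_nonneg by (simp add: abs_of_nonneg)
  have "\<bar>bump 2 (phase R j \<zeta>)\<bar> * c \<le> 16 * R ^ 4" if "c \<le> 8 * R ^ 4" "0 \<le> c" for c
    using mult_mono[OF b that(1)] that by simp
  then show ?g0
    ?g1
    unfolding d_zeta_bump_phase norm_mult norm_of_real
    using norm_d_zeta_real_le[OF smooth_phase phase_derivative_le[OF R pos]] by simp_all
qed

lemma smooth_bump_phase: "smooth (\<lambda>\<zeta>. complex_of_real (bump 0 (phase R j \<zeta>)))"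
  by (rule smooth_of_real[OF smooth_compose_real[OF smooth_bump smooth_phase]])

lemma smooth_peak_form: "smooth (peak_form R j P J)"
  unfolding peak_form_def[abs_def]
  by (intro smooth_mult smooth_linear_compose[OF bounded_linear_divide] smooth_contraction smooth_bump_phase smooth_peak)

lemma compact_support_peak_form: "1 \<le> R \<Longrightarrow> compact_support (peak_form R j P J)"
  unfolding peak_form_def[abs_def] by (intro compact_support_mult(2) compact_support_phase)

text \<open>The contraction is antiholomorphic and the peak holomorphic, so each kind of derivative
  meets only one of them besides the bump. In particular the large exponent does not enter the
  \<open>d_zetabar\<close> derivative.\<close>

lemma d_zeta_peak_form:
  "d_zeta k (peak_form R j P J) \<zeta> = contraction (Some ` P) J \<zeta> / of_real R * peak R j \<zeta> *
     (d_zeta k (\<lambda>\<zeta>. of_real (bump 0 (phase R j \<zeta>))) \<zeta>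
      + of_real (bump 0 (phase R j \<zeta>)) * (\<i> * of_real (R ^ 8) * d_zeta k (hol_w R j) \<zeta>))" (is ?g0)
  "d_zetabar k (peak_form R j P J) \<zeta> = peak R j \<zeta> *
     (d_zetabar k (contraction (Some ` P) J) \<zeta> / of_real R * of_real (bump 0 (phase R j \<zeta>))
      + contraction (Some ` P) J \<zeta> / of_real R * d_zetabar k (\<lambda>\<zeta>. of_real (bump 0 (phase R j \<zeta>))) \<zeta>)" (is ?g1)
proof -
  have eq: "peak_form R j P J = (\<lambda>\<zeta>. (1 / of_real R) * (contraction (Some ` P) J \<zeta> *
      (of_real (bump 0 (phase R j \<zeta>)) * peak R j \<zeta>)))"
    by (simp add: peak_form_def fun_eq_iff)
  note s = smooth_mult[OF smooth_bump_phase smooth_peak]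
  note e = d_zeta_mult[OF smooth_const smooth_mult[OF smooth_contraction s]] d_zeta_const
    d_zeta_mult[OF smooth_contraction s] d_zeta_mult[OF smooth_bump_phase smooth_peak] d_zeta_contraction(1) d_zeta_peak
  show ?g0
    ?g1
    unfolding eq e by (simp_all add: algebra_simps add_divide_distrib)
qed

lemma peak_form_tangential:
  "(\<Sum>k\<in>- K. wedge_sign k (insert k K) * d_zeta k (\<lambda>\<zeta>. of_real (siegel_r \<zeta>)) \<zeta> * peak_form R j P (insert k K) \<zeta>) = 0"
proof -
  have "wedge_sign k (insert k K) * d_zeta k (\<lambda>\<zeta>. of_real (siegel_r \<zeta>)) \<zeta> * peak_form R j P (insert k K) \<zeta>
      = (of_real (bump 0 (phase R j \<zeta>)) * peak R j \<zeta> / of_real R) *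
        (wedge_sign k (insert k K) * cnj (\<zeta> $ k) * contraction (Some ` P) (insert k K) \<zeta>)" for k
    by (cases k) (simp_all add: peak_form_def d_zeta_siegel_r contraction_eq_0)
  then show ?thesis
    by (simp only: sum_distrib_left[symmetric] contraction_contraction mult_zero_right)
qed

lemma norm_contraction_R_le:
  fixes R :: real and P :: "'n::{finite,linorder} set"
  assumes R: "1 \<le> R" and pos: "0 < phase R j \<zeta>"
  shows "cmod (contraction (Some ` P) J \<zeta> / of_real R) \<le> 2 * real CARD('n option)"
proof -
  have "cmod (\<zeta> $ l) \<le> 2 * R" if l: "l \<in> Some ` P" for l
  proof -
    obtain i where "l = Some i" using l by blast
    then have "cmod (\<zeta> $ l) = cmod (zpart \<zeta> $ i)" by simp
    also have "\<dots> \<le> norm (zpart \<zeta>)" by (rule Finite_Cartesian_Product.norm_nth_le)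
    finally show ?thesis using phase_pos_bounds(3)[OF R pos] by linarith
  qed
  then have "cmod (contraction (Some ` P) J \<zeta>) \<le> CARD('n option) * (2 * R)"
    using R by (intro norm_contraction_le) auto
  then show ?thesis using R by (simp add: norm_divide field_simps)
qed

text \<open>With \<open>m\<close> the number of indices, a derivative of a coefficient is at most
  \<open>(m + 2 * m * 16) * R ^ 4\<close> times the peak, and each sum has at most \<open>m\<close>
  terms. The resulting 33 is enlarged to 36 to match \<open>theta_peak_form_le\<close>.\<close>

lemma dbar_peak_form_le:
  fixes R :: real and P :: "'n::{finite,linorder} set"
  assumes R: "1 \<le> R"
  shows "cmod (dbar_smooth (peak_form R j P) K \<zeta>)
    \<le> (if 0 < phase R j \<zeta> then 36 * (real CARD('n option))\<^sup>2 * R ^ 4 * cmod (peak R j \<zeta>) else 0)"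
proof (cases "0 < phase R j \<zeta>")
  case False
  then have "d_zetabar k (peak_form R j P J) \<zeta> = 0" for k J
    unfolding d_zeta_peak_form d_zeta_bump_phase by (simp add: bump_def)
  with False show ?thesis by (simp add: dbar_smooth_def)
next
  case pos: True
  let ?m = "real CARD('n option)"
  have card_le: "real (card L) \<le> ?m" for L :: "'n option set"
    by (rule of_nat_mono[OF card_mono]) auto
  have m: "1 \<le> ?m" by simp
  have R4: "1 \<le> R ^ 4" using R by (rule one_le_power)
  have "cmod (d_zetabar k (peak_form R j P J) \<zeta>) \<le> cmod (peak R j \<zeta>) * (36 * ?m * R ^ 4)" for k J
  proof -
    have "cmod (d_zetabar k (contraction (Some ` P) J) \<zeta> / of_real R * of_real (bump 0 (phase R j \<zeta>)))
        \<le> ?m * 1"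
      unfolding norm_mult
    proof (rule mult_mono)
      have "cmod (d_zetabar k (contraction (Some ` P) J) \<zeta> / of_real R) \<le> cmod (d_zetabar k (contraction (Some ` P) J) \<zeta>)"
        using R by (simp add: norm_divide divide_le_eq mult_le_cancel_left1)
      also have "\<dots> \<le> ?m" by (rule d_zeta_contraction)
      finally show "cmod (d_zetabar k (contraction (Some ` P) J) \<zeta> / of_real R) \<le> ?m" .
    qed (auto simp: bump_0_le_1 bump_nonneg)
    also have "\<dots> \<le> ?m * R ^ 4" using R4 m by (intro mult_left_mono) auto
    finally have 1: "cmod (d_zetabar k (contraction (Some ` P) J) \<zeta> / of_real R * of_real (bump 0 (phase R j \<zeta>)))
        \<le> ?m * R ^ 4" .
    have 2: "cmod (contraction (Some ` P) J \<zeta> / of_real R * d_zetabar k (\<lambda>\<zeta>. of_real (bump 0 (phase R j \<zeta>))) \<zeta>)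
        \<le> (2 * ?m) * (16 * R ^ 4)"
      unfolding norm_mult
      by (intro mult_mono norm_contraction_R_le[OF R pos] norm_d_zeta_bump_phase[OF R pos]) auto
    have "0 \<le> ?m * R ^ 4" using R by simp
    then have 3: "?m * R ^ 4 + (2 * ?m) * (16 * R ^ 4) \<le> 36 * ?m * R ^ 4" by linarith
    show ?thesis
      unfolding d_zeta_peak_form norm_mult[of "peak R j \<zeta>"]
      by (rule mult_left_mono[OF order_trans[OF norm_triangle_ineq order_trans[OF add_mono[OF 1 2] 3]] norm_ge_zero])
  qed
  then have "cmod (dbar_smooth (peak_form R j P) K \<zeta>) \<le> (\<Sum>k\<in>K. cmod (peak R j \<zeta>) * (36 * ?m * R ^ 4))"
    unfolding dbar_smooth_def by (intro order_trans[OF norm_sum sum_mono]) (simp add: norm_mult)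
  also have "\<dots> \<le> ?m * (cmod (peak R j \<zeta>) * (36 * ?m * R ^ 4))"
    unfolding sum_constant using R by (intro mult_right_mono card_le) auto
  finally show ?thesis using pos by (simp add: power2_eq_square algebra_simps)
qed

text \<open>The derivative of the peak function is of size \<open>R\<^sup>8\<close>, but by tangentiality only its part along
  \<open>z - center\<close>, of size \<open>R\<^sup>4\<close>, survives; the terms with the factor \<open>t\<close> cancel.\<close>

lemma theta_peak_form_le:
  fixes R :: real and P :: "'n::{finite,linorder} set"
  assumes R: "1 \<le> R"
  shows "cmod (theta_smooth t (peak_form R j P) K \<zeta>)
    \<le> (if 0 < phase R j \<zeta> then 36 * (real CARD('n option))\<^sup>2 * R ^ 4 * cmod (peak R j \<zeta>) else 0)"
proof (cases "0 < phase R j \<zeta>")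
  case False
  then have "d_zeta k (peak_form R j P J) \<zeta> = 0" "peak_form R j P J \<zeta> = 0" for k J
    unfolding d_zeta_peak_form d_zeta_bump_phase by (simp_all add: bump_def peak_form_def)
  with False show ?thesis by (simp add: theta_smooth_def)
next
  case pos: True
  let ?m = "real CARD('n option)"
  have card_le: "real (card L) \<le> ?m" for L :: "'n option set"
    by (rule of_nat_mono[OF card_mono]) auto
  let ?c = "\<lambda>k. contraction (Some ` P) (insert k K) \<zeta>"
  let ?\<chi> = "bump 0 (phase R j \<zeta>)"
  let ?d = "\<lambda>k. d_zeta k (\<lambda>\<zeta>. complex_of_real (bump 0 (phase R j \<zeta>))) \<zeta>"
  define e where "e k = (case k of None \<Rightarrow> 0 | Some l \<Rightarrow> cnj ((zpart \<zeta> - center R j) $ l))" for k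
  have e: "cmod (e k) \<le> 1 / R ^ 4" for k
  proof (cases k)
    case None
    then show ?thesis using R by (simp add: e_def)
  next
    case (Some l)
    have "cmod ((zpart \<zeta> - center R j) $ l) \<le> norm (zpart \<zeta> - center R j)"
      by (rule Finite_Cartesian_Product.norm_nth_le)
    with phase_pos_bounds(1)[OF R pos] Some show ?thesis
      by (simp only: e_def option.case complex_mod_cnj)
  qed
  have cw: "?c k * d_zeta k (hol_w R j) \<zeta> = ?c k * (- 2 * \<i> * cnj (\<zeta> $ k) + 2 * \<i> * e k)" for k
    by (cases k) (simp_all add: d_zeta_hol_w e_def contraction_eq_0 algebra_simps)
  \<comment> \<open>The second summand collects all multiples of \<open>cnj (\<zeta> $ k)\<close>:
    \<open>2 * R ^ 8\<close> from the peak and \<open>- t\<close> from the weight. The sum over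
    \<open>k\<close> of these is a double contraction, hence 0.\<close>
  have summand: "wedge_sign k (insert k K) * (d_zeta k (peak_form R j P (insert k K)) \<zeta>
      - of_real t * cnj (\<zeta> $ k) * peak_form R j P (insert k K) \<zeta>)
    = peak R j \<zeta> * (wedge_sign k (insert k K) * (?c k / of_real R) * (?d k - 2 * (of_real (?\<chi> * R ^ 8) * e k)))
      + (2 * of_real (R ^ 8) - of_real t) * (of_real ?\<chi> * peak R j \<zeta> / of_real R) *
        (wedge_sign k (insert k K) * cnj (\<zeta> $ k) * ?c k)" for k
  proof -
    have dp: "d_zeta k (peak_form R j P (insert k K)) \<zeta> = peak R j \<zeta> / of_real R *
        (?c k * ?d k + of_real ?\<chi> * \<i> * of_real (R ^ 8) * (?c k * d_zeta k (hol_w R j) \<zeta>))"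
      unfolding d_zeta_peak_form by (simp add: algebra_simps)
    show ?thesis
      unfolding dp cw peak_form_def using R by (simp add: field_simps)
  qed
  have "theta_smooth t (peak_form R j P) K \<zeta>
      = - (\<Sum>k\<in>- K. peak R j \<zeta> * (wedge_sign k (insert k K) * (?c k / of_real R) * (?d k - 2 * (of_real (?\<chi> * R ^ 8) * e k))))"
    unfolding theta_smooth_def summand sum.distrib sum_distrib_left[symmetric] contraction_contraction by simp
  also have "cmod \<dots> \<le> (\<Sum>k\<in>- K. cmod (peak R j \<zeta>) * ((2 * ?m) * (18 * R ^ 4)))"
    unfolding norm_minus_cancel
  proof (intro order_trans[OF norm_sum sum_mono])
    fix k
    have "cmod (2 * (of_real (?\<chi> * R ^ 8) * e k)) \<le> 2 * (1 * R ^ 8 * (1 / R ^ 4))"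
      unfolding norm_mult norm_of_real abs_mult using R e[of k] bump_0_le_1 bump_nonneg
      by (intro mult_mono) auto
    also have "\<dots> = 2 * R ^ 4" using R by (simp add: field_simps flip: power_add)
    finally have "cmod (?d k - 2 * (of_real (?\<chi> * R ^ 8) * e k)) \<le> 18 * R ^ 4"
      using norm_triangle_ineq4[of "?d k" "2 * (of_real (?\<chi> * R ^ 8) * e k)"]
        norm_d_zeta_bump_phase(1)[OF R pos, of k] by linarith
    then show "cmod (peak R j \<zeta> * (wedge_sign k (insert k K) * (?c k / of_real R) * (?d k - 2 * (of_real (?\<chi> * R ^ 8) * e k))))
        \<le> cmod (peak R j \<zeta>) * ((2 * ?m) * (18 * R ^ 4))"
      unfolding norm_mult norm_wedge_sign mult_1
      by (intro mult_left_mono mult_mono norm_contraction_R_le[OF R pos]) auto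
  qed
  also have "\<dots> \<le> ?m * (cmod (peak R j \<zeta>) * ((2 * ?m) * (18 * R ^ 4)))"
    unfolding sum_constant using R by (intro mult_right_mono card_le) auto
  finally show ?thesis using pos by (simp add: power2_eq_square algebra_simps)
qed

text \<open>On the half-size support the phase is at least \<open>1 / 4\<close>, so the bump is at
  least \<open>exp (- 4)\<close>; the peak is at least \<open>exp (- 1)\<close> and the normalized
  contraction at least \<open>1 / 2\<close>. The stated constant is the square of their
  product.\<close>

lemma peak_form_lower:
  assumes R: "1 \<le> R" and j: "j \<in> P" and r: "siegel_r \<zeta> = 0"
    and z: "norm (zpart \<zeta> - center R j) \<le> 1 / (2 * R ^ 4)" and w: "\<bar>Re (hol_w R j \<zeta>)\<bar> \<le> 1 / (2 * R\<^sup>2)"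
  shows "0 < phase R j \<zeta>"
    and "exp (- 10) / 4 \<le> (cmod (peak_form R j P (Some ` (P - {j})) \<zeta>))\<^sup>2"
proof -
  define d where "d = norm (zpart \<zeta> - center R j)"
  have d0: "0 \<le> d" by (simp add: d_def)
  have R1: "1 \<le> R ^ k" for k using R by (rule one_le_power)
  have I: "Im (hol_w R j \<zeta>) = d\<^sup>2" by (simp add: Im_hol_w r d_def)
  have dR: "R ^ 4 * d \<le> 1 / 2" using z R by (simp add: d_def field_simps)
  then have dR2: "R ^ 8 * d\<^sup>2 \<le> 1 / 4"
  proof -
    have "(R ^ 4 * d)\<^sup>2 \<le> (1 / 2)\<^sup>2" using dR d0 R by (intro power_mono) auto
    then show ?thesis by (simp add: power_mult_distrib power_divide flip: power_mult)
  qed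
  have wR: "R ^ 4 * (Re (hol_w R j \<zeta>))\<^sup>2 \<le> 1 / 4"
  proof -
    have "R\<^sup>2 * \<bar>Re (hol_w R j \<zeta>)\<bar> \<le> 1 / 2" using w R by (simp add: field_simps)
    then have "(R\<^sup>2 * \<bar>Re (hol_w R j \<zeta>)\<bar>)\<^sup>2 \<le> (1 / 2)\<^sup>2" using R by (intro power_mono) auto
    then show ?thesis by (simp add: power_mult_distrib power_divide flip: power_mult)
  qed
  have dR4: "R ^ 4 * (d\<^sup>2)\<^sup>2 \<le> 1 / 16"
  proof -
    have "R ^ 4 * d ^ 4 \<le> (R ^ 4) ^ 4 * d ^ 4"
      using R1[of 4] d0 self_le_power[of "R ^ 4" 4] by (intro mult_right_mono) auto
    also have "\<dots> = (R ^ 4 * d) ^ 4" by (simp add: power_mult_distrib)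
    also have "\<dots> \<le> (1 / 2) ^ 4" using dR d0 R by (intro power_mono) auto
    finally show ?thesis by (simp add: power_divide flip: power_mult)
  qed
  have "phase R j \<zeta> = 1 - R ^ 8 * d\<^sup>2 - (R ^ 4 * (Re (hol_w R j \<zeta>))\<^sup>2 + R ^ 4 * (d\<^sup>2)\<^sup>2)"
    by (simp add: phase_def d_def[symmetric] cmod_power2 I algebra_simps)
  then have ph: "1 / 4 \<le> phase R j \<zeta>" using dR2 wR dR4 by linarith
  then show pos: "0 < phase R j \<zeta>" by linarith
  have bump: "exp (- 4) \<le> bump 0 (phase R j \<zeta>)"
    using ph pos by (simp add: bump_def divide_le_eq)
  have pk: "exp (- 1) \<le> cmod (peak R j \<zeta>)" using dR2 by (simp add: norm_peak I)
  have "cmod (\<zeta> $ Some j - of_real R) \<le> d"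
    using Finite_Cartesian_Product.norm_nth_le[of "zpart \<zeta> - center R j" j] by (simp add: d_def center_def)
  moreover have "1 * d \<le> R ^ 4 * d" using R1[of 4] d0 by (intro mult_right_mono) auto
  ultimately have "R / 2 \<le> cmod (\<zeta> $ Some j)"
    using norm_triangle_ineq2[of "complex_of_real R" "\<zeta> $ Some j"] dR R by (simp add: norm_minus_commute)
  then have c: "1 / 2 \<le> cmod (contraction (Some ` P) (Some ` (P - {j})) \<zeta> / of_real R)"
  proof -
    have "Some ` (P - {j}) = Some ` P - {Some j}" by auto
    then have "contraction (Some ` P) (Some ` (P - {j})) \<zeta> = wedge_sign (Some j) (Some ` P) * cnj (\<zeta> $ Some j)"
      using contraction_remove[of "Some j" "Some ` P"] j by simp
    then show ?thesis using \<open>R / 2 \<le> cmod (\<zeta> $ Some j)\<close> R by (simp add: norm_divide norm_mult field_simps)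
  qed
  have "1 / 2 * (exp (- 4) * exp (- 1)) \<le> cmod (peak_form R j P (Some ` (P - {j})) \<zeta>)"
    unfolding peak_form_def norm_mult norm_of_real
    using bump bump_nonneg by (intro mult_mono c pk) auto
  then have "(1 / 2 * (exp (- 4) * exp (- 1)))\<^sup>2 \<le> (cmod (peak_form R j P (Some ` (P - {j})) \<zeta>))\<^sup>2"
    by (intro power_mono) auto
  then show "exp (- 10) / 4 \<le> (cmod (peak_form R j P (Some ` (P - {j})) \<zeta>))\<^sup>2"
    by (simp add: power_mult_distrib power_divide flip: exp_add exp_double exp_of_nat_mult)
qed

section \<open>Failure of the basic estimate\<close>

text \<open>The set is a product sheared along its last coordinate, so by Fubini its volume is that
  of the unsheared product.\<close>

lemma emeasure_slab:
  fixes c :: "'a::euclidean_space" and s :: "'a \<Rightarrow> real"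
  assumes s: "continuous_on UNIV s" and ab: "0 \<le> a" "0 \<le> b"
  defines "A \<equiv> {p. norm (fst p - c) \<le> a \<and> \<bar>snd p - s (fst p)\<bar> \<le> b}"
  shows "A \<in> sets borel" "emeasure lborel A = ennreal (measure lborel (cball c a) * (2 * b))"
proof -
  have "closed ({p. norm (fst p - c) \<le> a} \<inter> {p. \<bar>snd p - s (fst p)\<bar> \<le> b})"
    by (intro closed_Int closed_Collect_le continuous_intros continuous_on_compose2[OF s]) auto
  moreover have "{p. norm (fst p - c) \<le> a} \<inter> {p. \<bar>snd p - s (fst p)\<bar> \<le> b} = A"
    by (auto simp: A_def)
  ultimately show A: "A \<in> sets borel" by (metis borel_closed)
  have "emeasure lborel A = emeasure (lborel \<Otimes>\<^sub>M lborel) A" by (simp add: lborel_prod)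
  also have "\<dots> = (\<integral>\<^sup>+z. emeasure lborel (Pair z -` A) \<partial>lborel)"
    by (rule lborel.emeasure_pair_measure_alt) (unfold lborel_prod sets_lborel, rule A)
  also have "\<dots> = (\<integral>\<^sup>+z. ennreal (2 * b) * indicator (cball c a) z \<partial>lborel)"
  proof (rule nn_integral_cong)
    fix z
    have "Pair z -` A = (if z \<in> cball c a then {s z - b..s z + b} else {})"
      by (auto simp: A_def dist_norm norm_minus_commute)
    then show "emeasure lborel (Pair z -` A) = ennreal (2 * b) * indicator (cball c a) z"
      using ab by simp
  qed
  also have "\<dots> = ennreal (2 * b) * emeasure lborel (cball c a)"
    by (rule nn_integral_cmult_indicator) simp
  also have "\<dots> = ennreal (measure lborel (cball c a) * (2 * b))"
    using ab emeasure_bounded_finite[OF bounded_cball, of c a]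
    by (subst emeasure_eq_ennreal_measure) (auto simp: ennreal_mult' mult.commute)
  finally show "emeasure lborel A = ennreal (measure lborel (cball c a) * (2 * b))" .
qed

lemma nn_integral_exp_decay:
  fixes c :: real
  assumes "0 < c"
  shows "(\<integral>\<^sup>+y. ennreal (exp (- (c * y))) * indicator {0..} y \<partial>lborel) = ennreal (1 / c)"
proof -
  have "((\<lambda>y. exp (- (c * y))) \<longlongrightarrow> 0) at_top"
    using assms by (intro filterlim_compose[OF exp_at_bot] filterlim_uminus_at_bot_at_top filterlim_compose[OF filterlim_uminus_at_bot_at_top]
        filterlim_tendsto_pos_mult_at_top[OF tendsto_const _ filterlim_ident])
  then have lim: "((\<lambda>y. - (exp (- (c * y)) / c)) \<longlongrightarrow> - (0 / c)) at_top"
    using assms by (intro tendsto_intros) auto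
  have "(\<integral>\<^sup>+y. ennreal (exp (- (c * y))) * indicator {0..} y \<partial>lborel) = ennreal (- (0 / c) - (- (exp (- (c * 0)) / c)))"
    by (rule nn_integral_FTC_atLeast[OF _ _ _ lim]) (use assms in \<open>auto intro!: derivative_eq_intros\<close>)
  then show ?thesis by simp
qed

text \<open>In the coordinates \<open>(z, Re w)\<close> the second condition is
  \<open>\<bar>Re (hol_w R j)\<bar> \<le> b\<close>; the term
  \<open>- 2 * R * Im (fst p $ j)\<close> is the shear of the Heisenberg translation.\<close>

definition slab :: "real \<Rightarrow> 'n \<Rightarrow> real \<Rightarrow> real \<Rightarrow> ((complex ^ 'n::finite) \<times> real) set" where
  "slab R j a b = {p. norm (fst p - center R j) \<le> a \<and> \<bar>snd p - (- 2 * R * Im (fst p $ j))\<bar> \<le> b}"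

lemma slab_measure:
  fixes j :: "'n::finite"
  assumes "0 \<le> a" "0 \<le> b"
  shows "slab R j a b \<in> sets borel"
    "emeasure lborel (slab R j a b)
      = ennreal (unit_ball_vol (DIM(complex ^ 'n)) * a ^ DIM(complex ^ 'n) * (2 * b))"
proof -
  have "continuous_on UNIV (\<lambda>z :: complex ^ 'n. - 2 * R * Im (z $ j))"
    by (intro continuous_intros)
  note * = emeasure_slab[OF this assms, of "center R j", folded slab_def]
  then show "slab R j a b \<in> sets borel" by simp
  have "measure lborel (cball (center R j) a) = unit_ball_vol (DIM(complex ^ 'n)) * a ^ DIM(complex ^ 'n)"
    using assms(1) by (rule content_cball)
  then show "emeasure lborel (slab R j a b)
      = ennreal (unit_ball_vol (DIM(complex ^ 'n)) * a ^ DIM(complex ^ 'n) * (2 * b))"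
    using *(2) by simp
qed

lemma Re_hol_w_chart: "Re (hol_w R j (siegel_chart (p, y))) = snd p - (- 2 * R * Im (fst p $ j))"
  by (simp add: hol_w_def siegel_chart_nth)

text \<open>On the support \<open>(norm \<zeta>)\<^sup>2\<close> lies in an interval of length 36,
  so the weight is constant up to the factor \<open>exp (36 * t)\<close>, which is independent of
  \<open>R\<close>.\<close>

lemma weight_bounds:
  assumes "0 \<le> t" "1 \<le> R" "0 < phase R j \<zeta>"
  shows "weight t \<zeta> \<le> exp (36 * t) * exp (- t * (R\<^sup>2 + R ^ 4 + 18))"
    "exp (- t * (R\<^sup>2 + R ^ 4 + 18)) \<le> weight t \<zeta>"
proof -
  have b: "\<bar>(norm \<zeta>)\<^sup>2 - (R\<^sup>2 + R ^ 4)\<bar> \<le> 18" by (rule phase_pos_bounds(4)[OF assms(2,3)])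
  have "t * (R\<^sup>2 + R ^ 4 - 18) \<le> t * (norm \<zeta>)\<^sup>2" "t * (norm \<zeta>)\<^sup>2 \<le> t * (R\<^sup>2 + R ^ 4 + 18)"
    using b assms(1) by (auto intro!: mult_left_mono)
  then show "weight t \<zeta> \<le> exp (36 * t) * exp (- t * (R\<^sup>2 + R ^ 4 + 18))"
    "exp (- t * (R\<^sup>2 + R ^ 4 + 18)) \<le> weight t \<zeta>"
    unfolding weight_def exp_add[symmetric] by (auto simp: algebra_simps)
qed

text \<open>The support lies over a slab in the chart, and at height \<open>y\<close> the squared
  peak is at most \<open>exp (- (2 * R ^ 8 * y))\<close>. Integrating over \<open>y\<close> gives
  \<open>1 / (2 * R ^ 8)\<close>, whose 2 cancels against the height \<open>2 / R\<^sup>2\<close> of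
  the slab. The power of 2 bounds the number of coefficients.\<close>

lemma L2_norm_sq_upper:
  fixes g :: "('n::finite option) form"
  assumes R: "1 \<le> R" and t: "0 \<le> t" and B: "0 \<le> B"
    and g: "\<And>J \<zeta>. cmod (g J \<zeta>) \<le> (if 0 < phase R j \<zeta> then B * cmod (peak R j \<zeta>) else 0)"
  shows "L2_norm_sq siegel t q g \<le> 2 ^ CARD('n option) * B\<^sup>2 * exp (36 * t) * exp (- t * (R\<^sup>2 + R ^ 4 + 18))
    * (unit_ball_vol (DIM(complex ^ 'n)) * (1 / R ^ 4) ^ DIM(complex ^ 'n) / R\<^sup>2) / R ^ 8"
proof -
  define c where "c = 2 ^ CARD('n option) * B\<^sup>2 * (exp (36 * t) * exp (- t * (R\<^sup>2 + R ^ 4 + 18)))"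
  define V where "V = unit_ball_vol (DIM(complex ^ 'n)) * (1 / R ^ 4) ^ DIM(complex ^ 'n)"
  define A where "A = slab R j (1 / R ^ 4) (1 / R\<^sup>2)"
  define F where "F \<zeta> = indicator siegel \<zeta> * ((\<Sum>J | card J = q. (cmod (g J \<zeta>))\<^sup>2) * weight t \<zeta>)" for \<zeta>
  define M where "M = (\<lambda>v :: ((complex ^ 'n) \<times> real) \<times> real.
    ennreal c * (indicator A (fst v) * (ennreal (exp (- (2 * R ^ 8 * snd v))) * indicator {0..} (snd v))))"
  define \<pi> where "\<pi> \<zeta> = ((zpart \<zeta>, Re (\<zeta> $ None)), - siegel_r \<zeta>)" for \<zeta> :: "complex ^ ('n option)"
  have Rp: "0 < R ^ k" for k using R by simp
  have c0: "0 \<le> c" and V0: "0 \<le> V" using R by (auto simp: c_def V_def)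
  have A: "A \<in> sets borel" "emeasure lborel A = ennreal (V * (2 * (1 / R\<^sup>2)))"
    unfolding A_def V_def by (rule slab_measure; use R in simp)+
  have cont: "continuous_on UNIV \<pi>"
    unfolding \<pi>_def by (intro continuous_intros smooth_continuous_on smooth_zpart smooth_siegel_r)
  have chart_\<pi>: "siegel_chart (\<pi> \<zeta>) = \<zeta>" for \<zeta>
  proof -
    have "siegel_chart (\<pi> \<zeta>) $ i = \<zeta> $ i" for i
      by (cases i) (simp_all add: \<pi>_def siegel_chart_nth siegel_r_def complex_eq_iff)
    then show ?thesis by (simp add: vec_eq_iff)
  qed
  have \<pi>_chart: "\<pi> (siegel_chart v) = v" for v
    by (cases v) (simp add: \<pi>_def siegel_chart_nth)
  have M: "M \<in> borel_measurable (borel \<Otimes>\<^sub>M borel)"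
    unfolding M_def using A(1) by measurable
  then have M': "M \<in> borel_measurable borel" by (simp only: borel_prod)
  have M\<pi>: "(\<lambda>\<zeta>. M (\<pi> \<zeta>)) \<in> borel_measurable borel"
    by (rule measurable_compose[OF borel_measurable_continuous_onI[OF cont] M'])
  have "(\<Sum>J | card J = q. g J \<zeta> * cnj (g J \<zeta>)) = of_real (\<Sum>J | card J = q. (cmod (g J \<zeta>))\<^sup>2)" for \<zeta>
    unfolding of_real_sum by (intro sum.cong refl) (rule complex_norm_square[symmetric])
  then have "L2_norm_sq siegel t q g = Re (LINT \<zeta>|lebesgue. complex_of_real (F \<zeta>))"
    unfolding L2_norm_sq_def L2_inner_def set_lebesgue_integral_def F_def by (simp add: scaleR_conv_of_real)
  also have "\<dots> = (LINT \<zeta>|lebesgue. F \<zeta>)"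
    by (simp add: integral_complex_of_real)
  also have "\<dots> \<le> c * (V * (2 * (1 / R\<^sup>2)) * (1 / (2 * R ^ 8)))"
  proof (rule integral_real_bounded)
    have "(\<integral>\<^sup>+\<zeta>. ennreal (F \<zeta>) \<partial>lebesgue) \<le> (\<integral>\<^sup>+\<zeta>. M (\<pi> \<zeta>) \<partial>lebesgue)"
    proof (rule nn_integral_mono)
      fix \<zeta> :: "complex ^ ('n option)"
      show "ennreal (F \<zeta>) \<le> M (\<pi> \<zeta>)"
      proof (cases "\<zeta> \<in> siegel \<and> 0 < phase R j \<zeta>")
        case False
        have "F \<zeta> = 0"
        proof (cases "\<zeta> \<in> siegel")
          case True
          with False g[of _ \<zeta>] have "g J \<zeta> = 0" for J by simp
          then show ?thesis by (simp add: F_def)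
        qed (simp add: F_def)
        then show ?thesis by simp
      next
        case True
        define y where "y = - siegel_r \<zeta>"
        have y: "0 < y" using True by (simp add: y_def siegel_eq)
        have "R ^ 8 * y \<le> R ^ 8 * Im (hol_w R j \<zeta>)"
          using Rp[of 8] by (intro mult_left_mono) (simp_all add: Im_hol_w y_def)
        then have "cmod (peak R j \<zeta>) \<le> exp (- (R ^ 8 * y))"
          by (simp add: norm_peak)
        then have gJ: "(cmod (g J \<zeta>))\<^sup>2 \<le> (B * exp (- (R ^ 8 * y)))\<^sup>2" for J
          using g[of J \<zeta>] True B mult_left_mono[of "cmod (peak R j \<zeta>)" _ B] by (intro power_mono) force+
        have "(\<Sum>J | card J = q. (cmod (g J \<zeta>))\<^sup>2) \<le> (\<Sum>J | card (J :: 'n option set) = q. (B * exp (- (R ^ 8 * y)))\<^sup>2)"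
          by (rule sum_mono) (rule gJ)
        also have "\<dots> \<le> (\<Sum>J\<in>Pow (UNIV :: 'n option set). (B * exp (- (R ^ 8 * y)))\<^sup>2)"
          by (rule sum_mono2) auto
        also have "\<dots> = 2 ^ CARD('n option) * (B * exp (- (R ^ 8 * y)))\<^sup>2"
          by (simp only: sum_constant card_Pow[OF finite] of_nat_power of_nat_numeral)
        finally have S: "(\<Sum>J | card J = q. (cmod (g J \<zeta>))\<^sup>2) \<le> 2 ^ CARD('n option) * (B * exp (- (R ^ 8 * y)))\<^sup>2" .
        have "F \<zeta> \<le> 2 ^ CARD('n option) * (B * exp (- (R ^ 8 * y)))\<^sup>2 * (exp (36 * t) * exp (- t * (R\<^sup>2 + R ^ 4 + 18)))"
          using True weight_bounds(1)[OF t R, of j \<zeta>] weight_pos[of t \<zeta>] by (simp only: F_def indicator_simps mult_1)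
            (intro mult_mono S, auto)
        also have "\<dots> = c * exp (- (2 * R ^ 8 * y))"
          by (simp add: c_def power_mult_distrib exp_double[symmetric] mult_ac)
        finally have F: "F \<zeta> \<le> c * exp (- (2 * R ^ 8 * y))" .
        have "(zpart \<zeta>, Re (\<zeta> $ None)) \<in> A"
          using phase_pos_bounds(1,2)[OF R, of j \<zeta>] True abs_Re_le_cmod[of "hol_w R j \<zeta>"]
          by (simp add: A_def slab_def hol_w_def)
        then have "M (\<pi> \<zeta>) = ennreal (c * exp (- (2 * R ^ 8 * y)))"
          using y c0 by (simp add: M_def \<pi>_def y_def ennreal_mult)
        with F show ?thesis by (simp add: ennreal_leI)
      qed
    qed
    also have "\<dots> = (\<integral>\<^sup>+\<zeta>. M (\<pi> \<zeta>) \<partial>lborel)"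
      using M\<pi> by (simp add: nn_integral_completion)
    also have "\<dots> = (\<integral>\<^sup>+\<zeta>. M (\<pi> \<zeta>) \<partial>distr lborel borel siegel_chart)"
      unfolding lborel_distr_siegel_chart ..
    also have "\<dots> = (\<integral>\<^sup>+v. M v \<partial>lborel)"
      using M\<pi> by (subst nn_integral_distr) (auto simp: \<pi>_chart)
    also have "\<dots> = (\<integral>\<^sup>+v. M v \<partial>(lborel \<Otimes>\<^sub>M lborel))" by (simp add: lborel_prod)
    also have "\<dots> = (\<integral>\<^sup>+p. \<integral>\<^sup>+y. M (p, y) \<partial>lborel \<partial>lborel)"
      using M' by (subst lborel.nn_integral_fst[symmetric]) (auto simp: lborel_prod)
    also have "\<dots> = (\<integral>\<^sup>+p. ennreal c * ennreal (1 / (2 * R ^ 8)) * indicator A p \<partial>lborel)"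
    proof (rule nn_integral_cong)
      fix p
      have "(\<integral>\<^sup>+y. M (p, y) \<partial>lborel) = (\<integral>\<^sup>+y. (ennreal c * indicator A p) * (ennreal (exp (- (2 * R ^ 8 * y))) * indicator {0..} y) \<partial>lborel)"
        by (simp add: M_def mult_ac)
      also have "\<dots> = (ennreal c * indicator A p) * ennreal (1 / (2 * R ^ 8))"
        using Rp[of 8] by (subst nn_integral_cmult) (auto simp: nn_integral_exp_decay)
      finally show "(\<integral>\<^sup>+y. M (p, y) \<partial>lborel) = ennreal c * ennreal (1 / (2 * R ^ 8)) * indicator A p"
        by (simp add: mult_ac)
    qed
    also have "\<dots> = ennreal c * ennreal (1 / (2 * R ^ 8)) * ennreal (V * (2 * (1 / R\<^sup>2)))"
      using A by (simp add: nn_integral_cmult_indicator)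
    also have "\<dots> = ennreal (c * (V * (2 * (1 / R\<^sup>2)) * (1 / (2 * R ^ 8))))"
      using c0 V0 R by (simp add: ennreal_mult[symmetric] mult_ac)
    finally show "(\<integral>\<^sup>+\<zeta>. ennreal (F \<zeta>) \<partial>lebesgue) \<le> ennreal (c * (V * (2 * (1 / R\<^sup>2)) * (1 / (2 * R ^ 8))))" .
    show "0 \<le> c * (V * (2 * (1 / R\<^sup>2)) * (1 / (2 * R ^ 8)))" using c0 V0 R by simp
  qed
  finally show ?thesis by (simp add: c_def V_def mult_ac)
qed

text \<open>Integration over the slab of half the size, where \<open>peak_form_lower\<close>
  applies. The leading \<open>R\<close> bounds the area density \<open>siegel_s\<close> from below
  and is the only factor growing relative to \<open>L2_norm_sq_upper\<close>.\<close>

lemma boundary_integral_lower: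
  fixes P :: "'n::{finite,linorder} set"
  assumes R: "1 \<le> R" and t: "0 \<le> t" and j: "j \<in> P" and P: "card P = Suc q"
  shows "ennreal (R * (exp (- 10) / 4) * exp (- t * (R\<^sup>2 + R ^ 4 + 18))
      * (unit_ball_vol (DIM((complex, 'n) vec)) * (1 / (2 * R ^ 4)) ^ DIM((complex, 'n) vec) / R\<^sup>2))
    \<le> (\<integral>\<^sup>+p\<in>frontier siegel. ennreal ((\<Sum>J | card J = q. (cmod (peak_form R j P J p))\<^sup>2) * weight t p) \<partial>siegel_surface_measure)"
proof -
  define c where "c = R * (exp (- 10) / 4) * exp (- t * (R\<^sup>2 + R ^ 4 + 18))"
  define V where "V = unit_ball_vol (DIM((complex, 'n) vec)) * (1 / (2 * R ^ 4)) ^ DIM((complex, 'n) vec)"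
  define A where "A = slab R j (1 / (2 * R ^ 4)) (1 / (2 * R\<^sup>2))"
  define F where "F \<zeta> = (\<Sum>J | card J = q. (cmod (peak_form R j P J \<zeta>))\<^sup>2) * weight t \<zeta>" for \<zeta>
  have c0: "0 \<le> c" and V0: "0 \<le> V" using R by (auto simp: c_def V_def)
  have A: "A \<in> sets borel" "emeasure lborel A = ennreal (V * (2 * (1 / (2 * R\<^sup>2))))"
    unfolding A_def V_def by (rule slab_measure; use R in simp)+
  have F[measurable]: "F \<in> borel_measurable borel"
    unfolding F_def by (intro borel_measurable_continuous_onI continuous_intros smooth_continuous_on
        smooth_peak_form continuous_on_weight)
  have "ennreal (c * (V * (2 * (1 / (2 * R\<^sup>2))))) = ennreal c * emeasure lborel A"
    unfolding A(2) by (rule ennreal_mult'[OF c0])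
  also have "\<dots> = (\<integral>\<^sup>+p. ennreal c * indicator A p \<partial>lborel)"
    by (rule nn_integral_cmult_indicator[symmetric]) (simp add: A)
  also have "\<dots> \<le> (\<integral>\<^sup>+p. ennreal (siegel_s (siegel_graph p)) * ennreal (F (siegel_graph p)) \<partial>lborel)"
  proof (rule nn_integral_mono)
    fix p :: "((complex, 'n) vec) \<times> real"
    let ?\<zeta> = "siegel_graph p"
    show "ennreal c * indicator A p \<le> ennreal (siegel_s ?\<zeta>) * ennreal (F ?\<zeta>)"
    proof (cases "p \<in> A")
      case True
      have z: "norm (zpart ?\<zeta> - center R j) \<le> 1 / (2 * R ^ 4)" "\<bar>Re (hol_w R j ?\<zeta>)\<bar> \<le> 1 / (2 * R\<^sup>2)"
        using True unfolding A_def slab_def siegel_graph_eq Re_hol_w_chart by simp_all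
      have r: "siegel_r ?\<zeta> = 0" by (simp add: siegel_graph_eq)
      note low = peak_form_lower[OF R j r z]
      have "exp (- 10) / 4 \<le> (\<Sum>J | card J = q. (cmod (peak_form R j P J ?\<zeta>))\<^sup>2)"
      proof -
        have "card (Some ` (P - {j})) = q" using j P by (simp add: card_image)
        then have "(cmod (peak_form R j P (Some ` (P - {j})) ?\<zeta>))\<^sup>2 \<le> (\<Sum>J | card J = q. (cmod (peak_form R j P J ?\<zeta>))\<^sup>2)"
          by (intro member_le_sum) auto
        with low(2) show ?thesis by linarith
      qed
      then have "exp (- 10) / 4 * exp (- t * (R\<^sup>2 + R ^ 4 + 18)) \<le> F ?\<zeta>"
        unfolding F_def by (intro mult_mono weight_bounds(2)[OF t R low(1)]) (auto intro: sum_nonneg)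
      moreover have "R \<le> siegel_s ?\<zeta>"
      proof -
        have "1 / (2 * R ^ 4) \<le> (1 / 2 :: real)" using R one_le_power[OF R, of 4] by (simp add: field_simps)
        then have "R - 1 / 2 \<le> norm (zpart ?\<zeta>)"
          using z(1) norm_triangle_ineq2[of "center R j" "zpart ?\<zeta>"] R
          unfolding norm_center norm_minus_commute[of "center R j"] by linarith
        then show ?thesis using siegel_s_ge(2)[of ?\<zeta>] R by linarith
      qed
      ultimately have "R * (exp (- 10) / 4 * exp (- t * (R\<^sup>2 + R ^ 4 + 18))) \<le> siegel_s ?\<zeta> * F ?\<zeta>"
        using R siegel_s_pos[of ?\<zeta>] by (intro mult_mono) auto
      then have "c \<le> siegel_s ?\<zeta> * F ?\<zeta>" by (simp add: c_def mult_ac)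
      then show ?thesis
        using True siegel_s_pos[of ?\<zeta>] by (simp add: ennreal_mult'[symmetric] ennreal_leI)
    qed simp
  qed
  also have "\<dots> = (\<integral>\<^sup>+p. ennreal (F p) * indicator (frontier siegel) p \<partial>siegel_surface_measure)"
    unfolding siegel_surface_measure_eq
    by (subst nn_integral_distr; (subst nn_integral_density)?) (auto simp: siegel_graph_frontier)
  finally show ?thesis by (simp add: c_def V_def F_def)
qed

lemma basic_estimate_fails:
  assumes q: "1 \<le> q" "q \<le> CARD('n::{finite,linorder}) - 1" and t: "0 \<le> t" and C: "0 < C"
  shows "\<not> basic_estimate (siegel :: (complex ^ ('n option)) set) siegel_surface_measure q t C"
proof
  assume est: "basic_estimate (siegel :: (complex ^ ('n option)) set) siegel_surface_measure q t C"
  have "Suc q \<le> CARD('n)" using q by linarith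
  then obtain P :: "'n set" where P: "card P = Suc q"
    using obtain_subset_with_card_n by blast
  then obtain j where j: "j \<in> P" by fastforce
  define m where "m = real CARD('n option)"
  define k1 :: real where "k1 = exp (- 10) / 4 * (1 / 2) ^ DIM((complex, 'n) vec)"
  define k2 where "k2 = 2 ^ CARD('n option) * (36 * m\<^sup>2)\<^sup>2 * exp (36 * t)"
  have k: "0 < k1" "0 \<le> k2" by (simp_all add: k1_def k2_def)
  have key: "R * k1 \<le> C * (2 * k2)" if R: "1 \<le> R" for R :: real
  proof -
    \<comment> \<open>\<open>X\<close> collects the weight and the slab volume, which both sides
      share. It depends on \<open>R\<close>, but \<open>k1\<close> and \<open>k2\<close> do
      not.\<close>
    define X where "X = exp (- t * (R\<^sup>2 + R ^ 4 + 18)) * (unit_ball_vol (DIM((complex, 'n) vec)) * (1 / R ^ 4) ^ DIM((complex, 'n) vec) / R\<^sup>2)"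
    have X: "0 < X" using R by (simp add: X_def)
    let ?f = "peak_form R j P"
    let ?g = "dbar_smooth ?f"
    let ?u = "theta_smooth t ?f"
    have B: "0 \<le> 36 * m\<^sup>2 * R ^ 4" using R by (simp add: m_def)
    have up: "L2_norm_sq siegel t q' h \<le> k2 * X"
      if "\<And>J \<zeta>. cmod (h J \<zeta>) \<le> (if 0 < phase R j \<zeta> then 36 * m\<^sup>2 * R ^ 4 * cmod (peak R j \<zeta>) else 0)"
      for q' and h :: "('n option) form"
    proof -
      \<comment> \<open>Here the scales balance: the square of the derivative bound
        \<open>R ^ 4\<close> is exactly offset by the gain \<open>1 / R ^ 8\<close> from integrating
        across the boundary.\<close>
      have eq: "(36 * m\<^sup>2 * R ^ 4)\<^sup>2 / R ^ 8 = (36 * m\<^sup>2)\<^sup>2"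
        using R by (simp add: power_mult_distrib flip: power_mult)
      have reorder: "a * b * c * d * w / e = a * (b / e) * c * (d * w)" for a b c d w e :: real
        by simp
      show ?thesis
        using L2_norm_sq_upper[where g = h, OF R t B that, of q']
        unfolding reorder eq k2_def X_def by simp
    qed
    have "has_dbar siegel t q ?f ?g"
      by (intro has_dbar_smooth smooth_peak_form compact_support_peak_form R open_siegel)
    moreover have "has_dbar_adjoint siegel t (q - 1) ?f ?u"
      by (intro has_dbar_adjoint_tangential smooth_peak_form compact_support_peak_form R peak_form_tangential)
    moreover have "has_boundary_values siegel siegel_surface_measure q ?f ?f"
      by (intro has_boundary_values_continuous smooth_continuous_on smooth_peak_form)
    ultimately have "(\<integral>\<^sup>+p\<in>frontier siegel. ennreal ((\<Sum>J | card J = q. (cmod (?f J p))\<^sup>2) * weight t p) \<partial>siegel_surface_measure)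
        \<le> ennreal (C * (L2_norm_sq siegel t (q + 1) ?g + L2_norm_sq siegel t (q - 1) ?u))"
      using est unfolding basic_estimate_def by blast
    also have "\<dots> \<le> ennreal (C * (k2 * X + k2 * X))"
    proof (intro ennreal_leI mult_left_mono add_mono up)
      show "cmod (?g J \<zeta>) \<le> (if 0 < phase R j \<zeta> then 36 * m\<^sup>2 * R ^ 4 * cmod (peak R j \<zeta>) else 0)" for J \<zeta>
        unfolding m_def by (rule dbar_peak_form_le[OF R])
      show "cmod (?u J \<zeta>) \<le> (if 0 < phase R j \<zeta> then 36 * m\<^sup>2 * R ^ 4 * cmod (peak R j \<zeta>) else 0)" for J \<zeta>
        unfolding m_def by (rule theta_peak_form_le[OF R])
    qed (use C in simp)
    finally have "ennreal (R * (exp (- 10) / 4) * exp (- t * (R\<^sup>2 + R ^ 4 + 18))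
      * (unit_ball_vol (DIM((complex, 'n) vec)) * (1 / (2 * R ^ 4)) ^ DIM((complex, 'n) vec) / R\<^sup>2)) \<le> ennreal (C * (k2 * X + k2 * X))"
      using boundary_integral_lower[OF R t j P] by (rule order_trans[rotated])
    also have "R * (exp (- 10) / 4) * exp (- t * (R\<^sup>2 + R ^ 4 + 18))
      * (unit_ball_vol (DIM((complex, 'n) vec)) * (1 / (2 * R ^ 4)) ^ DIM((complex, 'n) vec) / R\<^sup>2) = (R * k1) * X"
      by (simp add: k1_def X_def power_divide power_mult_distrib)
    finally have "(R * k1) * X \<le> C * (k2 * X + k2 * X)"
      using X k R C by (subst (asm) ennreal_le_iff) auto
    also have "\<dots> = (C * (2 * k2)) * X" by (simp add: algebra_simps)
    finally show ?thesis using X by simp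
  qed
  \<comment> \<open>The summand 1 ensures \<open>1 \<le> R\<close> and makes the left side of
    \<open>key\<close> exceed the right side by \<open>k1\<close>.\<close>
  define R where "R = C * (2 * k2) / k1 + 1"
  have "1 \<le> R" using C k by (simp add: R_def)
  then have "R * k1 \<le> C * (2 * k2)" by (rule key)
  moreover have "R * k1 = C * (2 * k2) + k1"
    using k by (simp add: R_def distrib_right)
  ultimately show False using k by linarith
qed

theorem theorem2p10:
  "admits_uniformly_smooth_defining_function (siegel :: (complex ^ ('n::{finite,linorder} option)) set) \<and>
   strictly_pseudoconvex (siegel :: (complex ^ ('n option)) set) \<and>
   \<not> uniformly_strictly_pseudoconvex (siegel :: (complex ^ ('n option)) set) \<and>
   (\<forall>q::nat. \<forall>t::real. 1 \<le> q \<and> q \<le> CARD('n) - 1 \<and> 0 \<le> t \<longrightarrow>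
      \<not> (\<exists>C>0. basic_estimate (siegel :: (complex ^ ('n option)) set) siegel_surface_measure q t C))"
  using admits_uniformly_smooth_defining_function_siegel strictly_pseudoconvex_siegel
    not_uniformly_strictly_pseudoconvex_siegel basic_estimate_fails by blast

end
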